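(* Let $G$ be a group and $M$ a left $K_{\mathrm{par}}(G)$-module. Then $H^0_{par}(G,M)\cong Z^0_{par}(G,M)$ and, for every $n\in\mathbb N$ ($n\ge1$), $H^n_{par}(G,M)\cong Z^n_{par}(G,M)/B^n_{par}(G,M)$.
   Context: $K$ is a commutative unital ring. $\mathcal S(G)$ is the monoid generated by symbols $[g]$, $g\in G$, with relations $[g^{-1}][g][h]=[g^{-1}][gh]$, $[g][h][h^{-1}]=[gh][h^{-1}]$, $[g][1_G]=[g]$ (so $[1_G]$ is the identity). It is an inverse monoid; $s^{-1}$ denotes the inverse of $s$ and $E(\mathcal S(G))$ the semilattice of idempotents. $e_g=[g][g^{-1}]$ and $e_{(g_1,\dots,g_n)}=e_{g_1}e_{g_1g_2}\cdots e_{g_1\cdots g_n}$. $K_{\mathrm{par}}(G)=K\mathcal S(G)$ is the semigroup algebra. $B=KE(\mathcal S(G))$ is the left $K_{\mathrm{par}}(G)$-module with $s\cdot e=ses^{-1}$ for $s\in\mathcal S(G)$, $e\in E(\mathcal S(G))$. The cohomology of Alvares, Alves and Redondo is $H^n_{par}(G,M)=\mathrm{Ext}^n_{K_{\mathrm{par}}(G)}(B,M)$. $C^0_{par}(G,M)=M$ and $C^n_{par}(G,M)=\{f:G^n\to M\mid f(g_1,\dots,g_n)\in e_{(g_1,\dots,g_n)}\cdot M\}$ for $n\ge1$. The maps $\delta^n:C^n_{par}(G,M)\to C^{n+1}_{par}(G,M)$ are $(\delta^0m)(g)=[g]\cdot m-e_g\cdot m$ and, for $n\ge1$, $$(\delta^nf)(g_1,\dots,g_{n+1})=[g_1]\cdot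 f(g_2,\dots,g_{n+1})+\sum_{i=1}^n(-1)^ie_{g_1\cdots g_i}\cdot f(g_1,\dots,g_ig_{i+1},\dots,g_{n+1})+(-1)^{n+1}e_{g_1\cdots g_{n+1}}\cdot f(g_1,\dots,g_n).$$ $Z^n_{par}(G,M)=\ker\delta^n$ for $n\ge0$ and $B^n_{par}(G,M)=\mathrm{im}\,\delta^{n-1}$ for $n\ge1$. *)

theory Defs
  imports "HOL-Algebra.Module" "HOL-Algebra.AbelCoset"
begin

section \<open>Left modules over a ring\<close>

text \<open>
  The locale \<open>module\<close> of HOL-Algebra is restricted to commutative rings of scalars. Modules are
  records of type \<open>module\<close>, which extends \<open>ring\<close>; the fields \<open>mult\<close> and \<open>one\<close> of a left module
  carry no meaning.
\<close>

locale left_module = R?: ring R + M?: abelian_group M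
  for R :: "('r, 'x) ring_scheme" (structure) and M :: "('r, 'm, 'y) module_scheme" (structure) +
  assumes smult_closed:
      "\<lbrakk>a \<in> carrier R; x \<in> carrier M\<rbrakk> \<Longrightarrow> a \<odot>\<^bsub>M\<^esub> x \<in> carrier M"
    and smult_l_distr:
      "\<lbrakk>a \<in> carrier R; b \<in> carrier R; x \<in> carrier M\<rbrakk> \<Longrightarrow>
        (a \<oplus>\<^bsub>R\<^esub> b) \<odot>\<^bsub>M\<^esub> x = a \<odot>\<^bsub>M\<^esub> x \<oplus>\<^bsub>M\<^esub> b \<odot>\<^bsub>M\<^esub> x"
    and smult_r_distr:
      "\<lbrakk>a \<in> carrier R; x \<in> carrier M; y \<in> carrier M\<rbrakk> \<Longrightarrow>
        a \<odot>\<^bsub>M\<^esub> (x \<oplus>\<^bsub>M\<^esub> y) = a \<odot>\<^bsub>M\<^esub> x \<oplus>\<^bsub>M\<^esub> a \<odot>\<^bsub>M\<^esub> y"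
    and smult_assoc1:
      "\<lbrakk>a \<in> carrier R; b \<in> carrier R; x \<in> carrier M\<rbrakk> \<Longrightarrow>
        (a \<otimes>\<^bsub>R\<^esub> b) \<odot>\<^bsub>M\<^esub> x = a \<odot>\<^bsub>M\<^esub> (b \<odot>\<^bsub>M\<^esub> x)"
    and smult_one:
      "x \<in> carrier M \<Longrightarrow> \<one>\<^bsub>R\<^esub> \<odot>\<^bsub>M\<^esub> x = x"

definition mod_hom ::
    "('r, 'x) ring_scheme \<Rightarrow> ('r, 'a, 'y) module_scheme \<Rightarrow> ('r, 'b, 'z) module_scheme \<Rightarrow> ('a \<Rightarrow> 'b) set"
  where "mod_hom R M N = {f \<in> carrier M \<rightarrow> carrier N.
    (\<forall>x\<in>carrier M. \<forall>y\<in>carrier M. f (x \<oplus>\<^bsub>M\<^esub> y) = f x \<oplus>\<^bsub>N\<^esub> f y) \<and>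
    (\<forall>r\<in>carrier R. \<forall>x\<in>carrier M. f (r \<odot>\<^bsub>M\<^esub> x) = r \<odot>\<^bsub>N\<^esub> f x)}"

definition mod_isomorphic ::
    "('r, 'x) ring_scheme \<Rightarrow> ('r, 'a, 'y) module_scheme \<Rightarrow> ('r, 'b, 'z) module_scheme \<Rightarrow> bool"
  where "mod_isomorphic R M N \<longleftrightarrow>
    (\<exists>f \<in> mod_hom R M N. bij_betw f (carrier M) (carrier N))"

definition submodule_of :: "('r, 'a, 'y) module_scheme \<Rightarrow> 'a set \<Rightarrow> ('r, 'a) module"
  where "submodule_of M N = \<lparr>carrier = N, mult = undefined, one = undefined,
    zero = \<zero>\<^bsub>M\<^esub>, add = add M, smult = smult M\<rparr>"

definition quot_module :: "('r, 'a, 'y) module_scheme \<Rightarrow> 'a set \<Rightarrow> ('r, 'a set) module"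
  where "quot_module M N = \<lparr>carrier = a_rcosets\<^bsub>M\<^esub> N, mult = undefined, one = undefined,
    zero = N, add = set_add M, smult = (\<lambda>r X. \<Union>x\<in>X. N +>\<^bsub>M\<^esub> (r \<odot>\<^bsub>M\<^esub> x))\<rparr>"

text \<open>A set \<open>F\<close> of maps \<open>X \<rightarrow> M\<close> with the pointwise operations; the maps are undefined off \<open>X\<close>.\<close>

definition map_module ::
    "'x set \<Rightarrow> ('x \<Rightarrow> 'a) set \<Rightarrow> ('r, 'a, 'y) module_scheme \<Rightarrow> ('r, 'x \<Rightarrow> 'a) module"
  where "map_module X F M = \<lparr>carrier = F \<inter> extensional X, mult = undefined, one = undefined,
    zero = (\<lambda>x\<in>X. \<zero>\<^bsub>M\<^esub>), add = (\<lambda>f g. \<lambda>x\<in>X. f x \<oplus>\<^bsub>M\<^esub> g x),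
    smult = (\<lambda>r f. \<lambda>x\<in>X. r \<odot>\<^bsub>M\<^esub> f x)\<rparr>"

text \<open>
  An algebra \<open>R\<close> over \<open>K\<close> is a record \<open>R\<close> of type \<open>module\<close> whose scalar multiplication is that
  of \<open>K\<close>. Every left \<open>R\<close>-module is a \<open>K\<close>-module via \<open>k \<mapsto> k 1\<^sub>R\<close>.
\<close>

definition restrict_scalars ::
    "('k, 'r, 'y) module_scheme \<Rightarrow> ('r, 'a, 'z) module_scheme \<Rightarrow> ('k, 'a) module"
  where "restrict_scalars R M = \<lparr>carrier = carrier M, mult = undefined, one = undefined,
    zero = \<zero>\<^bsub>M\<^esub>, add = add M, smult = (\<lambda>k x. (k \<odot>\<^bsub>R\<^esub> \<one>\<^bsub>R\<^esub>) \<odot>\<^bsub>M\<^esub> x)\<rparr>"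

definition fsupp :: "('r, 'y) ring_scheme \<Rightarrow> ('x \<Rightarrow> 'r) \<Rightarrow> 'x set"
  where "fsupp R f = {x. f x \<noteq> \<zero>\<^bsub>R\<^esub>}"

text \<open>The free left module on \<open>X\<close>: finitely supported functions, vanishing off \<open>X\<close>.\<close>

definition free_module :: "('r, 'y) ring_scheme \<Rightarrow> 'x set \<Rightarrow> ('r, 'x \<Rightarrow> 'r) module"
  where "free_module R X = \<lparr>carrier = {f \<in> UNIV \<rightarrow> carrier R. finite (fsupp R f) \<and> fsupp R f \<subseteq> X},
    mult = undefined, one = undefined, zero = (\<lambda>x. \<zero>\<^bsub>R\<^esub>), add = (\<lambda>f g x. f x \<oplus>\<^bsub>R\<^esub> g x),
    smult = (\<lambda>r f x. r \<otimes>\<^bsub>R\<^esub> f x)\<rparr>"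

definition free_basis :: "('r, 'y) ring_scheme \<Rightarrow> 'x \<Rightarrow> 'x \<Rightarrow> 'r"
  where "free_basis R x = (\<lambda>y. if y = x then \<one>\<^bsub>R\<^esub> else \<zero>\<^bsub>R\<^esub>)"

definition free_lift ::
    "('r, 'y) ring_scheme \<Rightarrow> ('r, 'a, 'z) module_scheme \<Rightarrow> ('x \<Rightarrow> 'a) \<Rightarrow> ('x \<Rightarrow> 'r) \<Rightarrow> 'a"
  where "free_lift R M \<phi> f = (\<Oplus>\<^bsub>M\<^esub>x\<in>fsupp R f. f x \<odot>\<^bsub>M\<^esub> \<phi> x)"


section \<open>Ext\<close>

text \<open>
  Ext is computed from a fixed functorial free resolution
  \<open>\<dots> \<rightarrow> F\<^sub>2 \<rightarrow> F\<^sub>1 \<rightarrow> F\<^sub>0 \<rightarrow> A \<rightarrow> 0\<close>: \<open>F\<^sub>0\<close> is free on the elements of \<open>A\<close>, and \<open>F\<^sub>n\<^sub>+\<^sub>1\<close> is free on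
  (expressions for) the elements of the kernel of the map leaving \<open>F\<^sub>n\<close>. For all \<open>F\<^sub>n\<close> to live in
  one type, the basis elements are trees: \<open>Elem a\<close> is the basis element of \<open>F\<^sub>0\<close> mapped to \<open>a\<close>,
  and \<open>Comb [(r\<^sub>1, x\<^sub>1), \<dots>, (r\<^sub>k, x\<^sub>k)]\<close> the one of \<open>F\<^sub>n\<^sub>+\<^sub>1\<close> mapped to \<open>r\<^sub>1 x\<^sub>1 + \<dots> + r\<^sub>k x\<^sub>k\<close>.
  Exactness is proved in \<open>res_aug_surj\<close> and \<open>res_exact\<close> below.
\<close>

datatype ('r, 'a) res_gen = Elem (res_elem: 'a) | Comb (res_comb: "('r \<times> ('r, 'a) res_gen) list")

fun lin_comb :: "('r, 'y) ring_scheme \<Rightarrow> ('r \<times> 'x) list \<Rightarrow> 'x \<Rightarrow> 'r"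
  where
    "lin_comb R [] = (\<lambda>x. \<zero>\<^bsub>R\<^esub>)"
  | "lin_comb R ((r, x) # l) = (\<lambda>y. r \<otimes>\<^bsub>R\<^esub> free_basis R x y \<oplus>\<^bsub>R\<^esub> lin_comb R l y)"

text \<open>\<open>res_bd R X\<close> is the differential from \<open>F\<^sub>n\<^sub>+\<^sub>1\<close> to \<open>F\<^sub>n\<close>, where \<open>X\<close> is the basis of \<open>F\<^sub>n\<close>.\<close>

definition res_aug ::
    "('r, 'y) ring_scheme \<Rightarrow> ('r, 'a, 'z) module_scheme \<Rightarrow> (('r, 'a) res_gen \<Rightarrow> 'r) \<Rightarrow> 'a"
  where "res_aug R A = free_lift R A res_elem"

definition res_bd ::
    "('r, 'y) ring_scheme \<Rightarrow> ('r, 'a) res_gen set \<Rightarrow>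
      (('r, 'a) res_gen \<Rightarrow> 'r) \<Rightarrow> ('r, 'a) res_gen \<Rightarrow> 'r"
  where "res_bd R X = free_lift R (free_module R X) (\<lambda>x. lin_comb R (res_comb x))"

fun res_basis ::
    "('r, 'y) ring_scheme \<Rightarrow> ('r, 'a, 'z) module_scheme \<Rightarrow> nat \<Rightarrow> ('r, 'a) res_gen set"
  where
    "res_basis R A 0 = Elem ` carrier A"
  | "res_basis R A (Suc 0) =
      Comb ` {l \<in> lists (carrier R \<times> res_basis R A 0).
        res_aug R A (lin_comb R l) = \<zero>\<^bsub>A\<^esub>}"
  | "res_basis R A (Suc (Suc n)) =
      Comb ` {l \<in> lists (carrier R \<times> res_basis R A (Suc n)).
        res_bd R (res_basis R A n) (lin_comb R l) = \<zero>\<^bsub>free_module R (res_basis R A n)\<^esub>}"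

definition res_mod ::
    "('r, 'y) ring_scheme \<Rightarrow> ('r, 'a, 'z) module_scheme \<Rightarrow> nat \<Rightarrow>
      ('r, ('r, 'a) res_gen \<Rightarrow> 'r) module"
  where "res_mod R A n = free_module R (res_basis R A n)"

text \<open>\<open>res_diff R A n\<close> is the differential from \<open>F\<^sub>n\<^sub>+\<^sub>1\<close> to \<open>F\<^sub>n\<close>.\<close>

definition res_diff ::
    "('r, 'y) ring_scheme \<Rightarrow> ('r, 'a, 'z) module_scheme \<Rightarrow> nat \<Rightarrow>
      (('r, 'a) res_gen \<Rightarrow> 'r) \<Rightarrow> ('r, 'a) res_gen \<Rightarrow> 'r"
  where "res_diff R A n = res_bd R (res_basis R A n)"

text \<open>For a \<open>K\<close>-algebra \<open>R\<close>, the \<open>K\<close>-modules \<open>Hom\<^sub>R(F\<^sub>n, M)\<close> and the cohomology of this complex.\<close>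

definition hom_module ::
    "('k, 'r, 'w) module_scheme \<Rightarrow> ('r, 'a, 'y) module_scheme \<Rightarrow> ('r, 'b, 'z) module_scheme \<Rightarrow>
      ('k, 'a \<Rightarrow> 'b) module"
  where "hom_module R P M =
    map_module (carrier P) (mod_hom R P M) (restrict_scalars R M)"

definition Ext_diff ::
    "('k, 'r, 'w) module_scheme \<Rightarrow> ('r, 'a, 'y) module_scheme \<Rightarrow> nat \<Rightarrow>
      ((('r, 'a) res_gen \<Rightarrow> 'r) \<Rightarrow> 'b) \<Rightarrow> (('r, 'a) res_gen \<Rightarrow> 'r) \<Rightarrow> 'b"
  where "Ext_diff R A n f = (\<lambda>x\<in>carrier (res_mod R A (Suc n)). f (res_diff R A n x))"

definition Ext_cocycles ::
    "('k, 'r, 'w) module_scheme \<Rightarrow> ('r, 'a, 'y) module_scheme \<Rightarrow> ('r, 'b, 'z) module_scheme \<Rightarrow>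
      nat \<Rightarrow> ((('r, 'a) res_gen \<Rightarrow> 'r) \<Rightarrow> 'b) set"
  where "Ext_cocycles R A M n =
    {f \<in> carrier (hom_module R (res_mod R A n) M).
      Ext_diff R A n f = \<zero>\<^bsub>hom_module R (res_mod R A (Suc n)) M\<^esub>}"

fun Ext_coboundaries ::
    "('k, 'r, 'w) module_scheme \<Rightarrow> ('r, 'a, 'y) module_scheme \<Rightarrow> ('r, 'b, 'z) module_scheme \<Rightarrow>
      nat \<Rightarrow> ((('r, 'a) res_gen \<Rightarrow> 'r) \<Rightarrow> 'b) set"
  where
    "Ext_coboundaries R A M 0 = {\<zero>\<^bsub>hom_module R (res_mod R A 0) M\<^esub>}"
  | "Ext_coboundaries R A M (Suc n) =
      Ext_diff R A n ` carrier (hom_module R (res_mod R A n) M)"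

definition Ext ::
    "('k, 'r, 'w) module_scheme \<Rightarrow> ('r, 'a, 'y) module_scheme \<Rightarrow> ('r, 'b, 'z) module_scheme \<Rightarrow>
      nat \<Rightarrow> ('k, ((('r, 'a) res_gen \<Rightarrow> 'r) \<Rightarrow> 'b) set) module"
  where "Ext R A M n =
    quot_module (submodule_of (hom_module R (res_mod R A n) M) (Ext_cocycles R A M n))
      (Ext_coboundaries R A M n)"


section \<open>The monoid \<open>S(G)\<close> and the partial group algebra\<close>

inductive exel_rel :: "('g, 'x) monoid_scheme \<Rightarrow> 'g list \<Rightarrow> 'g list \<Rightarrow> bool"
  for G (structure)
  where
    "\<lbrakk>g \<in> carrier G; h \<in> carrier G\<rbrakk> \<Longrightarrow> exel_rel G [inv g, g, h] [inv g, g \<otimes> h]"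
  | "\<lbrakk>g \<in> carrier G; h \<in> carrier G\<rbrakk> \<Longrightarrow> exel_rel G [g, h, inv h] [g \<otimes> h, inv h]"
  | "g \<in> carrier G \<Longrightarrow> exel_rel G [g, \<one>] [g]"

text \<open>
  The words are nonempty: the relations make \<open>[1\<^sub>G]\<close> the identity of the semigroup they present,
  whereas an empty word would remain a further identity, different from \<open>[1\<^sub>G]\<close>.
\<close>

definition exel_words :: "('g, 'x) monoid_scheme \<Rightarrow> 'g list set"
  where "exel_words G = lists (carrier G) - {[]}"

inductive_set exel_cong :: "('g, 'x) monoid_scheme \<Rightarrow> ('g list \<times> 'g list) set"
  for G
  where
    exel_cong_rel: "exel_rel G u v \<Longrightarrow> (u, v) \<in> exel_cong G"
  | exel_cong_refl: "u \<in> exel_words G \<Longrightarrow> (u, u) \<in> exel_cong G"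
  | exel_cong_sym: "(u, v) \<in> exel_cong G \<Longrightarrow> (v, u) \<in> exel_cong G"
  | exel_cong_trans: "\<lbrakk>(u, v) \<in> exel_cong G; (v, w) \<in> exel_cong G\<rbrakk> \<Longrightarrow> (u, w) \<in> exel_cong G"
  | exel_cong_append: "\<lbrakk>(u, u') \<in> exel_cong G; (v, v') \<in> exel_cong G\<rbrakk> \<Longrightarrow> (u @ v, u' @ v') \<in> exel_cong G"

definition exel_sym :: "('g, 'x) monoid_scheme \<Rightarrow> 'g \<Rightarrow> 'g list set"
  where "exel_sym G g = exel_cong G `` {[g]}"

definition exel_monoid :: "('g, 'x) monoid_scheme \<Rightarrow> 'g list set monoid"
  where "exel_monoid G = \<lparr>carrier = exel_words G // exel_cong G,
    mult = (\<lambda>s t. \<Union>u\<in>s. \<Union>v\<in>t. exel_cong G `` {u @ v}),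
    one = exel_sym G \<one>\<^bsub>G\<^esub>\<rparr>"

definition semigroup_inverse :: "('s, 'x) monoid_scheme \<Rightarrow> 's \<Rightarrow> 's"
  where "semigroup_inverse S s = (THE t. t \<in> carrier S \<and>
    s \<otimes>\<^bsub>S\<^esub> t \<otimes>\<^bsub>S\<^esub> s = s \<and> t \<otimes>\<^bsub>S\<^esub> s \<otimes>\<^bsub>S\<^esub> t = t)"

definition idempotents :: "('s, 'x) monoid_scheme \<Rightarrow> 's set"
  where "idempotents S = {e \<in> carrier S. e \<otimes>\<^bsub>S\<^esub> e = e}"

text \<open>The extension of \<open>\<mu> : S \<times> T \<rightarrow> U\<close> to a \<open>K\<close>-bilinear map \<open>KS \<times> KT \<rightarrow> KU\<close>.\<close>

definition bil_ext ::
    "('k, 'y) ring_scheme \<Rightarrow> ('s \<Rightarrow> 't \<Rightarrow> 'u) \<Rightarrow> ('s \<Rightarrow> 'k) \<Rightarrow> ('t \<Rightarrow> 'k) \<Rightarrow> 'u \<Rightarrow> 'k"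
  where "bil_ext K \<mu> a b u =
    (\<Oplus>\<^bsub>K\<^esub>p\<in>{(s, t) \<in> fsupp K a \<times> fsupp K b. \<mu> s t = u}. a (fst p) \<otimes>\<^bsub>K\<^esub> b (snd p))"

definition semigroup_algebra ::
    "('k, 'y) ring_scheme \<Rightarrow> ('s, 'x) monoid_scheme \<Rightarrow> ('k, 's \<Rightarrow> 'k) module"
  where "semigroup_algebra K S = (free_module K (carrier S))
    \<lparr>mult := bil_ext K (mult S), one := free_basis K \<one>\<^bsub>S\<^esub>\<rparr>"

abbreviation K_par :: "('k, 'y) ring_scheme \<Rightarrow> ('g, 'x) monoid_scheme \<Rightarrow> ('k, 'g list set \<Rightarrow> 'k) module"
  where "K_par K G \<equiv> semigroup_algebra K (exel_monoid G)"

text \<open>\<open>KE(S)\<close> with the \<open>K\<close>-bilinear extension of \<open>s \<cdot> e = s e s\<^sup>-\<^sup>1\<close>.\<close>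

definition idempotent_module ::
    "('k, 'y) ring_scheme \<Rightarrow> ('s, 'x) monoid_scheme \<Rightarrow> ('s \<Rightarrow> 'k, 's \<Rightarrow> 'k) module"
  where "idempotent_module K S =
    \<lparr>carrier = carrier (free_module K (idempotents S)), mult = undefined, one = undefined,
     zero = zero (free_module K (idempotents S)), add = add (free_module K (idempotents S)),
     smult = bil_ext K (\<lambda>s e. s \<otimes>\<^bsub>S\<^esub> e \<otimes>\<^bsub>S\<^esub> semigroup_inverse S s)\<rparr>"

definition H_par ::
    "('k, 'y) ring_scheme \<Rightarrow> ('g, 'x) monoid_scheme \<Rightarrow> ('g list set \<Rightarrow> 'k, 'm, 'z) module_scheme \<Rightarrow>
      nat \<Rightarrow> ('k, ((('g list set \<Rightarrow> 'k, 'g list set \<Rightarrow> 'k) res_gen \<Rightarrow> 'g list set \<Rightarrow> 'k) \<Rightarrow> 'm) set) module"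
  where "H_par K G M n = Ext (K_par K G) (idempotent_module K (exel_monoid G)) M n"


section \<open>Partial cochains\<close>

definition exel_e :: "('g, 'x) monoid_scheme \<Rightarrow> 'g \<Rightarrow> 'g list set"
  where "exel_e G g = exel_sym G g \<otimes>\<^bsub>exel_monoid G\<^esub> exel_sym G (inv\<^bsub>G\<^esub> g)"

definition mult_list :: "('s, 'x) monoid_scheme \<Rightarrow> 's list \<Rightarrow> 's"
  where "mult_list S xs = foldr (mult S) xs \<one>\<^bsub>S\<^esub>"

definition exel_es :: "('g, 'x) monoid_scheme \<Rightarrow> 'g list \<Rightarrow> 'g list set"
  where "exel_es G gs =
    mult_list (exel_monoid G) (map (\<lambda>i. exel_e G (mult_list G (take i gs))) [1..<Suc (length gs)])"

definition sg_act :: "('k, 'y) ring_scheme \<Rightarrow> ('s \<Rightarrow> 'k, 'm, 'z) module_scheme \<Rightarrow> 's \<Rightarrow> 'm \<Rightarrow> 'm"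
  where "sg_act K M s m = free_basis K s \<odot>\<^bsub>M\<^esub> m"

definition tuples :: "('g, 'x) monoid_scheme \<Rightarrow> nat \<Rightarrow> 'g list set"
  where "tuples G n = {gs. length gs = n \<and> set gs \<subseteq> carrier G}"

text \<open>\<open>par_cochains K G M n\<close> is \<open>C\<^sup>n\<^sub>p\<^sub>a\<^sub>r(G, M)\<close> for \<open>n \<ge> 1\<close>; \<open>C\<^sup>0\<^sub>p\<^sub>a\<^sub>r(G, M) = M\<close> is treated apart.\<close>

definition par_cochains ::
    "('k, 'y) ring_scheme \<Rightarrow> ('g, 'x) monoid_scheme \<Rightarrow> ('g list set \<Rightarrow> 'k, 'm, 'z) module_scheme \<Rightarrow>
      nat \<Rightarrow> ('k, 'g list \<Rightarrow> 'm) module"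
  where "par_cochains K G M n = map_module (tuples G n)
    {f. \<forall>gs\<in>tuples G n. f gs \<in> sg_act K M (exel_es G gs) ` carrier M}
    (restrict_scalars (K_par K G) M)"

definition alternate :: "('a, 'z) ring_scheme \<Rightarrow> nat \<Rightarrow> 'a \<Rightarrow> 'a"
  where "alternate M i x = (if even i then x else \<ominus>\<^bsub>M\<^esub> x)"

definition par_delta0 ::
    "('k, 'y) ring_scheme \<Rightarrow> ('g, 'x) monoid_scheme \<Rightarrow> ('g list set \<Rightarrow> 'k, 'm, 'z) module_scheme \<Rightarrow>
      'm \<Rightarrow> 'g list \<Rightarrow> 'm"
  where "par_delta0 K G M m = (\<lambda>gs\<in>tuples G 1.
    sg_act K M (exel_sym G (gs ! 0)) m \<ominus>\<^bsub>M\<^esub> sg_act K M (exel_e G (gs ! 0)) m)"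

text \<open>The list entry \<open>gs ! (i - 1)\<close> is \<open>g\<^sub>i\<close>.\<close>

definition par_delta ::
    "('k, 'y) ring_scheme \<Rightarrow> ('g, 'x) monoid_scheme \<Rightarrow> ('g list set \<Rightarrow> 'k, 'm, 'z) module_scheme \<Rightarrow>
      nat \<Rightarrow> ('g list \<Rightarrow> 'm) \<Rightarrow> 'g list \<Rightarrow> 'm"
  where "par_delta K G M n f = (\<lambda>gs\<in>tuples G (Suc n).
    sg_act K M (exel_sym G (gs ! 0)) (f (tl gs))
    \<oplus>\<^bsub>M\<^esub> (\<Oplus>\<^bsub>M\<^esub>i\<in>{1..n}. alternate M i (sg_act K M (exel_e G (mult_list G (take i gs)))
          (f (take (i - 1) gs @ [gs ! (i - 1) \<otimes>\<^bsub>G\<^esub> gs ! i] @ drop (i + 1) gs))))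
    \<oplus>\<^bsub>M\<^esub> alternate M (n + 1) (sg_act K M (exel_e G (mult_list G gs)) (f (take n gs))))"

definition par_Z0 ::
    "('k, 'y) ring_scheme \<Rightarrow> ('g, 'x) monoid_scheme \<Rightarrow> ('g list set \<Rightarrow> 'k, 'm, 'z) module_scheme \<Rightarrow> 'm set"
  where "par_Z0 K G M = {m \<in> carrier M. par_delta0 K G M m = \<zero>\<^bsub>par_cochains K G M 1\<^esub>}"

definition par_Z ::
    "('k, 'y) ring_scheme \<Rightarrow> ('g, 'x) monoid_scheme \<Rightarrow> ('g list set \<Rightarrow> 'k, 'm, 'z) module_scheme \<Rightarrow>
      nat \<Rightarrow> ('g list \<Rightarrow> 'm) set"
  where "par_Z K G M n =
    {f \<in> carrier (par_cochains K G M n). par_delta K G M n f = \<zero>\<^bsub>par_cochains K G M (Suc n)\<^esub>}"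

definition par_B ::
    "('k, 'y) ring_scheme \<Rightarrow> ('g, 'x) monoid_scheme \<Rightarrow> ('g list set \<Rightarrow> 'k, 'm, 'z) module_scheme \<Rightarrow>
      nat \<Rightarrow> ('g list \<Rightarrow> 'm) set"
  where "par_B K G M n =
    (if n = 1 then par_delta0 K G M ` carrier M
     else par_delta K G M (n - 1) ` carrier (par_cochains K G M (n - 1)))"


section \<open>The resolution is exact\<close>

lemma fsupp_finite_superset:
  assumes "left_module R M" "f \<in> UNIV \<rightarrow> carrier R" "finite Y" "fsupp R f \<subseteq> Y" "\<phi> \<in> Y \<rightarrow> carrier M"
  shows "free_lift R M \<phi> f = (\<Oplus>\<^bsub>M\<^esub>x\<in>Y. f x \<odot>\<^bsub>M\<^esub> \<phi> x)"
proof -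
  interpret left_module R M by fact
  have z: "\<zero>\<^bsub>R\<^esub> \<odot>\<^bsub>M\<^esub> x = \<zero>\<^bsub>M\<^esub>" if x: "x \<in> carrier M" for x
  proof -
    have "\<zero>\<^bsub>R\<^esub> \<odot>\<^bsub>M\<^esub> x = (\<zero>\<^bsub>R\<^esub> \<oplus>\<^bsub>R\<^esub> \<zero>\<^bsub>R\<^esub>) \<odot>\<^bsub>M\<^esub> x" by simp
    also have "\<dots> = \<zero>\<^bsub>R\<^esub> \<odot>\<^bsub>M\<^esub> x \<oplus>\<^bsub>M\<^esub> \<zero>\<^bsub>R\<^esub> \<odot>\<^bsub>M\<^esub> x"
      using smult_l_distr[of "\<zero>\<^bsub>R\<^esub>" "\<zero>\<^bsub>R\<^esub>" x] x by simp
    finally show ?thesis using x smult_closed[of "\<zero>\<^bsub>R\<^esub>" x]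
      by (metis M.add.r_cancel_one' R.zero_closed)
  qed
  show ?thesis unfolding free_lift_def
    using assms z smult_closed
    by (intro M.add.finprod_mono_neutral_cong_left) (fastforce simp: fsupp_def Pi_iff)+
qed

lemma smult_l_null':
  assumes "left_module R M" "x \<in> carrier M"
  shows "\<zero>\<^bsub>R\<^esub> \<odot>\<^bsub>M\<^esub> x = \<zero>\<^bsub>M\<^esub>"
proof -
  interpret left_module R M by fact
  show ?thesis
    by (metis M.add.r_cancel_one' R.l_zero R.zero_closed assms(2) smult_closed smult_l_distr)
qed

lemma smult_r_null':
  assumes "left_module R M" "r \<in> carrier R"
  shows "r \<odot>\<^bsub>M\<^esub> \<zero>\<^bsub>M\<^esub> = \<zero>\<^bsub>M\<^esub>"
proof -
  interpret left_module R M by fact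
  show ?thesis
    by (metis M.add.r_cancel_one' M.l_zero M.zero_closed assms(2) smult_closed smult_r_distr)
qed

lemma free_module_carrierI:
  assumes "\<And>x. f x \<in> carrier R" "finite Y" "Y \<subseteq> X" "\<And>x. x \<notin> Y \<Longrightarrow> f x = \<zero>\<^bsub>R\<^esub>"
  shows "f \<in> carrier (free_module R X)"
proof -
  have "fsupp R f \<subseteq> Y" using assms(4) by (auto simp: fsupp_def)
  with assms show ?thesis unfolding free_module_def by (auto intro: finite_subset)
qed

lemma free_module_left_module:
  assumes "ring R" shows "left_module R (free_module R X)"
proof -
  interpret ring R by fact
  have add: "(\<lambda>x. f x \<oplus>\<^bsub>R\<^esub> g x) \<in> carrier (free_module R X)"
    if "f \<in> carrier (free_module R X)" "g \<in> carrier (free_module R X)" for f g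
    using that by (intro free_module_carrierI[where Y = "fsupp R f \<union> fsupp R g"])
      (auto simp: free_module_def fsupp_def Pi_iff)
  have sm: "(\<lambda>x. r \<otimes>\<^bsub>R\<^esub> f x) \<in> carrier (free_module R X)"
    if "f \<in> carrier (free_module R X)" "r \<in> carrier R" for f r
    using that by (intro free_module_carrierI[where Y = "fsupp R f"])
      (auto simp: free_module_def fsupp_def Pi_iff)
  have neg: "(\<lambda>x. \<ominus>\<^bsub>R\<^esub> f x) \<in> carrier (free_module R X)"
    if "f \<in> carrier (free_module R X)" for f
    using that by (intro free_module_carrierI[where Y = "fsupp R f"])
      (auto simp: free_module_def fsupp_def Pi_iff)
  have c: "f x \<in> carrier R" if "f \<in> carrier (free_module R X)" for f x
    using that by (auto simp: free_module_def)
  have z: "(\<lambda>x. \<zero>\<^bsub>R\<^esub>) \<in> carrier (free_module R X)"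
    by (intro free_module_carrierI[where Y = "{}"]) auto
  have s: "zero (free_module R X) = (\<lambda>x. \<zero>\<^bsub>R\<^esub>)" "add (free_module R X) = (\<lambda>f g x. f x \<oplus>\<^bsub>R\<^esub> g x)"
    "smult (free_module R X) = (\<lambda>r f x. r \<otimes>\<^bsub>R\<^esub> f x)"
    by (auto simp: free_module_def)
  have "abelian_group (free_module R X)"
  proof (rule abelian_groupI, goal_cases)
    case (6 f)
    show ?case unfolding s
      by (rule bexI[where x = "\<lambda>x. \<ominus>\<^bsub>R\<^esub> f x"]) (use 6 neg c in \<open>auto simp: l_neg\<close>)
  qed (auto simp: s add z c a_ac)
  then show ?thesis
    by (intro left_module.intro left_module_axioms.intro)
      (use assms in \<open>auto simp: s sm c l_distr r_distr m_assoc\<close>)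
qed

lemma free_basis_closed:
  assumes "ring R" "x \<in> X" shows "free_basis R x \<in> carrier (free_module R X)"
proof -
  interpret ring R by fact
  show ?thesis
    using assms by (intro free_module_carrierI[where Y = "{x}"]) (auto simp: free_basis_def)
qed

lemma free_lift_hom:
  assumes "left_module R M" "\<phi> \<in> X \<rightarrow> carrier M"
  shows "free_lift R M \<phi> \<in> mod_hom R (free_module R X) M"
proof -
  interpret left_module R M by fact
  interpret F: left_module R "free_module R X" by (rule free_module_left_module) (rule R.ring_axioms)
  have c: "f x \<in> carrier R" "finite (fsupp R f)" "fsupp R f \<subseteq> X"
    if "f \<in> carrier (free_module R X)" for f x
    using that by (auto simp: free_module_def)
  have tc: "f x \<odot>\<^bsub>M\<^esub> \<phi> x \<in> carrier M" if "f \<in> carrier (free_module R X)" "x \<in> X" for f x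
    using smult_closed c(1) that assms(2) by blast
  have L: "free_lift R M \<phi> f = (\<Oplus>\<^bsub>M\<^esub>x\<in>Y. f x \<odot>\<^bsub>M\<^esub> \<phi> x)"
    if "f \<in> carrier (free_module R X)" "finite Y" "fsupp R f \<subseteq> Y" "Y \<subseteq> X" for f Y
  proof (rule fsupp_finite_superset[OF assms(1) _ that(2,3)])
    show "f \<in> UNIV \<rightarrow> carrier R" using c(1)[OF that(1)] by simp
    show "\<phi> \<in> Y \<rightarrow> carrier M" using assms(2) that(4) by auto
  qed
  have "free_lift R M \<phi> (f \<oplus>\<^bsub>free_module R X\<^esub> g) = free_lift R M \<phi> f \<oplus>\<^bsub>M\<^esub> free_lift R M \<phi> g"
    if f: "f \<in> carrier (free_module R X)" and g: "g \<in> carrier (free_module R X)" for f g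
  proof -
    let ?Y = "fsupp R f \<union> fsupp R g"
    have Y: "finite ?Y" "?Y \<subseteq> X" using f g c by auto
    have s: "fsupp R (f \<oplus>\<^bsub>free_module R X\<^esub> g) \<subseteq> ?Y"
      by (auto simp: fsupp_def free_module_def)
    have "free_lift R M \<phi> (f \<oplus>\<^bsub>free_module R X\<^esub> g) =
      (\<Oplus>\<^bsub>M\<^esub>x\<in>?Y. (f \<oplus>\<^bsub>free_module R X\<^esub> g) x \<odot>\<^bsub>M\<^esub> \<phi> x)"
      by (intro L F.M.a_closed f g Y s)
    also have "\<dots> = (\<Oplus>\<^bsub>M\<^esub>x\<in>?Y. f x \<odot>\<^bsub>M\<^esub> \<phi> x \<oplus>\<^bsub>M\<^esub> g x \<odot>\<^bsub>M\<^esub> \<phi> x)"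
    proof (rule M.finsum_cong')
      fix x assume "x \<in> ?Y"
      then have "\<phi> x \<in> carrier M" using Y assms(2) by auto
      then show "(f \<oplus>\<^bsub>free_module R X\<^esub> g) x \<odot>\<^bsub>M\<^esub> \<phi> x = f x \<odot>\<^bsub>M\<^esub> \<phi> x \<oplus>\<^bsub>M\<^esub> g x \<odot>\<^bsub>M\<^esub> \<phi> x"
        using smult_l_distr[OF c(1)[OF f] c(1)[OF g]] by (simp add: free_module_def)
    qed (use Y(2) tc[OF f] tc[OF g] in auto)
    also have "\<dots> = (\<Oplus>\<^bsub>M\<^esub>x\<in>?Y. f x \<odot>\<^bsub>M\<^esub> \<phi> x) \<oplus>\<^bsub>M\<^esub> (\<Oplus>\<^bsub>M\<^esub>x\<in>?Y. g x \<odot>\<^bsub>M\<^esub> \<phi> x)"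
      by (rule M.finsum_addf) (use Y(2) tc[OF f] tc[OF g] in auto)
    also have "\<dots> = free_lift R M \<phi> f \<oplus>\<^bsub>M\<^esub> free_lift R M \<phi> g"
      using L[of f ?Y] L[of g ?Y] f g Y by auto
    finally show ?thesis .
  qed
  moreover have "free_lift R M \<phi> (r \<odot>\<^bsub>free_module R X\<^esub> f) = r \<odot>\<^bsub>M\<^esub> free_lift R M \<phi> f"
    if f: "f \<in> carrier (free_module R X)" and r: "r \<in> carrier R" for f r
  proof -
    have Y: "finite (fsupp R f)" "fsupp R f \<subseteq> X" using f c by auto
    have s: "fsupp R (r \<odot>\<^bsub>free_module R X\<^esub> f) \<subseteq> fsupp R f"
      using r by (auto simp: fsupp_def free_module_def)
    have ind: "(\<Oplus>\<^bsub>M\<^esub>x\<in>Y. r \<odot>\<^bsub>M\<^esub> h x) = r \<odot>\<^bsub>M\<^esub> (\<Oplus>\<^bsub>M\<^esub>x\<in>Y. h x)"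
      if "finite Y" "h \<in> Y \<rightarrow> carrier M" for Y :: "'idx set" and h
      using that
      by (induction Y rule: finite_induct)
        (simp_all add: smult_r_null'[OF assms(1) r] smult_r_distr[OF r] smult_closed[OF r] Pi_iff)
    have "free_lift R M \<phi> (r \<odot>\<^bsub>free_module R X\<^esub> f) =
        (\<Oplus>\<^bsub>M\<^esub>x\<in>fsupp R f. (r \<odot>\<^bsub>free_module R X\<^esub> f) x \<odot>\<^bsub>M\<^esub> \<phi> x)"
      by (intro L F.smult_closed f r Y s)
    also have "\<dots> = (\<Oplus>\<^bsub>M\<^esub>x\<in>fsupp R f. r \<odot>\<^bsub>M\<^esub> (f x \<odot>\<^bsub>M\<^esub> \<phi> x))"
    proof (rule M.finsum_cong')
      fix x assume "x \<in> fsupp R f"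
      then have "\<phi> x \<in> carrier M" using Y assms(2) by auto
      then show "(r \<odot>\<^bsub>free_module R X\<^esub> f) x \<odot>\<^bsub>M\<^esub> \<phi> x = r \<odot>\<^bsub>M\<^esub> (f x \<odot>\<^bsub>M\<^esub> \<phi> x)"
        using smult_assoc1[OF r c(1)[OF f]] by (simp add: free_module_def)
    qed (use Y(2) tc[OF f] r smult_closed in auto)
    also have "\<dots> = r \<odot>\<^bsub>M\<^esub> free_lift R M \<phi> f"
      unfolding free_lift_def
      by (rule ind[OF Y(1)]) (use Y(2) tc[OF f] in auto)
    finally show ?thesis .
  qed
  moreover have "free_lift R M \<phi> f \<in> carrier M" if f: "f \<in> carrier (free_module R X)" for f
    unfolding free_lift_def
    by (rule M.finsum_closed) (use c(3)[OF f] tc[OF f] in auto)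
  ultimately show ?thesis unfolding mod_hom_def by auto
qed

lemma free_lift_basis:
  assumes "left_module R M" "\<phi> x \<in> carrier M"
  shows "free_lift R M \<phi> (free_basis R x) = \<phi> x"
proof -
  interpret left_module R M by fact
  have "free_lift R M \<phi> (free_basis R x) = (\<Oplus>\<^bsub>M\<^esub>y\<in>{x}. free_basis R x y \<odot>\<^bsub>M\<^esub> \<phi> y)"
    by (rule fsupp_finite_superset) (use assms in \<open>auto simp: free_basis_def fsupp_def\<close>)
  then show ?thesis using assms(2) smult_one by (simp add: free_basis_def)
qed

lemma hom_free_lift:
  assumes "left_module R M" "left_module R N" "h \<in> mod_hom R M N" "\<phi> \<in> X \<rightarrow> carrier M"
    "f \<in> carrier (free_module R X)"
  shows "h (free_lift R M \<phi> f) = free_lift R N (h \<circ> \<phi>) f"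
proof -
  interpret left_module R M by fact
  interpret N: left_module R N by fact
  have h: "h x \<in> carrier N" "h (x \<oplus>\<^bsub>M\<^esub> y) = h x \<oplus>\<^bsub>N\<^esub> h y" "h (r \<odot>\<^bsub>M\<^esub> x) = r \<odot>\<^bsub>N\<^esub> h x"
    if "x \<in> carrier M" "y \<in> carrier M" "r \<in> carrier R" for x y r
    using that assms(3) by (auto simp: mod_hom_def)
  have h0: "h \<zero>\<^bsub>M\<^esub> = \<zero>\<^bsub>N\<^esub>"
    by (metis M.zero_closed M.l_zero N.M.add.r_cancel_one' R.zero_closed h(1,2))
  have ind: "h (\<Oplus>\<^bsub>M\<^esub>x\<in>Y. g x) = (\<Oplus>\<^bsub>N\<^esub>x\<in>Y. h (g x))"
    if "finite Y" "g \<in> Y \<rightarrow> carrier M" for Y :: "'idx set" and g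
    using that
    by (induction Y rule: finite_induct)
     (use h(1,2)[where r="\<zero>\<^bsub>R\<^esub>"] in \<open>auto simp: h0 Pi_iff\<close>)
  have f: "f x \<in> carrier R" "finite (fsupp R f)" "fsupp R f \<subseteq> X" for x
    using assms(5) by (auto simp: free_module_def)
  have \<phi>: "\<phi> x \<in> carrier M" if "x \<in> fsupp R f" for x using that f assms(4) by auto
  have "h (free_lift R M \<phi> f) = (\<Oplus>\<^bsub>N\<^esub>x\<in>fsupp R f. h (f x \<odot>\<^bsub>M\<^esub> \<phi> x))"
    unfolding free_lift_def by (rule ind) (use f smult_closed \<phi> in auto)
  also have "\<dots> = free_lift R N (h \<circ> \<phi>) f"
    unfolding free_lift_def
  proof (rule N.M.finsum_cong')
    show "(\<lambda>x. f x \<odot>\<^bsub>N\<^esub> (h \<circ> \<phi>) x) \<in> fsupp R f \<rightarrow> carrier N"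
      using N.smult_closed[OF f(1) h(1)[OF \<phi> \<phi> f(1)]] by auto
    show "h (f x \<odot>\<^bsub>M\<^esub> \<phi> x) = f x \<odot>\<^bsub>N\<^esub> (h \<circ> \<phi>) x" if "x \<in> fsupp R f" for x
      using h(3)[OF \<phi> \<phi> f(1)] that by auto
  qed simp
  finally show ?thesis .
qed

lemma lin_comb_closed:
  assumes "ring R" "l \<in> lists (carrier R \<times> X)"
  shows "lin_comb R l \<in> carrier (free_module R X)"
proof -
  interpret F: left_module R "free_module R X" by (rule free_module_left_module) fact
  show ?thesis using assms(2)
  proof (induction l)
    case Nil
    then show ?case using F.zero_closed by (simp add: free_module_def)
  next
    case (Cons p l)
    obtain r x where p: "p = (r, x)" by (cases p)
    have "r \<odot>\<^bsub>free_module R X\<^esub> free_basis R x \<oplus>\<^bsub>free_module R X\<^esub> lin_comb R l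
      \<in> carrier (free_module R X)"
      using Cons p by (intro F.M.a_closed F.smult_closed free_basis_closed[OF assms(1)]) auto
    then show ?case by (simp add: p free_module_def)
  qed
qed

lemma lin_comb_surj:
  assumes "ring R" "f \<in> carrier (free_module R X)"
  obtains l where "l \<in> lists (carrier R \<times> X)" "lin_comb R l = f"
proof -
  interpret ring R by fact
  have main: "\<exists>l \<in> lists (carrier R \<times> X). lin_comb R l = f"
    if "finite Y" "Y \<subseteq> X" "f \<in> UNIV \<rightarrow> carrier R" "fsupp R f = Y" for Y f
    using that
  proof (induction Y arbitrary: f rule: finite_induct)
    case empty
    then have "f = (\<lambda>x. \<zero>\<^bsub>R\<^esub>)" by (auto simp: fsupp_def)
    then show ?case by (intro bexI[where x = "[]"]) auto
  next
    case (insert y Y)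
    have fc: "f x \<in> carrier R" for x using insert by auto
    have z: "f x = \<zero>\<^bsub>R\<^esub> \<longleftrightarrow> x \<notin> insert y Y" for x using insert(6) unfolding fsupp_def by blast
    have "fsupp R (f(y := \<zero>\<^bsub>R\<^esub>)) = Y" using insert z by (auto simp: fsupp_def)
    then obtain l where l: "l \<in> lists (carrier R \<times> X)" "lin_comb R l = f(y := \<zero>\<^bsub>R\<^esub>)"
      using insert.IH[of "f(y := \<zero>\<^bsub>R\<^esub>)"] insert.prems by fastforce
    have "lin_comb R ((f y, y) # l) = f"
      using l fc by (auto simp: free_basis_def)
    then show ?case using l insert.prems fc by (intro bexI[where x = "(f y, y) # l"]) auto
  qed
  have "finite (fsupp R f)" "fsupp R f \<subseteq> X" "f \<in> UNIV \<rightarrow> carrier R"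
    using assms(2) by (auto simp: free_module_def)
  from main[OF this refl] obtain l where "l \<in> lists (carrier R \<times> X)" "lin_comb R l = f"
    by (elim bexE)
  then show ?thesis by (rule that)
qed

theorem res_mod_left_module: "ring R \<Longrightarrow> left_module R (res_mod R A n)"
  unfolding res_mod_def by (rule free_module_left_module)

theorem res_aug_hom:
  assumes "left_module R A" shows "res_aug R A \<in> mod_hom R (res_mod R A 0) A"
  unfolding res_aug_def res_mod_def by (rule free_lift_hom) (use assms in auto)

theorem res_aug_surj:
  assumes "left_module R A" shows "res_aug R A ` carrier (res_mod R A 0) = carrier A"
proof
  interpret left_module R A by fact
  show "res_aug R A ` carrier (res_mod R A 0) \<subseteq> carrier A"
    using res_aug_hom[OF assms] by (auto simp: mod_hom_def)
  show "carrier A \<subseteq> res_aug R A ` carrier (res_mod R A 0)"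
  proof
    fix a assume a: "a \<in> carrier A"
    have "res_aug R A (free_basis R (Elem a)) = a"
      unfolding res_aug_def using assms a by (simp add: free_lift_basis)
    moreover have "free_basis R (Elem a) \<in> carrier (res_mod R A 0)"
      unfolding res_mod_def by (rule free_basis_closed) (use a in \<open>auto intro: R.ring_axioms\<close>)
    ultimately show "a \<in> res_aug R A ` carrier (res_mod R A 0)" by force
  qed
qed

lemma res_basis_Suc:
  assumes "ring R"
  shows "res_basis R A (Suc n) = Comb ` {l \<in> lists (carrier R \<times> res_basis R A n).
    lin_comb R l \<in> (if n = 0 then a_kernel (res_mod R A 0) A (res_aug R A)
      else a_kernel (res_mod R A n) (res_mod R A (n - 1)) (res_diff R A (n - 1)))}"
proof -
  have c: "lin_comb R l \<in> carrier (res_mod R A n)"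
    if "l \<in> lists (carrier R \<times> res_basis R A n)" for l n
    unfolding res_mod_def using lin_comb_closed[OF assms that] .
  show ?thesis
  proof (cases n)
    case 0
    show ?thesis unfolding 0 res_basis.simps(2) a_kernel_def kernel_def
      by (rule arg_cong[where f = "image Comb"]) (use c[of _ 0] in \<open>simp del: in_lists_conv_set add: res_mod_def cong: conj_cong\<close>)
  next
    case (Suc m)
    show ?thesis unfolding Suc res_basis.simps(3) a_kernel_def kernel_def
      by (rule arg_cong[where f = "image Comb"])
        (use c[of _ "Suc m"] in \<open>simp del: in_lists_conv_set add: res_diff_def res_mod_def cong: conj_cong\<close>)
  qed
qed

lemma res_comb_closed:
  assumes "ring R" "x \<in> res_basis R A (Suc n)"
  shows "lin_comb R (res_comb x) \<in> carrier (res_mod R A n)"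
proof -
  obtain l where "x = Comb l" "l \<in> lists (carrier R \<times> res_basis R A n)"
    using assms(2) unfolding res_basis_Suc[OF assms(1)] by blast
  then show ?thesis unfolding res_mod_def using lin_comb_closed[OF assms(1)] by simp
qed

theorem res_diff_hom:
  assumes "ring R"
  shows "res_diff R A n \<in> mod_hom R (res_mod R A (Suc n)) (res_mod R A n)"
  unfolding res_diff_def res_bd_def res_mod_def
  by (rule free_lift_hom)
    (use assms res_comb_closed[OF assms, of _ A n]
      in \<open>auto simp: free_module_left_module res_mod_def\<close>)

theorem res_exact:
  assumes "left_module R A"
  shows "res_diff R A n ` carrier (res_mod R A (Suc n)) =
    (if n = 0 then a_kernel (res_mod R A 0) A (res_aug R A)
     else a_kernel (res_mod R A n) (res_mod R A (n - 1)) (res_diff R A (n - 1)))"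
    (is "_ = ?K")
proof
  interpret left_module R A by fact
  note R = R.ring_axioms
  note F = free_module_left_module[OF R]
  have ker: "h (res_diff R A n f) = \<zero>\<^bsub>N\<^esub>"
    if N: "left_module R N" "h \<in> mod_hom R (res_mod R A n) N"
      and K: "?K = a_kernel (res_mod R A n) N h" and f: "f \<in> carrier (res_mod R A (Suc n))"
    for h f and N :: "('a, 'q, 'w) module_scheme"
  proof -
    interpret N: left_module R N by fact
    have s: "fsupp R f \<subseteq> res_basis R A (Suc n)" "\<And>x. f x \<in> carrier R"
      using f by (auto simp: res_mod_def free_module_def)
    have c: "(\<lambda>x. lin_comb R (res_comb x)) \<in> res_basis R A (Suc n) \<rightarrow> carrier (res_mod R A n)"
      using res_comb_closed[OF R] by blast
    have z: "h (lin_comb R (res_comb x)) = \<zero>\<^bsub>N\<^esub>" if "x \<in> res_basis R A (Suc n)" for x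
      using that unfolding res_basis_Suc[OF R] K by (auto simp: a_kernel_def kernel_def)
    have "h (res_diff R A n f) = free_lift R N (h \<circ> (\<lambda>x. lin_comb R (res_comb x))) f"
      unfolding res_diff_def res_bd_def
      using hom_free_lift[OF res_mod_left_module[OF R] N c] f
      unfolding res_mod_def by blast
    also have "\<dots> = (\<Oplus>\<^bsub>N\<^esub>x\<in>fsupp R f. \<zero>\<^bsub>N\<^esub>)"
      unfolding free_lift_def
      by (rule N.M.finsum_cong') (use s z smult_r_null'[OF N(1)] in \<open>auto simp: subset_iff\<close>)
    also have "\<dots> = \<zero>\<^bsub>N\<^esub>" by simp
    finally show ?thesis .
  qed
  have cl: "res_diff R A n f \<in> carrier (res_mod R A n)" if "f \<in> carrier (res_mod R A (Suc n))" for f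
    using res_diff_hom[OF R, of A n] that by (auto simp: mod_hom_def)
  show "res_diff R A n ` carrier (res_mod R A (Suc n)) \<subseteq> ?K"
  proof (cases n)
    case 0
    then show ?thesis
      using ker[OF assms, of "res_aug R A"] res_aug_hom[OF assms] cl
      by (auto simp: a_kernel_def kernel_def)
  next
    case (Suc m)
    then show ?thesis
      using ker[OF res_mod_left_module[OF R], of "res_diff R A m" A m] res_diff_hom[OF R, of A m] cl
      by (auto simp: a_kernel_def kernel_def)
  qed
  show "?K \<subseteq> res_diff R A n ` carrier (res_mod R A (Suc n))"
  proof
    fix f assume f: "f \<in> ?K"
    then have "f \<in> carrier (free_module R (res_basis R A n))"
      by (auto simp: a_kernel_def kernel_def res_mod_def split: if_splits)
    then obtain l where l: "l \<in> lists (carrier R \<times> res_basis R A n)" "lin_comb R l = f"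
      using lin_comb_surj[OF R] by metis
    have x: "Comb l \<in> res_basis R A (Suc n)"
      unfolding res_basis_Suc[OF R] using l f by auto
    have "res_diff R A n (free_basis R (Comb l)) = f"
      unfolding res_diff_def res_bd_def
      using free_lift_basis[OF F, of "\<lambda>x. lin_comb R (res_comb x)" "Comb l"] l
        lin_comb_closed[OF R l(1)] by simp
    moreover have "free_basis R (Comb l) \<in> carrier (res_mod R A (Suc n))"
      unfolding res_mod_def using free_basis_closed[OF R x] .
    ultimately show "f \<in> res_diff R A n ` carrier (res_mod R A (Suc n))" by force
  qed
qed


section \<open>The semigroup algebra is a ring\<close>

lemma free_moduleD:
  assumes "f \<in> carrier (free_module R X)"
  shows "f x \<in> carrier R" "finite (fsupp R f)" "fsupp R f \<subseteq> X"
  using assms by (auto simp: free_module_def)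

lemma free_module_simps:
  "zero (free_module R X) = (\<lambda>x. \<zero>\<^bsub>R\<^esub>)" "add (free_module R X) = (\<lambda>f g x. f x \<oplus>\<^bsub>R\<^esub> g x)"
  "smult (free_module R X) = (\<lambda>r f x. r \<otimes>\<^bsub>R\<^esub> f x)"
  by (auto simp: free_module_def)

lemma hom_eq_on_basis:
  assumes "ring R" "left_module R N" "h \<in> mod_hom R (free_module R X) N"
    "h' \<in> mod_hom R (free_module R X) N"
    and eq: "\<And>x. x \<in> X \<Longrightarrow> h (free_basis R x) = h' (free_basis R x)"
    and f: "f \<in> carrier (free_module R X)"
  shows "h f = h' f"
proof -
  interpret F: left_module R "free_module R X" by (rule free_module_left_module) fact
  interpret N: left_module R N by fact
  have H: "g \<zero>\<^bsub>free_module R X\<^esub> = \<zero>\<^bsub>N\<^esub>" if "g \<in> mod_hom R (free_module R X) N" for g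
    using that F.M.zero_closed F.M.l_zero N.M.add.r_cancel_one'
    unfolding mod_hom_def by (smt (verit) Pi_iff mem_Collect_eq)
  obtain l where l: "l \<in> lists (carrier R \<times> X)" "lin_comb R l = f"
    using lin_comb_surj[OF assms(1) f] .
  have "h (lin_comb R l) = h' (lin_comb R l)"
    using l(1)
  proof (induction l)
    case Nil
    have "lin_comb R [] = \<zero>\<^bsub>free_module R X\<^esub>" by (simp add: free_module_simps)
    then show ?case using H assms(3,4) by metis
  next
    case (Cons p l)
    obtain r x where p: "p = (r, x)" by (cases p)
    have c: "r \<in> carrier R" "free_basis R x \<in> carrier (free_module R X)"
      "lin_comb R l \<in> carrier (free_module R X)"
      using Cons p free_basis_closed[OF assms(1), of x X] lin_comb_closed[OF assms(1), of l X] by auto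
    have *: "lin_comb R (p # l) = r \<odot>\<^bsub>free_module R X\<^esub> free_basis R x \<oplus>\<^bsub>free_module R X\<^esub> lin_comb R l"
      by (simp add: p free_module_simps)
    have g: "g (lin_comb R (p # l)) = r \<odot>\<^bsub>N\<^esub> g (free_basis R x) \<oplus>\<^bsub>N\<^esub> g (lin_comb R l)"
      if "g \<in> mod_hom R (free_module R X) N" for g
      using that c F.smult_closed[OF c(1,2)] unfolding * mod_hom_def by simp
    have "h (free_basis R x) = h' (free_basis R x)" "h (lin_comb R l) = h' (lin_comb R l)"
      using Cons p eq[of x] by auto
    then show ?case by (simp only: g[OF assms(3)] g[OF assms(4)])
  qed
  then show ?thesis by (simp add: l)
qed

context
  fixes K :: "('k, 'y) ring_scheme" (structure)
  assumes K: "cring K"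
begin

interpretation K: cring K by (rule K)

lemma bil_ext_rect:
  assumes "a \<in> UNIV \<rightarrow> carrier K" "b \<in> UNIV \<rightarrow> carrier K" "finite A" "finite B"
    "fsupp K a \<subseteq> A" "fsupp K b \<subseteq> B"
  shows "bil_ext K \<mu> a b u =
    (\<Oplus>p\<in>A \<times> B. if \<mu> (fst p) (snd p) = u then a (fst p) \<otimes> b (snd p) else \<zero>)"
  unfolding bil_ext_def
proof (rule K.add.finprod_mono_neutral_cong_left)
  have c: "a x \<in> carrier K" "b y \<in> carrier K" for x y using assms by auto
  show "finite (A \<times> B)" using assms by simp
  show "{(s, t) \<in> fsupp K a \<times> fsupp K b. \<mu> s t = u} \<subseteq> A \<times> B" using assms by auto
  show "(if \<mu> (fst p) (snd p) = u then a (fst p) \<otimes> b (snd p) else \<zero>) = \<zero>"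
    if "p \<in> A \<times> B - {(s, t) \<in> fsupp K a \<times> fsupp K b. \<mu> s t = u}" for p
    using that c by (auto simp: fsupp_def)
  show "(\<lambda>p. if \<mu> (fst p) (snd p) = u then a (fst p) \<otimes> b (snd p) else \<zero>) \<in> A \<times> B \<rightarrow> carrier K"
    using c by auto
qed auto

lemma bil_ext_closed:
  assumes a: "a \<in> carrier (free_module K X)" and b: "b \<in> carrier (free_module K Y)"
    and \<mu>: "\<And>x y. x \<in> X \<Longrightarrow> y \<in> Y \<Longrightarrow> \<mu> x y \<in> Z"
  shows "bil_ext K \<mu> a b \<in> carrier (free_module K Z)"
proof (rule free_module_carrierI[where Y = "case_prod \<mu> ` (fsupp K a \<times> fsupp K b)"])
  note a' = free_moduleD[OF a] and b' = free_moduleD[OF b]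
  show "bil_ext K \<mu> a b u \<in> carrier K" for u
    unfolding bil_ext_def by (rule K.finsum_closed) (use a' b' in auto)
  show "finite (case_prod \<mu> ` (fsupp K a \<times> fsupp K b))" using a' b' by auto
  show "case_prod \<mu> ` (fsupp K a \<times> fsupp K b) \<subseteq> Z" using a'(3) b'(3) \<mu> by auto
  show "bil_ext K \<mu> a b u = \<zero>" if "u \<notin> case_prod \<mu> ` (fsupp K a \<times> fsupp K b)" for u
  proof -
    have e: "{(s, t) \<in> fsupp K a \<times> fsupp K b. \<mu> s t = u} = {}" using that by auto
    show ?thesis unfolding bil_ext_def e by simp
  qed
qed

lemma bil_ext_flip:
  assumes a: "a \<in> carrier (free_module K X)" and b: "b \<in> carrier (free_module K Y)"
  shows "bil_ext K (\<lambda>y x. \<mu> x y) b a = bil_ext K \<mu> a b"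
proof
  fix u
  note a' = free_moduleD[OF a] and b' = free_moduleD[OF b]
  let ?S = "{(s, t) \<in> fsupp K a \<times> fsupp K b. \<mu> s t = u}"
  let ?T = "{(t, s) \<in> fsupp K b \<times> fsupp K a. \<mu> s t = u}"
  have T: "?T = prod.swap ` ?S" by (auto simp: image_iff)
  have "(\<Oplus>p\<in>?T. b (fst p) \<otimes> a (snd p)) = (\<Oplus>p\<in>?S. b (fst (prod.swap p)) \<otimes> a (snd (prod.swap p)))"
    unfolding T by (rule K.finsum_reindex) (use a' b' in \<open>auto simp: inj_on_def\<close>)
  also have "\<dots> = (\<Oplus>p\<in>?S. a (fst p) \<otimes> b (snd p))"
    by (rule K.finsum_cong') (use a' b' in \<open>auto simp: K.m_comm\<close>)
  finally show "bil_ext K (\<lambda>y x. \<mu> x y) b a u = bil_ext K \<mu> a b u"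
    unfolding bil_ext_def .
qed

lemma bil_ext_hom_right:
  assumes a: "a \<in> carrier (free_module K X)"
    and \<mu>: "\<And>x y. x \<in> X \<Longrightarrow> y \<in> Y \<Longrightarrow> \<mu> x y \<in> Z"
  shows "bil_ext K \<mu> a \<in> mod_hom K (free_module K Y) (free_module K Z)"
proof -
  interpret F: left_module K "free_module K Y"
    by (rule free_module_left_module) (rule K.ring_axioms)
  note a' = free_moduleD[OF a]
  have "bil_ext K \<mu> a (b \<oplus>\<^bsub>free_module K Y\<^esub> c) =
      bil_ext K \<mu> a b \<oplus>\<^bsub>free_module K Z\<^esub> bil_ext K \<mu> a c"
    if b: "b \<in> carrier (free_module K Y)" and c: "c \<in> carrier (free_module K Y)" for b c
  proof
    fix u
    note b' = free_moduleD[OF b] and c' = free_moduleD[OF c]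
    note bc' = free_moduleD[OF F.M.a_closed[OF b c]]
    let ?B = "fsupp K b \<union> fsupp K c"
    have s: "fsupp K (b \<oplus>\<^bsub>free_module K Y\<^esub> c) \<subseteq> ?B"
      by (auto simp: fsupp_def free_module_simps)
    let ?g = "\<lambda>b p. if \<mu> (fst p) (snd p) = u then a (fst p) \<otimes> b (snd p) else \<zero>"
    have "bil_ext K \<mu> a (b \<oplus>\<^bsub>free_module K Y\<^esub> c) u =
        (\<Oplus>p\<in>fsupp K a \<times> ?B. ?g (b \<oplus>\<^bsub>free_module K Y\<^esub> c) p)"
      by (rule bil_ext_rect) (use a' b' c' bc' s in auto)
    also have "\<dots> = (\<Oplus>p\<in>fsupp K a \<times> ?B. ?g b p \<oplus> ?g c p)"
      by (rule K.finsum_cong') (use a' b' c' in \<open>auto simp: free_module_simps K.r_distr\<close>)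
    also have "\<dots> = (\<Oplus>p\<in>fsupp K a \<times> ?B. ?g b p) \<oplus> (\<Oplus>p\<in>fsupp K a \<times> ?B. ?g c p)"
      by (rule K.finsum_addf) (use a' b' c' in auto)
    also have "(\<Oplus>p\<in>fsupp K a \<times> ?B. ?g b p) = bil_ext K \<mu> a b u"
      by (rule bil_ext_rect[symmetric]) (use a' b' c' in auto)
    also have "(\<Oplus>p\<in>fsupp K a \<times> ?B. ?g c p) = bil_ext K \<mu> a c u"
      by (rule bil_ext_rect[symmetric]) (use a' b' c' in auto)
    finally show "bil_ext K \<mu> a (b \<oplus>\<^bsub>free_module K Y\<^esub> c) u =
        (bil_ext K \<mu> a b \<oplus>\<^bsub>free_module K Z\<^esub> bil_ext K \<mu> a c) u"
      by (simp add: free_module_simps)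
  qed
  moreover have "bil_ext K \<mu> a (r \<odot>\<^bsub>free_module K Y\<^esub> b) = r \<odot>\<^bsub>free_module K Z\<^esub> bil_ext K \<mu> a b"
    if b: "b \<in> carrier (free_module K Y)" and r: "r \<in> carrier K" for b r
  proof
    fix u
    note b' = free_moduleD[OF b]
    note rb' = free_moduleD[OF F.smult_closed[OF r b]]
    have s: "fsupp K (r \<odot>\<^bsub>free_module K Y\<^esub> b) \<subseteq> fsupp K b"
      using r by (auto simp: fsupp_def free_module_simps)
    let ?g = "\<lambda>b p. if \<mu> (fst p) (snd p) = u then a (fst p) \<otimes> b (snd p) else \<zero>"
    have "bil_ext K \<mu> a (r \<odot>\<^bsub>free_module K Y\<^esub> b) u =
        (\<Oplus>p\<in>fsupp K a \<times> fsupp K b. ?g (r \<odot>\<^bsub>free_module K Y\<^esub> b) p)"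
      by (rule bil_ext_rect) (use a' b' rb' s in auto)
    also have "\<dots> = (\<Oplus>p\<in>fsupp K a \<times> fsupp K b. r \<otimes> ?g b p)"
      by (rule K.finsum_cong') (use a'(1) b'(1) r K.m_lcomm[OF a'(1) r b'(1)] in \<open>auto simp: free_module_simps\<close>)
    also have "\<dots> = r \<otimes> (\<Oplus>p\<in>fsupp K a \<times> fsupp K b. ?g b p)"
      by (rule K.finsum_rdistr[symmetric]) (use a' b' r in auto)
    also have "(\<Oplus>p\<in>fsupp K a \<times> fsupp K b. ?g b p) = bil_ext K \<mu> a b u"
      by (rule bil_ext_rect[symmetric]) (use a' b' in auto)
    finally show "bil_ext K \<mu> a (r \<odot>\<^bsub>free_module K Y\<^esub> b) u = (r \<odot>\<^bsub>free_module K Z\<^esub> bil_ext K \<mu> a b) u"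
      by (simp add: free_module_simps)
  qed
  moreover have "bil_ext K \<mu> a b \<in> carrier (free_module K Z)"
    if b: "b \<in> carrier (free_module K Y)" for b
    by (rule bil_ext_closed[OF a b \<mu>])
  ultimately show ?thesis
    unfolding mod_hom_def by simp
qed

lemma mod_hom_cong:
  assumes "h \<in> mod_hom K (free_module K X) N" "\<And>a. a \<in> carrier (free_module K X) \<Longrightarrow> h a = h' a"
  shows "h' \<in> mod_hom K (free_module K X) N"
proof -
  interpret F: left_module K "free_module K X"
    by (rule free_module_left_module) (rule K.ring_axioms)
  have e: "h' a = h a" if "a \<in> carrier (free_module K X)" for a using assms(2)[OF that] ..
  show ?thesis
    using assms(1) unfolding mod_hom_def by (simp add: e F.smult_closed Pi_iff)
qed

lemma bil_ext_hom_left: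
  assumes b: "b \<in> carrier (free_module K Y)"
    and \<mu>: "\<And>x y. x \<in> X \<Longrightarrow> y \<in> Y \<Longrightarrow> \<mu> x y \<in> Z"
  shows "(\<lambda>a. bil_ext K \<mu> a b) \<in> mod_hom K (free_module K X) (free_module K Z)"
  by (rule mod_hom_cong[OF bil_ext_hom_right[OF b, of X "\<lambda>y x. \<mu> x y" Z]])
    (simp_all add: \<mu> bil_ext_flip[OF _ b])

lemma bil_ext_basis: "bil_ext K \<mu> (free_basis K x) (free_basis K y) = free_basis K (\<mu> x y)"
proof
  fix u
  have "bil_ext K \<mu> (free_basis K x) (free_basis K y) u =
      (\<Oplus>p\<in>{x} \<times> {y}. if \<mu> (fst p) (snd p) = u then free_basis K x (fst p) \<otimes> free_basis K y (snd p) else \<zero>)"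
    by (rule bil_ext_rect) (auto simp: free_basis_def fsupp_def)
  also have "\<dots> = free_basis K (\<mu> x y) u" by (simp add: free_basis_def)
  finally show "bil_ext K \<mu> (free_basis K x) (free_basis K y) u = free_basis K (\<mu> x y) u" .
qed

lemma mod_hom_comp:
  "h \<in> mod_hom K L M \<Longrightarrow> h' \<in> mod_hom K M N \<Longrightarrow> (\<lambda>x. h' (h x)) \<in> mod_hom K L N"
  unfolding mod_hom_def by (simp add: Pi_iff)

lemma bil_ext_assoc:
  assumes a: "a \<in> carrier (free_module K X)" and b: "b \<in> carrier (free_module K Y)"
    and c: "c \<in> carrier (free_module K Z)"
    and cl: "\<And>x y. x \<in> X \<Longrightarrow> y \<in> Y \<Longrightarrow> \<mu> x y \<in> U" "\<And>x z. x \<in> U \<Longrightarrow> z \<in> Z \<Longrightarrow> \<nu> x z \<in> W"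
      "\<And>y z. y \<in> Y \<Longrightarrow> z \<in> Z \<Longrightarrow> \<rho> y z \<in> V" "\<And>x y. x \<in> X \<Longrightarrow> y \<in> V \<Longrightarrow> \<sigma> x y \<in> W"
    and eq: "\<And>x y z. x \<in> X \<Longrightarrow> y \<in> Y \<Longrightarrow> z \<in> Z \<Longrightarrow> \<nu> (\<mu> x y) z = \<sigma> x (\<rho> y z)"
  shows "bil_ext K \<nu> (bil_ext K \<mu> a b) c = bil_ext K \<sigma> a (bil_ext K \<rho> b c)"
proof -
  note R = K.ring_axioms
  note FB = free_basis_closed[OF R]
  note E = hom_eq_on_basis[OF R free_module_left_module[OF R, of W]]
  note cl\<mu> = bil_ext_closed[of _ X _ Y \<mu> U, OF _ _ cl(1)]
    and cl\<rho> = bil_ext_closed[of _ Y _ Z \<rho> V, OF _ _ cl(3)]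
    and r\<mu> = bil_ext_hom_right[of _ X Y \<mu> U, OF _ cl(1)] and l\<mu> = bil_ext_hom_left[of _ Y X \<mu> U, OF _ cl(1)]
    and r\<nu> = bil_ext_hom_right[of _ U Z \<nu> W, OF _ cl(2)] and l\<nu> = bil_ext_hom_left[of _ Z U \<nu> W, OF _ cl(2)]
    and r\<rho> = bil_ext_hom_right[of _ Y Z \<rho> V, OF _ cl(3)] and l\<rho> = bil_ext_hom_left[of _ Z Y \<rho> V, OF _ cl(3)]
    and r\<sigma> = bil_ext_hom_right[of _ X V \<sigma> W, OF _ cl(4)] and l\<sigma> = bil_ext_hom_left[of _ V X \<sigma> W, OF _ cl(4)]
  have 1: "bil_ext K \<nu> (bil_ext K \<mu> (free_basis K x) (free_basis K y)) c =
      bil_ext K \<sigma> (free_basis K x) (bil_ext K \<rho> (free_basis K y) c)" if x: "x \<in> X" and y: "y \<in> Y" for x y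
    by (rule E[OF r\<nu>[OF cl\<mu>[OF FB[OF x] FB[OF y]]] mod_hom_comp[OF r\<rho>[OF FB[OF y]] r\<sigma>[OF FB[OF x]]] _ c])
      (simp_all add: bil_ext_basis eq x y)
  have 2: "bil_ext K \<nu> (bil_ext K \<mu> (free_basis K x) b) c =
      bil_ext K \<sigma> (free_basis K x) (bil_ext K \<rho> b c)" if x: "x \<in> X" for x
    by (rule E[OF mod_hom_comp[OF r\<mu>[OF FB[OF x]] l\<nu>[OF c]]
        mod_hom_comp[OF l\<rho>[OF c] r\<sigma>[OF FB[OF x]]] _ b])
      (simp_all add: x 1)
  show ?thesis
    by (rule E[OF mod_hom_comp[OF l\<mu>[OF b] l\<nu>[OF c]] l\<sigma>[OF cl\<rho>[OF b c]] _ a])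
      (simp_all add: 2)
qed

lemma bil_ext_unit:
  assumes a: "a \<in> carrier (free_module K X)" and e: "\<And>x. x \<in> X \<Longrightarrow> \<mu> e x = x"
  shows "bil_ext K \<mu> (free_basis K e) a = a"
proof (rule hom_eq_on_basis[OF K.ring_axioms free_module_left_module[OF K.ring_axioms] _ _ _ a])
  show "bil_ext K \<mu> (free_basis K e) \<in> mod_hom K (free_module K X) (free_module K X)"
    by (rule bil_ext_hom_right[OF free_basis_closed[OF K.ring_axioms, of e "{e}"]]) (auto simp: e)
  show "(\<lambda>a. a) \<in> mod_hom K (free_module K X) (free_module K X)"
    by (auto simp: mod_hom_def)
qed (simp add: bil_ext_basis e)

lemma abelian_group_cong:
  assumes "abelian_group A" "carrier B = carrier A" "zero B = zero A" "add B = add A"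
  shows "abelian_group B"
proof -
  interpret A: abelian_group A by fact
  show ?thesis
    by (rule abelian_groupI; unfold assms(2-4))
      (auto simp: A.a_assoc intro: A.a_comm A.l_neg A.a_inv_closed)
qed

lemma semigroup_algebra_simps:
  "carrier (semigroup_algebra K S) = carrier (free_module K (carrier S))"
  "zero (semigroup_algebra K S) = zero (free_module K (carrier S))"
  "add (semigroup_algebra K S) = add (free_module K (carrier S))"
  "mult (semigroup_algebra K S) = bil_ext K (mult S)"
  "one (semigroup_algebra K S) = free_basis K (one S)"
  by (simp_all add: semigroup_algebra_def)

lemma mod_homD:
  assumes "h \<in> mod_hom R M N"
  shows "x \<in> carrier M \<Longrightarrow> h x \<in> carrier N"
    "x \<in> carrier M \<Longrightarrow> y \<in> carrier M \<Longrightarrow> h (x \<oplus>\<^bsub>M\<^esub> y) = h x \<oplus>\<^bsub>N\<^esub> h y"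
  using assms by (auto simp: mod_hom_def)

theorem semigroup_algebra_ring:
  assumes "Group.monoid S" shows "ring (semigroup_algebra K S)"
proof -
  interpret S: Group.monoid S by fact
  interpret F: left_module K "free_module K (carrier S)"
    by (rule free_module_left_module) (rule K.ring_axioms)
  note l = bil_ext_hom_left[of _ "carrier S" "carrier S" "mult S" "carrier S", OF _ S.m_closed]
  note r = bil_ext_hom_right[of _ "carrier S" "carrier S" "mult S" "carrier S", OF _ S.m_closed]
  have one: "bil_ext K (mult S) a (free_basis K \<one>\<^bsub>S\<^esub>) = a"
    if a: "a \<in> carrier (free_module K (carrier S))" for a
    using bil_ext_unit[OF a, of "\<lambda>x y. y \<otimes>\<^bsub>S\<^esub> x" "\<one>\<^bsub>S\<^esub>"]
      bil_ext_flip[OF a free_basis_closed[OF K.ring_axioms S.one_closed], of "mult S"]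
    by simp
  show ?thesis
  proof (rule ringI)
    show "abelian_group (semigroup_algebra K S)"
      by (rule abelian_group_cong[OF F.M.abelian_group_axioms]) (simp_all add: semigroup_algebra_simps)
    show "Group.monoid (semigroup_algebra K S)"
    proof (rule Group.monoidI, unfold semigroup_algebra_simps)
      show "bil_ext K (mult S) a b \<in> carrier (free_module K (carrier S))"
        if "a \<in> carrier (free_module K (carrier S))" "b \<in> carrier (free_module K (carrier S))" for a b
        using bil_ext_closed[OF that S.m_closed] .
      show "free_basis K \<one>\<^bsub>S\<^esub> \<in> carrier (free_module K (carrier S))"
        by (rule free_basis_closed[OF K.ring_axioms S.one_closed])
      show "bil_ext K (mult S) (bil_ext K (mult S) a b) c = bil_ext K (mult S) a (bil_ext K (mult S) b c)"
        if "a \<in> carrier (free_module K (carrier S))" "b \<in> carrier (free_module K (carrier S))"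
          "c \<in> carrier (free_module K (carrier S))" for a b c
        by (rule bil_ext_assoc[of _ "carrier S" _ "carrier S" _ "carrier S" "mult S" "carrier S" "mult S"
            "carrier S" "mult S" "carrier S" "mult S", OF that S.m_closed S.m_closed S.m_closed S.m_closed S.m_assoc])
      show "bil_ext K (mult S) (free_basis K \<one>\<^bsub>S\<^esub>) a = a"
        if "a \<in> carrier (free_module K (carrier S))" for a
        by (rule bil_ext_unit[OF that]) simp
    qed (use one in auto)
  qed (use mod_homD(2)[OF l] mod_homD(2)[OF r] in \<open>simp_all add: semigroup_algebra_simps\<close>)
qed

lemma idempotent_module_left_module:
  assumes S: "Group.monoid S"
    and cl: "\<And>s e. s \<in> carrier S \<Longrightarrow> e \<in> idempotents S \<Longrightarrow>
      s \<otimes>\<^bsub>S\<^esub> e \<otimes>\<^bsub>S\<^esub> semigroup_inverse S s \<in> idempotents S"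
    and inv: "\<And>s. s \<in> carrier S \<Longrightarrow> semigroup_inverse S s \<in> carrier S"
    and inv_mult: "\<And>s t. s \<in> carrier S \<Longrightarrow> t \<in> carrier S \<Longrightarrow>
      semigroup_inverse S (s \<otimes>\<^bsub>S\<^esub> t) = semigroup_inverse S t \<otimes>\<^bsub>S\<^esub> semigroup_inverse S s"
    and inv_one: "semigroup_inverse S \<one>\<^bsub>S\<^esub> = \<one>\<^bsub>S\<^esub>"
  shows "left_module (semigroup_algebra K S) (idempotent_module K S)"
proof -
  interpret S: Group.monoid S by fact
  let ?E = "idempotents S"
  let ?\<mu> = "\<lambda>s e. s \<otimes>\<^bsub>S\<^esub> e \<otimes>\<^bsub>S\<^esub> semigroup_inverse S s"
  interpret F: left_module K "free_module K ?E"
    by (rule free_module_left_module) (rule K.ring_axioms)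
  have E: "e \<in> carrier S" if "e \<in> ?E" for e using that by (simp add: idempotents_def)
  have s: "carrier (idempotent_module K S) = carrier (free_module K ?E)"
    "zero (idempotent_module K S) = zero (free_module K ?E)"
    "add (idempotent_module K S) = add (free_module K ?E)"
    "smult (idempotent_module K S) = bil_ext K ?\<mu>"
    by (simp_all add: idempotent_module_def)
  note l = bil_ext_hom_left[of _ ?E "carrier S" ?\<mu> ?E, OF _ cl]
  note r = bil_ext_hom_right[of _ "carrier S" ?E ?\<mu> ?E, OF _ cl]
  have "abelian_group (idempotent_module K S)"
    by (rule abelian_group_cong[OF F.M.abelian_group_axioms]) (simp_all add: s)
  moreover have "bil_ext K ?\<mu> (bil_ext K (mult S) a b) x = bil_ext K ?\<mu> a (bil_ext K ?\<mu> b x)"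
    if "a \<in> carrier (free_module K (carrier S))" "b \<in> carrier (free_module K (carrier S))"
      "x \<in> carrier (free_module K ?E)" for a b x
    by (rule bil_ext_assoc[of _ "carrier S" _ "carrier S" _ ?E "mult S" "carrier S" ?\<mu> ?E ?\<mu> ?E ?\<mu>,
        OF that S.m_closed cl cl cl])
      (auto simp: inv_mult inv E S.m_assoc)
  moreover have "bil_ext K ?\<mu> (free_basis K \<one>\<^bsub>S\<^esub>) x = x" if "x \<in> carrier (free_module K ?E)" for x
    by (rule bil_ext_unit[OF that]) (simp add: inv_one E)
  ultimately show ?thesis
    by (intro left_module.intro left_module_axioms.intro semigroup_algebra_ring S)
      (use mod_homD[OF l] mod_homD[OF r] in \<open>simp_all add: s semigroup_algebra_simps\<close>)
qed

end


section \<open>\<open>S(G)\<close> is an inverse monoid\<close>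

locale exel = G?: Group.group G for G :: "('g, 'x) monoid_scheme" (structure)
begin

abbreviation (input) "SG \<equiv> exel_monoid G"
abbreviation (input) "sy \<equiv> exel_sym G"

lemma exel_words_append: "u \<in> exel_words G \<Longrightarrow> v \<in> exel_words G \<Longrightarrow> u @ v \<in> exel_words G"
  by (auto simp: exel_words_def)

lemma exel_cong_words: "(u, v) \<in> exel_cong G \<Longrightarrow> u \<in> exel_words G \<and> v \<in> exel_words G"
proof (induction rule: exel_cong.induct)
  case (exel_cong_rel u v)
  then show ?case by cases (auto simp: exel_words_def)
qed (simp_all add: exel_words_append)

lemma exel_cong_equiv: "equiv (exel_words G) (exel_cong G)"
proof (rule equivI)
  show "exel_cong G \<subseteq> exel_words G \<times> exel_words G" using exel_cong_words by auto
  show "refl_on (exel_words G) (exel_cong G)" by (simp add: refl_on_def exel_cong_refl)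
  show "sym (exel_cong G)" by (rule symI) (rule exel_cong_sym)
  show "trans (exel_cong G)" by (rule transI) (rule exel_cong_trans)
qed

lemma exel_mult_class:
  assumes "u \<in> exel_words G" "v \<in> exel_words G"
  shows "(exel_cong G `` {u}) \<otimes>\<^bsub>SG\<^esub> (exel_cong G `` {v}) = exel_cong G `` {u @ v}"
proof -
  let ?A = "exel_cong G `` {u}" and ?B = "exel_cong G `` {v}" and ?C = "exel_cong G `` {u @ v}"
  have "exel_cong G `` {u' @ v'} = ?C" if "u' \<in> ?A" "v' \<in> ?B" for u' v'
    by (rule equiv_class_eq[OF exel_cong_equiv exel_cong_sym[OF exel_cong_append]])
      (use that in simp_all)
  then have "(\<Union>u'\<in>?A. \<Union>v'\<in>?B. exel_cong G `` {u' @ v'}) = (\<Union>u'\<in>?A. \<Union>v'\<in>?B. ?C)"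
    by (intro SUP_cong HOL.refl)
  also have "\<dots> = ?C"
    using equiv_class_self[OF exel_cong_equiv assms(1)] equiv_class_self[OF exel_cong_equiv assms(2)]
    by (simp only: UN_constant) auto
  finally show ?thesis by (simp add: exel_monoid_def)
qed

lemma exel_classE:
  assumes "s \<in> carrier SG"
  obtains u where "u \<in> exel_words G" "s = exel_cong G `` {u}"
proof -
  from assms have "s \<in> exel_words G // exel_cong G" by (simp add: exel_monoid_def)
  then show ?thesis by (rule quotientE) (rule that)
qed

lemma exel_class_closed: "u \<in> exel_words G \<Longrightarrow> exel_cong G `` {u} \<in> carrier SG"
  by (simp add: exel_monoid_def quotientI)

lemma exel_sym_closed: "g \<in> carrier G \<Longrightarrow> sy g \<in> carrier SG"
  unfolding exel_sym_def by (rule exel_class_closed) (simp add: exel_words_def)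

lemma exel_one: "\<one>\<^bsub>SG\<^esub> = sy \<one>"
  by (simp add: exel_monoid_def)

lemma exel_mult_closed: "s \<in> carrier SG \<Longrightarrow> t \<in> carrier SG \<Longrightarrow> s \<otimes>\<^bsub>SG\<^esub> t \<in> carrier SG"
  by (elim exel_classE) (simp add: exel_mult_class exel_class_closed exel_words_append)

lemma exel_assoc:
  "s \<in> carrier SG \<Longrightarrow> t \<in> carrier SG \<Longrightarrow> r \<in> carrier SG \<Longrightarrow>
    s \<otimes>\<^bsub>SG\<^esub> t \<otimes>\<^bsub>SG\<^esub> r = s \<otimes>\<^bsub>SG\<^esub> (t \<otimes>\<^bsub>SG\<^esub> r)"
  by (elim exel_classE) (simp add: exel_mult_class exel_words_append)

lemma exel_class_Cons:
  assumes "g \<in> carrier G" "u \<in> exel_words G"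
  shows "exel_cong G `` {g # u} = sy g \<otimes>\<^bsub>SG\<^esub> exel_cong G `` {u}"
  using exel_mult_class[of "[g]" u] assms by (simp add: exel_sym_def exel_words_def)

lemma exel_rel_eq: "exel_rel G u v \<Longrightarrow> exel_cong G `` {u} = exel_cong G `` {v}"
  by (rule equiv_class_eq[OF exel_cong_equiv exel_cong_rel])

lemma exel_R1:
  assumes "g \<in> carrier G" "h \<in> carrier G"
  shows "sy (inv g) \<otimes>\<^bsub>SG\<^esub> (sy g \<otimes>\<^bsub>SG\<^esub> sy h) = sy (inv g) \<otimes>\<^bsub>SG\<^esub> sy (g \<otimes> h)"
  using exel_rel_eq[OF exel_rel.intros(1)[OF assms]] assms
  by (simp add: exel_class_Cons exel_words_def flip: exel_sym_def)

lemma exel_R2: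
  assumes "g \<in> carrier G" "h \<in> carrier G"
  shows "sy g \<otimes>\<^bsub>SG\<^esub> (sy h \<otimes>\<^bsub>SG\<^esub> sy (inv h)) = sy (g \<otimes> h) \<otimes>\<^bsub>SG\<^esub> sy (inv h)"
  using exel_rel_eq[OF exel_rel.intros(2)[OF assms]] assms
  by (simp add: exel_class_Cons exel_words_def flip: exel_sym_def)

lemma exel_R3: "g \<in> carrier G \<Longrightarrow> sy g \<otimes>\<^bsub>SG\<^esub> sy \<one> = sy g"
  using exel_rel_eq[OF exel_rel.intros(3)[of g G]]
  by (simp add: exel_class_Cons exel_words_def flip: exel_sym_def)

lemma exel_L3:
  assumes g: "g \<in> carrier G" shows "sy \<one> \<otimes>\<^bsub>SG\<^esub> sy g = sy g"
  using exel_R1[of "inv g" g] exel_R2[of g "inv g"] exel_R3[OF g] g by simp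

lemma exel_induct [consumes 1, case_names sy mult]:
  assumes "s \<in> carrier SG" "\<And>g. g \<in> carrier G \<Longrightarrow> P (sy g)"
    "\<And>g t. g \<in> carrier G \<Longrightarrow> t \<in> carrier SG \<Longrightarrow> P t \<Longrightarrow> P (sy g \<otimes>\<^bsub>SG\<^esub> t)"
  shows "P s"
proof -
  obtain u where u: "u \<in> exel_words G" "s = exel_cong G `` {u}" using exel_classE[OF assms(1)] .
  have "P (exel_cong G `` {u})" using u(1)
  proof (induction u)
    case (Cons g u)
    show ?case
    proof (cases "u = []")
      case True
      then show ?thesis using Cons assms(2)[of g] by (simp add: exel_sym_def exel_words_def)
    next
      case False
      then have "g \<in> carrier G" "u \<in> exel_words G" using Cons by (auto simp: exel_words_def)
      then show ?thesis using Cons.IH assms(3) exel_class_closed by (simp add: exel_class_Cons)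
    qed
  qed (simp add: exel_words_def)
  then show ?thesis using u by simp
qed

theorem exel_monoid_monoid: "Group.monoid SG"
proof (rule Group.monoidI)
  show "\<one>\<^bsub>SG\<^esub> \<otimes>\<^bsub>SG\<^esub> s = s" if "s \<in> carrier SG" for s
    using that
    by (induction rule: exel_induct)
      (simp_all add: exel_one exel_L3 exel_sym_closed flip: exel_assoc)
  show "s \<otimes>\<^bsub>SG\<^esub> \<one>\<^bsub>SG\<^esub> = s" if "s \<in> carrier SG" for s
    using that
    by (induction rule: exel_induct) (simp_all add: exel_one exel_R3 exel_sym_closed exel_assoc)
qed (auto simp: exel_one exel_sym_closed exel_mult_closed exel_assoc)

interpretation S: Group.monoid SG by (rule exel_monoid_monoid)

abbreviation (input) "e \<equiv> exel_e G"
abbreviation m (infixl "\<cdot>" 70) where "s \<cdot> t \<equiv> s \<otimes>\<^bsub>SG\<^esub> t"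

lemmas [simp] = exel_sym_closed

lemma e_closed [simp]: "g \<in> carrier G \<Longrightarrow> e g \<in> carrier SG"
  by (simp add: exel_e_def)

lemma R1':
  assumes "g \<in> carrier G" "h \<in> carrier G"
  shows "sy g \<cdot> (sy (inv g) \<cdot> sy h) = sy g \<cdot> sy (inv g \<otimes> h)"
  using exel_R1[OF G.inv_closed[OF assms(1)] assms(2)] unfolding G.inv_inv[OF assms(1)] .

lemma e_sy:
  assumes "g \<in> carrier G" shows "e g \<cdot> sy g = sy g"
  using R1'[OF assms assms] assms
  by (simp only: exel_e_def S.m_assoc exel_sym_closed G.inv_closed G.l_inv exel_R3)

lemma e_idem:
  assumes "g \<in> carrier G" shows "e g \<cdot> e g = e g"
proof -
  have "e g \<cdot> e g = e g \<cdot> (sy g \<cdot> sy (inv g))" by (simp only: exel_e_def)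
  also have "\<dots> = e g \<cdot> sy g \<cdot> sy (inv g)"
    using assms by (intro S.m_assoc[symmetric]) auto
  finally show ?thesis unfolding e_sy[OF assms] exel_e_def[symmetric] .
qed

lemma sy_mult:
  assumes g: "g \<in> carrier G" and h: "h \<in> carrier G"
  shows "sy g \<cdot> sy h = e g \<cdot> sy (g \<otimes> h)"
proof -
  have 1: "inv g \<otimes> (g \<otimes> h) = h" using g h by (simp add: G.m_assoc[symmetric])
  have "sy g \<cdot> (sy (inv g) \<cdot> sy (g \<otimes> h)) = sy g \<cdot> sy h"
    using R1'[OF g G.m_closed[OF g h]] unfolding 1 .
  moreover have "e g \<cdot> sy (g \<otimes> h) = sy g \<cdot> (sy (inv g) \<cdot> sy (g \<otimes> h))"
    unfolding exel_e_def using g h by (intro S.m_assoc) auto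
  ultimately show ?thesis by (simp only:)
qed

lemma sy_e:
  assumes g: "g \<in> carrier G" and h: "h \<in> carrier G"
  shows "sy g \<cdot> e h = e (g \<otimes> h) \<cdot> sy g"
proof -
  have 1: "g \<otimes> h \<otimes> inv h = g" using g h by (simp add: G.m_assoc)
  have "sy g \<cdot> e h = sy (g \<otimes> h) \<cdot> sy (inv h)"
    using exel_R2[OF g h] by (simp only: exel_e_def)
  also have "\<dots> = e (g \<otimes> h) \<cdot> sy (g \<otimes> h \<otimes> inv h)" using g h by (intro sy_mult) auto
  finally show ?thesis unfolding 1 .
qed

lemma e_comm:
  assumes g: "g \<in> carrier G" and h: "h \<in> carrier G"
  shows "e g \<cdot> e h = e h \<cdot> e g"
proof -
  have k: "inv g \<otimes> h \<in> carrier G" "g \<otimes> (inv g \<otimes> h) = h"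
    using g h by (simp_all add: G.m_assoc[symmetric])
  have "e g \<cdot> e h = sy g \<cdot> (sy (inv g) \<cdot> e h)"
    using g h by (simp add: exel_e_def[of G g] S.m_assoc)
  also have "\<dots> = (sy g \<cdot> e (inv g \<otimes> h)) \<cdot> sy (inv g)"
    using g h k(1) sy_e[of "inv g" h] by (simp add: S.m_assoc)
  also have "\<dots> = e h \<cdot> e g"
    using g h k sy_e[OF g k(1)] by (simp add: exel_e_def[of G g] S.m_assoc)
  finally show ?thesis .
qed

inductive_set Pe where
  Pe_one: "\<one>\<^bsub>SG\<^esub> \<in> Pe"
| Pe_mult: "g \<in> carrier G \<Longrightarrow> p \<in> Pe \<Longrightarrow> e g \<cdot> p \<in> Pe"

lemma Pe_closed [simp]: "p \<in> Pe \<Longrightarrow> p \<in> carrier SG"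
  by (induction rule: Pe.induct) auto

lemma e_Pe_comm: "p \<in> Pe \<Longrightarrow> g \<in> carrier G \<Longrightarrow> p \<cdot> e g = e g \<cdot> p"
proof (induction rule: Pe.induct)
  case (Pe_mult h p)
  have "e h \<cdot> p \<cdot> e g = e h \<cdot> (e g \<cdot> p)" using Pe_mult by (simp add: S.m_assoc)
  also have "\<dots> = (e h \<cdot> e g) \<cdot> p" using Pe_mult by (intro S.m_assoc[symmetric]) auto
  also have "\<dots> = (e g \<cdot> e h) \<cdot> p" using e_comm[of g h] Pe_mult by simp
  also have "\<dots> = e g \<cdot> (e h \<cdot> p)" using Pe_mult by (intro S.m_assoc) auto
  finally show ?case .
qed auto

lemma Pe_comm: "p \<in> Pe \<Longrightarrow> q \<in> Pe \<Longrightarrow> p \<cdot> q = q \<cdot> p"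
proof (induction rule: Pe.induct)
  case (Pe_mult h p)
  have "e h \<cdot> p \<cdot> q = e h \<cdot> (q \<cdot> p)" using Pe_mult by (simp add: S.m_assoc)
  also have "\<dots> = (e h \<cdot> q) \<cdot> p" using Pe_mult by (intro S.m_assoc[symmetric]) auto
  also have "\<dots> = (q \<cdot> e h) \<cdot> p" using e_Pe_comm[of q h] Pe_mult by simp
  also have "\<dots> = q \<cdot> (e h \<cdot> p)" using Pe_mult by (intro S.m_assoc) auto
  finally show ?case .
qed auto

lemma Pe_Pe: "p \<in> Pe \<Longrightarrow> q \<in> Pe \<Longrightarrow> p \<cdot> q \<in> Pe"
  by (induction rule: Pe.induct) (auto simp: S.m_assoc intro: Pe.intros)

lemma Pe_idem: "p \<in> Pe \<Longrightarrow> p \<cdot> p = p"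
proof (induction rule: Pe.induct)
  case (Pe_mult h p)
  have "e h \<cdot> p \<cdot> (e h \<cdot> p) = e h \<cdot> (p \<cdot> e h) \<cdot> p" using Pe_mult by (simp add: S.m_assoc)
  also have "\<dots> = (e h \<cdot> e h) \<cdot> (p \<cdot> p)"
    unfolding e_Pe_comm[OF Pe_mult(2,1)] using Pe_mult(1,2) by (simp add: S.m_assoc)
  finally show ?case using Pe_mult by (simp add: e_idem)
qed auto

lemma sy_Pe:
  assumes "p \<in> Pe" "g \<in> carrier G" obtains q where "q \<in> Pe" "sy g \<cdot> p = q \<cdot> sy g"
proof -
  have "\<exists>q\<in>Pe. sy g \<cdot> p = q \<cdot> sy g" using assms
  proof (induction rule: Pe.induct)
    case Pe_one
    then show ?case by (intro bexI[where x = "\<one>\<^bsub>SG\<^esub>"]) (auto intro: Pe.intros)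
  next
    case (Pe_mult h p)
    then obtain q where q: "q \<in> Pe" "sy g \<cdot> p = q \<cdot> sy g" by blast
    have "sy g \<cdot> (e h \<cdot> p) = e (g \<otimes> h) \<cdot> sy g \<cdot> p"
      using Pe_mult sy_e[of g h, symmetric] by (simp add: S.m_assoc)
    also have "\<dots> = e (g \<otimes> h) \<cdot> q \<cdot> sy g" using q Pe_mult by (simp add: S.m_assoc)
    finally show ?case using q Pe_mult by (intro bexI[where x = "e (g \<otimes> h) \<cdot> q"]) (auto intro: Pe.intros)
  qed
  then show ?thesis using that by blast
qed

lemma normal_form:
  assumes "s \<in> carrier SG"
  obtains p g where "p \<in> Pe" "g \<in> carrier G" "s = p \<cdot> sy g"
proof -
  have "\<exists>p g. p \<in> Pe \<and> g \<in> carrier G \<and> s = p \<cdot> sy g" using assms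
  proof (induction rule: exel_induct)
    case (sy g)
    then show ?case by (intro exI[of _ "\<one>\<^bsub>SG\<^esub>"] exI[of _ g]) (auto intro: Pe.intros)
  next
    case (mult g t)
    then obtain p h where t: "p \<in> Pe" "h \<in> carrier G" "t = p \<cdot> sy h" by blast
    obtain q where q: "q \<in> Pe" "sy g \<cdot> p = q \<cdot> sy g" using sy_Pe[OF t(1) mult(1)] .
    have "sy g \<cdot> t = (sy g \<cdot> p) \<cdot> sy h" using t mult by (simp add: S.m_assoc)
    also have "\<dots> = q \<cdot> (sy g \<cdot> sy h)" unfolding q(2) using q(1) t mult by (simp add: S.m_assoc)
    also have "\<dots> = q \<cdot> e g \<cdot> sy (g \<otimes> h)"
      unfolding sy_mult[OF mult(1) t(2)] using q(1) t mult by (simp add: S.m_assoc)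
    finally have "sy g \<cdot> t = q \<cdot> e g \<cdot> sy (g \<otimes> h)" .
    moreover have "q \<cdot> e g \<in> Pe" using q mult Pe.intros e_Pe_comm by simp
    ultimately show ?case using t mult by (metis G.m_closed)
  qed
  then show ?thesis using that by blast
qed

definition deg :: "'g list set \<Rightarrow> 'g"
  where "deg s = mult_list G (SOME u. u \<in> s)"

lemma mult_list_closed: "set u \<subseteq> carrier G \<Longrightarrow> mult_list G u \<in> carrier G"
  by (induction u) (auto simp: mult_list_def)

lemma mult_list_append:
  "set u \<subseteq> carrier G \<Longrightarrow> set v \<subseteq> carrier G \<Longrightarrow> mult_list G (u @ v) = mult_list G u \<otimes> mult_list G v"
proof (induction u)
  case Nil
  then show ?case using mult_list_closed[of v] by (simp add: mult_list_def)
next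
  case (Cons g u)
  then show ?case using mult_list_closed[of u] mult_list_closed[of v]
    by (simp add: mult_list_def G.m_assoc)
qed

lemma exel_cong_deg: "(u, v) \<in> exel_cong G \<Longrightarrow> mult_list G u = mult_list G v"
proof (induction rule: exel_cong.induct)
  case (exel_cong_rel u v)
  then show ?case by cases (auto simp: mult_list_def G.m_assoc)
next
  case (exel_cong_append u u' v v')
  then show ?case
    using exel_cong_words[of u u'] exel_cong_words[of v v']
    by (auto simp: mult_list_append exel_words_def subset_iff)
qed auto

lemma deg_class:
  assumes "u \<in> exel_words G" shows "deg (exel_cong G `` {u}) = mult_list G u"
proof -
  have "u \<in> exel_cong G `` {u}" using equiv_class_self[OF exel_cong_equiv assms] .
  then have "(SOME v. v \<in> exel_cong G `` {u}) \<in> exel_cong G `` {u}" by (rule someI)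
  then show ?thesis unfolding deg_def using exel_cong_deg by force
qed

lemma deg_mult: "s \<in> carrier SG \<Longrightarrow> t \<in> carrier SG \<Longrightarrow> deg (s \<cdot> t) = deg s \<otimes> deg t"
  by (elim exel_classE)
    (auto simp: exel_mult_class deg_class exel_words_append mult_list_append exel_words_def subset_iff)

lemma deg_sy: "g \<in> carrier G \<Longrightarrow> deg (sy g) = g"
  unfolding exel_sym_def by (subst deg_class) (auto simp: exel_words_def mult_list_def)

lemma deg_Pe: "p \<in> Pe \<Longrightarrow> deg p = \<one>"
proof (induction rule: Pe.induct)
  case Pe_one
  then show ?case by (simp add: exel_one deg_sy)
next
  case (Pe_mult g p)
  then show ?case by (simp add: deg_mult exel_e_def deg_sy)
qed

lemma idempotents_Pe: "idempotents SG = Pe"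
proof
  show "Pe \<subseteq> idempotents SG" by (auto simp: idempotents_def Pe_idem)
  show "idempotents SG \<subseteq> Pe"
  proof
    fix s assume "s \<in> idempotents SG"
    then have s: "s \<in> carrier SG" "s \<cdot> s = s" by (auto simp: idempotents_def)
    obtain p g where p: "p \<in> Pe" "g \<in> carrier G" "s = p \<cdot> sy g" using normal_form[OF s(1)] .
    have d: "deg s = g" using p by (simp add: deg_mult deg_Pe deg_sy)
    have "g \<otimes> g = g" using arg_cong[OF s(2), of deg] s(1) d by (simp add: deg_mult)
    then have "g = \<one>" using p(2) by simp
    then show "s \<in> Pe" using p by (simp flip: exel_one)
  qed
qed

lemma inverse_exists:
  assumes "s \<in> carrier SG"
  obtains t where "t \<in> carrier SG" "s \<cdot> t \<cdot> s = s" "t \<cdot> s \<cdot> t = t"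
proof -
  obtain p g where p: "p \<in> Pe" "g \<in> carrier G" "s = p \<cdot> sy g" using normal_form[OF assms] .
  let ?t = "sy (inv g) \<cdot> p"
  have 1: "s \<cdot> ?t = p \<cdot> e g"
  proof -
    have "s \<cdot> ?t = p \<cdot> (e g \<cdot> p)" using p by (simp add: exel_e_def S.m_assoc)
    also have "\<dots> = (p \<cdot> p) \<cdot> e g"
      unfolding e_Pe_comm[OF p(1,2), symmetric] using p by (simp add: S.m_assoc)
    finally show ?thesis using p by (simp add: Pe_idem)
  qed
  have "s \<cdot> ?t \<cdot> s = p \<cdot> (e g \<cdot> p) \<cdot> sy g" unfolding 1 using p by (simp add: S.m_assoc)
  also have "\<dots> = (p \<cdot> p) \<cdot> (e g \<cdot> sy g)"
    unfolding e_Pe_comm[OF p(1,2), symmetric] using p(1,2) by (simp add: S.m_assoc)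
  also have "\<dots> = s" using p by (simp add: Pe_idem e_sy)
  finally have 2: "s \<cdot> ?t \<cdot> s = s" .
  have 3: "sy (inv g) \<cdot> e g = sy (inv g)"
    using exel_R1[of g "inv g"] p by (simp add: exel_e_def exel_R3)
  have "?t \<cdot> s \<cdot> ?t = ?t \<cdot> (p \<cdot> e g)" using 1 p by (simp add: S.m_assoc)
  also have "\<dots> = sy (inv g) \<cdot> ((p \<cdot> p) \<cdot> e g)" using p by (simp add: S.m_assoc)
  also have "\<dots> = sy (inv g) \<cdot> e g \<cdot> p" using p by (simp add: Pe_idem e_Pe_comm S.m_assoc)
  also have "\<dots> = ?t" using 3 by simp
  finally show ?thesis using 2 p by (intro that[of ?t]) auto
qed

lemma idempotents_comm: "x \<in> idempotents SG \<Longrightarrow> y \<in> idempotents SG \<Longrightarrow> x \<cdot> y = y \<cdot> x"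
  unfolding idempotents_Pe by (rule Pe_comm)

lemma inverse_unique:
  assumes c: "s \<in> carrier SG" "t \<in> carrier SG" "t' \<in> carrier SG"
    and t: "s \<cdot> t \<cdot> s = s" "t \<cdot> s \<cdot> t = t" and t': "s \<cdot> t' \<cdot> s = s" "t' \<cdot> s \<cdot> t' = t'"
  shows "t = t'"
proof -
  have i: "s \<cdot> t \<in> idempotents SG" "s \<cdot> t' \<in> idempotents SG" "t \<cdot> s \<in> idempotents SG" "t' \<cdot> s \<in> idempotents SG"
    using c t t' by (auto simp: idempotents_def simp flip: S.m_assoc)
  have "t = t \<cdot> (s \<cdot> t' \<cdot> s) \<cdot> t" using t t' by simp
  also have "\<dots> = t \<cdot> ((s \<cdot> t') \<cdot> (s \<cdot> t))" using c by (simp add: S.m_assoc)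
  also have "\<dots> = t \<cdot> ((s \<cdot> t) \<cdot> (s \<cdot> t'))" using idempotents_comm[OF i(2,1)] by simp
  also have "\<dots> = t \<cdot> s \<cdot> t \<cdot> s \<cdot> t'" using c by (simp add: S.m_assoc)
  also have "\<dots> = t \<cdot> s \<cdot> (t' \<cdot> s \<cdot> t')" using c t t' by (simp)
  also have "\<dots> = ((t \<cdot> s) \<cdot> (t' \<cdot> s)) \<cdot> t'" using c by (simp add: S.m_assoc)
  also have "\<dots> = ((t' \<cdot> s) \<cdot> (t \<cdot> s)) \<cdot> t'" using idempotents_comm[OF i(3,4)] by simp
  also have "\<dots> = t' \<cdot> (s \<cdot> t \<cdot> s) \<cdot> t'" using c by (simp add: S.m_assoc)
  also have "\<dots> = t'" using t t' by simp
  finally show ?thesis .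
qed

abbreviation (input) "iv \<equiv> semigroup_inverse SG"

lemma iv:
  assumes "s \<in> carrier SG"
  shows "iv s \<in> carrier SG" "s \<cdot> iv s \<cdot> s = s" "iv s \<cdot> s \<cdot> iv s = iv s"
proof -
  obtain t where t: "t \<in> carrier SG" "s \<cdot> t \<cdot> s = s" "t \<cdot> s \<cdot> t = t" using inverse_exists[OF assms] .
  have "iv s \<in> carrier SG \<and> s \<cdot> iv s \<cdot> s = s \<and> iv s \<cdot> s \<cdot> iv s = iv s"
    unfolding semigroup_inverse_def
    by (rule theI[where a = t]) (use t assms inverse_unique in blast)+
  then show "iv s \<in> carrier SG" "s \<cdot> iv s \<cdot> s = s" "iv s \<cdot> s \<cdot> iv s = iv s" by auto
qed

lemma iv_eq:
  assumes "s \<in> carrier SG" "t \<in> carrier SG" "s \<cdot> t \<cdot> s = s" "t \<cdot> s \<cdot> t = t"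
  shows "iv s = t"
  using inverse_unique[OF assms(1) iv(1)[OF assms(1)] assms(2) iv(2,3)[OF assms(1)] assms(3,4)] .

lemma iv_one: "iv \<one>\<^bsub>SG\<^esub> = \<one>\<^bsub>SG\<^esub>"
  by (rule iv_eq) auto

lemma iv_idem:
  assumes s: "s \<in> carrier SG"
  shows "s \<cdot> iv s \<in> idempotents SG" "iv s \<cdot> s \<in> idempotents SG"
  using iv[OF s] s by (auto simp: idempotents_def simp flip: S.m_assoc)

lemma iv_mult:
  assumes s: "s \<in> carrier SG" and t: "t \<in> carrier SG"
  shows "iv (s \<cdot> t) = iv t \<cdot> iv s"
proof (rule iv_eq)
  note c = s t iv(1)[OF s] iv(1)[OF t]
  note cm = idempotents_comm[OF iv_idem(1)[OF t] iv_idem(2)[OF s]]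
  have "s \<cdot> t \<cdot> (iv t \<cdot> iv s) \<cdot> (s \<cdot> t) = s \<cdot> ((t \<cdot> iv t) \<cdot> (iv s \<cdot> s)) \<cdot> t"
    using c by (simp add: S.m_assoc)
  also have "\<dots> = (s \<cdot> iv s \<cdot> s) \<cdot> (t \<cdot> iv t \<cdot> t)" unfolding cm using c by (simp add: S.m_assoc)
  finally show "s \<cdot> t \<cdot> (iv t \<cdot> iv s) \<cdot> (s \<cdot> t) = s \<cdot> t" using iv[OF s] iv[OF t] by simp
  have "iv t \<cdot> iv s \<cdot> (s \<cdot> t) \<cdot> (iv t \<cdot> iv s) = iv t \<cdot> ((iv s \<cdot> s) \<cdot> (t \<cdot> iv t)) \<cdot> iv s"
    using c by (simp add: S.m_assoc)
  also have "\<dots> = (iv t \<cdot> t \<cdot> iv t) \<cdot> (iv s \<cdot> s \<cdot> iv s)"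
    unfolding cm[symmetric] using c by (simp add: S.m_assoc)
  finally show "iv t \<cdot> iv s \<cdot> (s \<cdot> t) \<cdot> (iv t \<cdot> iv s) = iv t \<cdot> iv s"
    using iv[OF s] iv[OF t] by simp
qed (use s t iv in auto)

lemma conj_idem:
  assumes s: "s \<in> carrier SG" and x: "x \<in> idempotents SG"
  shows "s \<cdot> x \<cdot> iv s \<in> idempotents SG"
proof -
  have x': "x \<in> carrier SG" "x \<cdot> x = x" using x by (auto simp: idempotents_def)
  have "(s \<cdot> x \<cdot> iv s) \<cdot> (s \<cdot> x \<cdot> iv s) = s \<cdot> (x \<cdot> (iv s \<cdot> s)) \<cdot> x \<cdot> iv s"
    using s x' iv(1)[OF s] by (simp add: S.m_assoc)
  also have "\<dots> = (s \<cdot> iv s \<cdot> s) \<cdot> (x \<cdot> x) \<cdot> iv s"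
    unfolding idempotents_comm[OF x iv_idem(2)[OF s]]
    using s x'(1) iv(1)[OF s] by (simp add: S.m_assoc)
  also have "\<dots> = s \<cdot> x \<cdot> iv s" using iv(2)[OF s] x' by simp
  finally show ?thesis using s x' iv(1)[OF s] by (simp add: idempotents_def)
qed

end

theorem K_par_ring:
  assumes "cring K" "Group.group G" shows "ring (K_par K G)"
  using semigroup_algebra_ring[OF assms(1) exel.exel_monoid_monoid] assms(2) by (simp add: exel_def)

theorem idempotent_module_exel:
  assumes "cring K" "Group.group G"
  shows "left_module (K_par K G) (idempotent_module K (exel_monoid G))"
proof -
  interpret exel G using assms(2) by (simp add: exel_def)
  show ?thesis
    by (rule idempotent_module_left_module[OF assms(1) exel_monoid_monoid])
      (simp_all add: conj_idem iv iv_mult iv_one)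
qed

end

(* The modules P_n, the direct sum over (g_1,...,g_n) of the left ideals K_par(G) e_(g_1,...,g_n), satisfy
   Hom(P_n, M) = C^n_par(G, M), and the formula for delta^n, read for the universal cochain with values
   in P_n, defines a differential P_(n+1) -> P_n. An element s of S(G) amounts to an idempotent s s^-1
   together with a group element g, the degree of s; in the coordinates (s s^-1; g, g g_1, ..., g g_1...g_n)
   the complex is a direct sum, over the idempotents, of ordered chain complexes of full simplices that have 1
   as a vertex. The cone with apex 1 contracts it, so that P is a projective resolution of B, and comparison
   with the free resolution defining Ext gives the isomorphisms. *)

theory Submission
  imports Defs
begin

section \<open>Additive maps and alternating sums\<close>

text \<open>For an idempotent \<open>e\<close>, evaluation at \<open>e\<close> gives
  \<open>Hom(R e, M) = e M\<close>; so each summand of \<open>P_n\<close> is projective, and the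
  cochain condition on a value is exactly what a homomorphism out of that summand requires. Write
  \<open>s = t[g]\<close> with \<open>t = s s^-1\<close> and \<open>g\<close> the degree of
  \<open>s\<close>. Moving idempotents past \<open>[g]\<close> shows that \<open>s\<close> absorbs
  \<open>e_(g_1,...,g_n)\<close> exactly when \<open>t\<close> absorbs \<open>e_h\<close> for every
  \<open>h\<close> among \<open>g g_1, ..., g g_1...g_n\<close>, while \<open>t\<close> absorbs
  \<open>e_g\<close> anyway. The simplices over \<open>t\<close> are therefore all tuples with
  entries in the set of those \<open>h\<close> with \<open>t e_h = t\<close>. This set contains 1
  because \<open>e_1\<close> is the identity, and this is what permits the apex 1. The factor
  \<open>[g_1]\<close> in the zeroth term of the differential turns \<open>t[g]\<close> into
  \<open>t[g g_1]\<close>, which deletes the vertex \<open>g\<close>; the idempotents in the other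
  terms are absorbed by \<open>s\<close>. Hence the terms are the faces of a simplex. The
  contraction is additive but in general not linear over the partial group algebra. Exactness needs
  no more than that; the linear maps and homotopies of the comparison come from
  projectivity.\<close>

lemma abelian_group_hom_additiveI:
  assumes "abelian_group M" "abelian_group N" "\<And>x. x \<in> carrier M \<Longrightarrow> h x \<in> carrier N"
    "\<And>x y. x \<in> carrier M \<Longrightarrow> y \<in> carrier M \<Longrightarrow> h (x \<oplus>\<^bsub>M\<^esub> y) = h x \<oplus>\<^bsub>N\<^esub> h y"
  shows "abelian_group_hom M N h"
proof (rule abelian_group_homI[OF assms(1,2)])
  show "group_hom (add_monoid M) (add_monoid N) h"
    using assms(3,4) abelian_group.a_group[OF assms(1)] abelian_group.a_group[OF assms(2)]
    by (auto simp: group_hom_def group_hom_axioms_def hom_def)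
qed

lemma (in abelian_group_hom) additive_finsum:
  assumes "f \<in> I \<rightarrow> carrier G" shows "h (\<Oplus>\<^bsub>G\<^esub>i\<in>I. f i) = (\<Oplus>\<^bsub>H\<^esub>i\<in>I. h (f i))"
\<comment> \<open>Over an infinite index set both sums are zero by convention, and \<open>h\<close>
  preserves zero.\<close>
proof (cases "finite I")
  case True
  then show ?thesis using assms
    by (induction I rule: finite_induct) (auto simp: Pi_iff)
qed simp

lemma (in abelian_group_hom) hom_alternate: "x \<in> carrier G \<Longrightarrow> h (alternate G i x) = alternate H i (h x)"
  by (simp add: alternate_def)

lemma (in abelian_group) alternate_closed [simp]: "x \<in> carrier G \<Longrightarrow> alternate G i x \<in> carrier G"
  by (simp add: alternate_def)

lemma (in abelian_group) alternate_Suc: "x \<in> carrier G \<Longrightarrow> alternate G (Suc i) x = \<ominus>\<^bsub>G\<^esub> alternate G i x"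
  by (simp add: alternate_def)

lemma (in abelian_group) finsum_minus:
  assumes "f \<in> I \<rightarrow> carrier G" shows "(\<Oplus>\<^bsub>G\<^esub>i\<in>I. \<ominus>\<^bsub>G\<^esub> f i) = \<ominus>\<^bsub>G\<^esub> (\<Oplus>\<^bsub>G\<^esub>i\<in>I. f i)"
proof -
  interpret h: abelian_group_hom G G "\<lambda>x. \<ominus>\<^bsub>G\<^esub> x"
    by (rule abelian_group_hom_additiveI) (auto simp: minus_add intro: abelian_group_axioms)
  show ?thesis by (rule h.additive_finsum[OF assms, symmetric])
qed

lemma (in abelian_group) alternate_add:
  "x \<in> carrier G \<Longrightarrow> y \<in> carrier G \<Longrightarrow> alternate G i (x \<oplus>\<^bsub>G\<^esub> y) = alternate G i x \<oplus>\<^bsub>G\<^esub> alternate G i y"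
  by (simp add: alternate_def minus_add)

section \<open>Left modules\<close>

lemma mod_hom_closed: "h \<in> mod_hom R M N \<Longrightarrow> x \<in> carrier M \<Longrightarrow> h x \<in> carrier N"
  by (auto simp: mod_hom_def)

lemma mod_hom_add:
  "h \<in> mod_hom R M N \<Longrightarrow> x \<in> carrier M \<Longrightarrow> y \<in> carrier M \<Longrightarrow> h (x \<oplus>\<^bsub>M\<^esub> y) = h x \<oplus>\<^bsub>N\<^esub> h y"
  by (auto simp: mod_hom_def)

lemma mod_hom_smult:
  "h \<in> mod_hom R M N \<Longrightarrow> r \<in> carrier R \<Longrightarrow> x \<in> carrier M \<Longrightarrow> h (r \<odot>\<^bsub>M\<^esub> x) = r \<odot>\<^bsub>N\<^esub> h x"
  by (auto simp: mod_hom_def)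

lemma mod_homI:
  assumes "\<And>x. x \<in> carrier M \<Longrightarrow> h x \<in> carrier N"
    "\<And>x y. x \<in> carrier M \<Longrightarrow> y \<in> carrier M \<Longrightarrow> h (x \<oplus>\<^bsub>M\<^esub> y) = h x \<oplus>\<^bsub>N\<^esub> h y"
    "\<And>r x. r \<in> carrier R \<Longrightarrow> x \<in> carrier M \<Longrightarrow> h (r \<odot>\<^bsub>M\<^esub> x) = r \<odot>\<^bsub>N\<^esub> h x"
  shows "h \<in> mod_hom R M N"
  using assms by (auto simp: mod_hom_def)

lemma mod_hom_compose:
  "h \<in> mod_hom R L M \<Longrightarrow> h' \<in> mod_hom R M N \<Longrightarrow> (\<lambda>x. h' (h x)) \<in> mod_hom R L N"
  by (auto simp: mod_hom_def Pi_iff)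

lemma mod_hom_id: "(\<lambda>x. x) \<in> mod_hom R M M"
  by (auto simp: mod_hom_def)

lemma mod_hom_abelian_group_hom:
  assumes "left_module R M" "left_module R N" "h \<in> mod_hom R M N"
  shows "abelian_group_hom M N h"
proof -
  interpret M: left_module R M by fact
  interpret N: left_module R N by fact
  show ?thesis
    by (rule abelian_group_hom_additiveI[OF M.M.abelian_group_axioms N.M.abelian_group_axioms])
      (simp_all add: mod_hom_closed[OF assms(3)] mod_hom_add[OF assms(3)])
qed

lemma mod_hom_zero:
  assumes "left_module R M" "left_module R N" "h \<in> mod_hom R M N"
  shows "h \<zero>\<^bsub>M\<^esub> = \<zero>\<^bsub>N\<^esub>"
  by (rule abelian_group_hom.hom_zero[OF mod_hom_abelian_group_hom[OF assms]])

lemma mod_hom_minus: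
  assumes "left_module R M" "left_module R N" "h \<in> mod_hom R M N" "x \<in> carrier M"
  shows "h (\<ominus>\<^bsub>M\<^esub> x) = \<ominus>\<^bsub>N\<^esub> h x"
  by (rule abelian_group_hom.hom_a_inv[OF mod_hom_abelian_group_hom[OF assms(1-3)] assms(4)])

lemma mod_hom_diff:
  assumes "left_module R M" "left_module R N" "h \<in> mod_hom R M N" "x \<in> carrier M" "y \<in> carrier M"
  shows "h (x \<ominus>\<^bsub>M\<^esub> y) = h x \<ominus>\<^bsub>N\<^esub> h y"
proof -
  interpret M: left_module R M by fact
  show ?thesis
    unfolding a_minus_def using assms(4,5)
    by (simp add: mod_hom_add[OF assms(3)] mod_hom_minus[OF assms(1-3)])
qed

lemma (in left_module) smult_abelian_group_hom:
  "r \<in> carrier R \<Longrightarrow> abelian_group_hom M M (\<lambda>x. r \<odot>\<^bsub>M\<^esub> x)"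
  by (rule abelian_group_hom_additiveI)
    (auto simp: smult_closed smult_r_distr intro: M.abelian_group_axioms)

context left_module
begin

text \<open>Over a noncommutative ring the homomorphisms still form an additive group; differences
  are what the construction of chain homotopies takes from it.\<close>

lemma minus_hom:
  assumes "left_module R L" "h \<in> mod_hom R L M" "h' \<in> mod_hom R L M"
  shows "(\<lambda>x. h x \<ominus>\<^bsub>M\<^esub> h' x) \<in> mod_hom R L M"
proof -
  interpret L: left_module R L by fact
  note c = mod_hom_closed[OF assms(2)] mod_hom_closed[OF assms(3)]
  show ?thesis
  proof (rule mod_homI)
    fix x y assume "x \<in> carrier L" "y \<in> carrier L"
    then show "h (x \<oplus>\<^bsub>L\<^esub> y) \<ominus>\<^bsub>M\<^esub> h' (x \<oplus>\<^bsub>L\<^esub> y) = h x \<ominus>\<^bsub>M\<^esub> h' x \<oplus>\<^bsub>M\<^esub> (h y \<ominus>\<^bsub>M\<^esub> h' y)"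
      using c by (simp add: mod_hom_add[OF assms(2)] mod_hom_add[OF assms(3)] M.minus_eq M.minus_add M.a_ac)
  next
    fix r x assume r: "r \<in> carrier R" "x \<in> carrier L"
    then have "r \<odot>\<^bsub>M\<^esub> (\<ominus>\<^bsub>M\<^esub> h' x) \<oplus>\<^bsub>M\<^esub> r \<odot>\<^bsub>M\<^esub> h' x = \<zero>\<^bsub>M\<^esub>"
      using c by (simp add: smult_r_distr[symmetric] M.l_neg smult_r_null'[OF left_module_axioms])
    then have "r \<odot>\<^bsub>M\<^esub> (\<ominus>\<^bsub>M\<^esub> h' x) = \<ominus>\<^bsub>M\<^esub> (r \<odot>\<^bsub>M\<^esub> h' x)"
      using r c by (intro M.minus_equality[symmetric]) (auto simp: smult_closed)
    then show "h (r \<odot>\<^bsub>L\<^esub> x) \<ominus>\<^bsub>M\<^esub> h' (r \<odot>\<^bsub>L\<^esub> x) = r \<odot>\<^bsub>M\<^esub> (h x \<ominus>\<^bsub>M\<^esub> h' x)"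
      using r c by (simp add: mod_hom_smult[OF assms(2)] mod_hom_smult[OF assms(3)] M.minus_eq smult_r_distr)
  qed (use c in auto)
qed

lemma minus_one_smult:
  assumes "x \<in> carrier M" shows "(\<ominus>\<^bsub>R\<^esub> \<one>\<^bsub>R\<^esub>) \<odot>\<^bsub>M\<^esub> x = \<ominus>\<^bsub>M\<^esub> x"
proof (rule M.minus_equality[symmetric])
  have "(\<ominus>\<^bsub>R\<^esub> \<one>\<^bsub>R\<^esub>) \<odot>\<^bsub>M\<^esub> x \<oplus>\<^bsub>M\<^esub> \<one>\<^bsub>R\<^esub> \<odot>\<^bsub>M\<^esub> x = (\<ominus>\<^bsub>R\<^esub> \<one>\<^bsub>R\<^esub> \<oplus>\<^bsub>R\<^esub> \<one>\<^bsub>R\<^esub>) \<odot>\<^bsub>M\<^esub> x"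
    using assms by (intro smult_l_distr[symmetric]) auto
  then show "(\<ominus>\<^bsub>R\<^esub> \<one>\<^bsub>R\<^esub>) \<odot>\<^bsub>M\<^esub> x \<oplus>\<^bsub>M\<^esub> x = \<zero>\<^bsub>M\<^esub>"
    using assms by (simp add: R.l_neg smult_one smult_l_null'[OF left_module_axioms])
qed (use assms in \<open>auto intro: smult_closed\<close>)

text \<open>Closure under negation follows from closure under the scalar \<open>-1\<close>.\<close>

lemma left_submoduleI:
  assumes "S \<subseteq> carrier M" "\<zero>\<^bsub>M\<^esub> \<in> S" "\<And>x y. x \<in> S \<Longrightarrow> y \<in> S \<Longrightarrow> x \<oplus>\<^bsub>M\<^esub> y \<in> S"
    "\<And>r x. r \<in> carrier R \<Longrightarrow> x \<in> S \<Longrightarrow> r \<odot>\<^bsub>M\<^esub> x \<in> S"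
  shows "submodule S R M"
proof (intro submodule.intro subgroup.intro submodule_axioms.intro)
  show "inv\<^bsub>add_monoid M\<^esub> x \<in> S" if "x \<in> S" for x
    using that assms minus_one_smult[of x] assms(4)[of "\<ominus>\<^bsub>R\<^esub> \<one>\<^bsub>R\<^esub>" x] by (auto simp: a_inv_def subset_iff)
qed (use assms in auto)

lemma left_submoduleD:
  assumes "submodule S R M"
  shows "S \<subseteq> carrier M" "\<zero>\<^bsub>M\<^esub> \<in> S" "x \<in> S \<Longrightarrow> y \<in> S \<Longrightarrow> x \<oplus>\<^bsub>M\<^esub> y \<in> S"
    "r \<in> carrier R \<Longrightarrow> x \<in> S \<Longrightarrow> r \<odot>\<^bsub>M\<^esub> x \<in> S" "x \<in> S \<Longrightarrow> \<ominus>\<^bsub>M\<^esub> x \<in> S"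
proof -
  interpret S: submodule S R M by fact
  show "S \<subseteq> carrier M" "\<zero>\<^bsub>M\<^esub> \<in> S" "x \<in> S \<Longrightarrow> y \<in> S \<Longrightarrow> x \<oplus>\<^bsub>M\<^esub> y \<in> S"
    "r \<in> carrier R \<Longrightarrow> x \<in> S \<Longrightarrow> r \<odot>\<^bsub>M\<^esub> x \<in> S" "x \<in> S \<Longrightarrow> \<ominus>\<^bsub>M\<^esub> x \<in> S"
    using S.subset S.one_closed S.m_closed S.smult_closed S.m_inv_closed by (auto simp: a_inv_def)
qed

lemma submodule_of_left_module:
  assumes "submodule S R M" shows "left_module R (submodule_of M S)"
proof -
  note S = left_submoduleD[OF assms]
  have "abelian_group (submodule_of M S)"
  proof (rule abelian_groupI)
    show "\<exists>y\<in>carrier (submodule_of M S). y \<oplus>\<^bsub>submodule_of M S\<^esub> x = \<zero>\<^bsub>submodule_of M S\<^esub>"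
      if "x \<in> carrier (submodule_of M S)" for x
      by (rule bexI[where x = "\<ominus>\<^bsub>M\<^esub> x"]) (use S that in \<open>auto simp: submodule_of_def M.l_neg\<close>)
  qed (use S in \<open>auto simp: submodule_of_def subset_iff M.a_assoc intro: M.a_comm\<close>)
  then show ?thesis
    by (intro left_module.intro left_module_axioms.intro R.ring_axioms)
      (use S in \<open>auto simp: submodule_of_def subset_iff smult_l_distr smult_r_distr smult_assoc1 smult_one\<close>)
qed

lemma map_module_left_module: "left_module R (map_module X (X \<rightarrow> carrier M) M)"
proof -
  have "abelian_group (map_module X (X \<rightarrow> carrier M) M)"
  proof (rule abelian_groupI)
    fix f assume f: "f \<in> carrier (map_module X (X \<rightarrow> carrier M) M)"
    show "\<exists>g\<in>carrier (map_module X (X \<rightarrow> carrier M) M).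
        g \<oplus>\<^bsub>map_module X (X \<rightarrow> carrier M) M\<^esub> f = \<zero>\<^bsub>map_module X (X \<rightarrow> carrier M) M\<^esub>"
      by (rule bexI[where x = "\<lambda>x\<in>X. \<ominus>\<^bsub>M\<^esub> f x"])
        (use f in \<open>auto simp: map_module_def Pi_iff M.l_neg\<close>)
  qed (auto simp: map_module_def Pi_iff M.a_ac extensional_def)
  then show ?thesis
    by (intro left_module.intro left_module_axioms.intro R.ring_axioms)
      (auto simp: map_module_def Pi_iff smult_closed smult_l_distr smult_r_distr smult_assoc1 smult_one
        extensional_def)
qed

text \<open>Modules of functions subject to a condition sit inside one full function module, so the
  module axioms are verified only there.\<close>

lemma map_module_eq_submodule_of:
  "map_module X F M = submodule_of (map_module X (X \<rightarrow> carrier M) M) (F \<inter> extensional X)"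
  by (simp add: map_module_def submodule_of_def)

lemma map_module_submodule:
  assumes F: "\<And>f x. f \<in> F \<Longrightarrow> x \<in> X \<Longrightarrow> f x \<in> carrier M" "(\<lambda>x\<in>X. \<zero>\<^bsub>M\<^esub>) \<in> F"
    "\<And>f g. f \<in> F \<Longrightarrow> g \<in> F \<Longrightarrow> (\<lambda>x\<in>X. f x \<oplus>\<^bsub>M\<^esub> g x) \<in> F"
    "\<And>r f. r \<in> carrier R \<Longrightarrow> f \<in> F \<Longrightarrow> (\<lambda>x\<in>X. r \<odot>\<^bsub>M\<^esub> f x) \<in> F"
  shows "left_module R (map_module X F M)"
proof -
  interpret L: left_module R "map_module X (X \<rightarrow> carrier M) M" by (rule map_module_left_module)
  show ?thesis
  proof (subst map_module_eq_submodule_of, rule L.submodule_of_left_module, rule L.left_submoduleI)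
    show "F \<inter> extensional X \<subseteq> carrier (map_module X (X \<rightarrow> carrier M) M)"
      using F(1) by (auto simp: map_module_def)
    show "\<zero>\<^bsub>map_module X (X \<rightarrow> carrier M) M\<^esub> \<in> F \<inter> extensional X"
      using F(2) by (simp add: map_module_def)
    show "f \<oplus>\<^bsub>map_module X (X \<rightarrow> carrier M) M\<^esub> g \<in> F \<inter> extensional X"
      if "f \<in> F \<inter> extensional X" "g \<in> F \<inter> extensional X" for f g
      using F(3)[of f g] that by (simp add: map_module_def)
    show "r \<odot>\<^bsub>map_module X (X \<rightarrow> carrier M) M\<^esub> f \<in> F \<inter> extensional X"
      if "r \<in> carrier R" "f \<in> F \<inter> extensional X" for r f
      using F(4)[of r f] that by (simp add: map_module_def)
  qed
qed

end

lemma kernel_submodule: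
  assumes "left_module R M" "left_module R N" "h \<in> mod_hom R M N"
  shows "submodule {x \<in> carrier M. h x = \<zero>\<^bsub>N\<^esub>} R M"
proof -
  interpret M: left_module R M by fact
  interpret N: left_module R N by fact
  show ?thesis
    by (rule M.left_submoduleI)
      (auto simp: mod_hom_zero[OF assms] mod_hom_add[OF assms(3)] mod_hom_smult[OF assms(3)] M.smult_closed
        smult_r_null'[OF assms(2)])
qed

lemma image_submodule:
  assumes "left_module R M" "left_module R N" "h \<in> mod_hom R M N"
  shows "submodule (h ` carrier M) R N"
proof -
  interpret M: left_module R M by fact
  interpret N: left_module R N by fact
  show ?thesis
  proof (rule N.left_submoduleI)
    show "\<zero>\<^bsub>N\<^esub> \<in> h ` carrier M"
      using mod_hom_zero[OF assms] M.M.zero_closed by (metis imageI)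
  next
    fix x y assume "x \<in> h ` carrier M" "y \<in> h ` carrier M"
    then show "x \<oplus>\<^bsub>N\<^esub> y \<in> h ` carrier M"
      using mod_hom_add[OF assms(3)] M.M.a_closed by (smt (verit) image_iff)
  next
    fix r x assume "r \<in> carrier R" "x \<in> h ` carrier M"
    then show "r \<odot>\<^bsub>N\<^esub> x \<in> h ` carrier M"
      using mod_hom_smult[OF assms(3)] M.smult_closed by (smt (verit) image_iff)
  qed (use mod_hom_closed[OF assms(3)] in auto)
qed

lemma submodule_in_submodule_of:
  assumes "left_module R M" "submodule S R M" "submodule T R M" "T \<subseteq> S"
  shows "submodule T R (submodule_of M S)"
proof -
  interpret M: left_module R M by fact
  interpret S: left_module R "submodule_of M S" by (rule M.submodule_of_left_module) fact
  note T = M.left_submoduleD[OF assms(3)]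
  show ?thesis
    by (rule S.left_submoduleI) (use T assms(4) in \<open>auto simp: submodule_of_def\<close>)
qed

section \<open>Quotient modules and the first isomorphism theorem\<close>

context left_module
begin

context
  fixes S assumes S: "submodule S R M"
begin

interpretation S: abelian_subgroup S M
proof (rule abelian_subgroupI3)
  show "additive_subgroup S M"
    using S by (simp add: additive_subgroup_def submodule_def)
qed (rule M.abelian_group_axioms)

lemma quot_coset_eq_iff:
  assumes "x \<in> carrier M" "y \<in> carrier M"
  shows "S +>\<^bsub>M\<^esub> x = S +>\<^bsub>M\<^esub> y \<longleftrightarrow> x \<ominus>\<^bsub>M\<^esub> y \<in> S"
proof
  assume "S +>\<^bsub>M\<^esub> x = S +>\<^bsub>M\<^esub> y"
  then have "x \<in> S +>\<^bsub>M\<^esub> y" using S.a_rcos_self[OF assms(1)] by simp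
  then obtain s where "s \<in> S" "x = s \<oplus>\<^bsub>M\<^esub> y" by (auto simp: a_r_coset_def')
  then show "x \<ominus>\<^bsub>M\<^esub> y \<in> S"
    using assms S.a_subset by (auto simp: M.minus_eq M.a_assoc M.r_neg)
next
  assume "x \<ominus>\<^bsub>M\<^esub> y \<in> S"
  moreover have "x = (x \<ominus>\<^bsub>M\<^esub> y) \<oplus>\<^bsub>M\<^esub> y"
    using assms by (simp add: M.minus_eq M.a_assoc M.l_neg)
  ultimately have "x \<in> S +>\<^bsub>M\<^esub> y" by (auto simp: a_r_coset_def')
  then show "S +>\<^bsub>M\<^esub> x = S +>\<^bsub>M\<^esub> y"
    using S.a_repr_independence'[OF _ assms(2)] by simp
qed

text \<open>The product is defined as a union over all representatives of the coset; they give the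
  same coset because \<open>S\<close> is closed under \<open>r\<close>.\<close>

lemma quot_smult_coset:
  assumes "r \<in> carrier R" "x \<in> carrier M"
  shows "r \<odot>\<^bsub>quot_module M S\<^esub> (S +>\<^bsub>M\<^esub> x) = S +>\<^bsub>M\<^esub> (r \<odot>\<^bsub>M\<^esub> x)"
proof -
  have eq: "S +>\<^bsub>M\<^esub> (r \<odot>\<^bsub>M\<^esub> y) = S +>\<^bsub>M\<^esub> (r \<odot>\<^bsub>M\<^esub> x)" if y: "y \<in> S +>\<^bsub>M\<^esub> x" for y
  proof -
    obtain z where z: "z \<in> S" "y = z \<oplus>\<^bsub>M\<^esub> x" using y by (auto simp: a_r_coset_def')
    have "r \<odot>\<^bsub>M\<^esub> z \<in> S" "z \<in> carrier M" "r \<odot>\<^bsub>M\<^esub> z \<in> carrier M"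
      using left_submoduleD[OF S] z assms by auto
    moreover from this have "r \<odot>\<^bsub>M\<^esub> y \<ominus>\<^bsub>M\<^esub> r \<odot>\<^bsub>M\<^esub> x = r \<odot>\<^bsub>M\<^esub> z"
      using z assms by (simp add: smult_r_distr smult_closed M.minus_eq M.a_assoc M.r_neg)
    ultimately show ?thesis using assms z by (subst quot_coset_eq_iff) (auto simp: smult_closed)
  qed
  have "x \<in> S +>\<^bsub>M\<^esub> x" using assms by (rule_tac S.a_rcos_self)
  moreover have "(\<Union>y\<in>S +>\<^bsub>M\<^esub> x. S +>\<^bsub>M\<^esub> (r \<odot>\<^bsub>M\<^esub> y)) = (\<Union>y\<in>S +>\<^bsub>M\<^esub> x. S +>\<^bsub>M\<^esub> (r \<odot>\<^bsub>M\<^esub> x))"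
    by (intro SUP_cong HOL.refl eq)
  ultimately show ?thesis unfolding quot_module_def by auto
qed

lemma quot_coset_hom: "(\<lambda>x. S +>\<^bsub>M\<^esub> x) \<in> mod_hom R M (quot_module M S)"
proof (rule mod_homI)
  show "S +>\<^bsub>M\<^esub> x \<in> carrier (quot_module M S)" if "x \<in> carrier M" for x
    using that S.a_subset by (simp add: quot_module_def M.a_rcosetsI)
  show "S +>\<^bsub>M\<^esub> (x \<oplus>\<^bsub>M\<^esub> y) = (S +>\<^bsub>M\<^esub> x) \<oplus>\<^bsub>quot_module M S\<^esub> (S +>\<^bsub>M\<^esub> y)"
    if "x \<in> carrier M" "y \<in> carrier M" for x y
    using S.a_rcos_sum[OF that] by (simp add: quot_module_def)
  show "S +>\<^bsub>M\<^esub> (r \<odot>\<^bsub>M\<^esub> x) = r \<odot>\<^bsub>quot_module M S\<^esub> (S +>\<^bsub>M\<^esub> x)"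
    if "r \<in> carrier R" "x \<in> carrier M" for r x
    using quot_smult_coset[OF that] by simp
qed

lemma quot_carrier: "carrier (quot_module M S) = (\<lambda>x. S +>\<^bsub>M\<^esub> x) ` carrier M"
  by (auto simp: quot_module_def A_RCOSETS_def')

text \<open>The target is an arbitrary record, so it may itself be a quotient whose module axioms
  have not been established. The kernel enters through equality of values, which avoids subtraction
  in \<open>N\<close>.\<close>

lemma first_isomorphism:
  assumes h: "h \<in> mod_hom R M N" and surj: "carrier N \<subseteq> h ` carrier M"
    and ker: "\<And>x y. x \<in> carrier M \<Longrightarrow> y \<in> carrier M \<Longrightarrow> h x = h y \<longleftrightarrow> x \<ominus>\<^bsub>M\<^esub> y \<in> S"
  shows "mod_isomorphic R (quot_module M S) N"
proof -
  \<comment> \<open>The value is taken at an arbitrary representative; \<open>ker\<close> makes the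
    choice irrelevant.\<close>
  define f where "f = (\<lambda>X. h (SOME x. x \<in> carrier M \<and> X = S +>\<^bsub>M\<^esub> x))"
  have f: "f (S +>\<^bsub>M\<^esub> x) = h x" if "x \<in> carrier M" for x
  proof -
    define y where "y = (SOME y. y \<in> carrier M \<and> S +>\<^bsub>M\<^esub> x = S +>\<^bsub>M\<^esub> y)"
    have "y \<in> carrier M \<and> S +>\<^bsub>M\<^esub> x = S +>\<^bsub>M\<^esub> y"
      unfolding y_def by (rule someI[where x = x]) (use that in simp)
    then show ?thesis
      unfolding f_def y_def[symmetric] using that by (metis ker quot_coset_eq_iff)
  qed
  note q = quot_coset_hom
  have "f \<in> mod_hom R (quot_module M S) N"
  proof (rule mod_homI)
    fix X Y assume "X \<in> carrier (quot_module M S)" "Y \<in> carrier (quot_module M S)"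
    then obtain x y where "x \<in> carrier M" "y \<in> carrier M" "X = S +>\<^bsub>M\<^esub> x" "Y = S +>\<^bsub>M\<^esub> y"
      unfolding quot_carrier by blast
    then show "f (X \<oplus>\<^bsub>quot_module M S\<^esub> Y) = f X \<oplus>\<^bsub>N\<^esub> f Y"
      by (simp add: f mod_hom_add[OF h] mod_hom_add[OF q, symmetric])
  qed (auto simp: quot_carrier f quot_smult_coset smult_closed mod_hom_smult[OF h] mod_hom_closed[OF h])
  moreover have "inj_on f (carrier (quot_module M S))"
    unfolding quot_carrier by (auto simp: inj_on_def f ker quot_coset_eq_iff)
  moreover have "f ` carrier (quot_module M S) = carrier N"
    unfolding quot_carrier using surj mod_hom_closed[OF h] by (force simp: f image_iff)
  ultimately show ?thesis unfolding mod_isomorphic_def bij_betw_def by blast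
qed

end

end

section \<open>Projective modules given by idempotents\<close>

text \<open>For idempotents \<open>e x\<close>, this is the direct sum of the left ideals \<open>R e x\<close>.\<close>

definition proj_module ::
    "('r, 'y) ring_scheme \<Rightarrow> 'x set \<Rightarrow> ('x \<Rightarrow> 'r) \<Rightarrow> ('r, 'x \<Rightarrow> 'r) module"
  where "proj_module R X e = submodule_of (free_module R X)
    {f \<in> carrier (free_module R X). \<forall>x\<in>X. f x \<otimes>\<^bsub>R\<^esub> e x = f x}"

definition proj_gen :: "('r, 'y) ring_scheme \<Rightarrow> ('x \<Rightarrow> 'r) \<Rightarrow> 'x \<Rightarrow> 'x \<Rightarrow> 'r"
  where "proj_gen R e x = (\<lambda>y. if y = x then e x else \<zero>\<^bsub>R\<^esub>)"

lemma proj_module_simps: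
  "carrier (proj_module R X e) = {f \<in> carrier (free_module R X). \<forall>x\<in>X. f x \<otimes>\<^bsub>R\<^esub> e x = f x}"
  "zero (proj_module R X e) = (\<lambda>x. \<zero>\<^bsub>R\<^esub>)" "add (proj_module R X e) = (\<lambda>f g x. f x \<oplus>\<^bsub>R\<^esub> g x)"
  "smult (proj_module R X e) = (\<lambda>r f x. r \<otimes>\<^bsub>R\<^esub> f x)"
  by (simp_all add: proj_module_def submodule_of_def free_module_simps)

text \<open>With all idempotents equal to one the free modules are recovered, so the free resolution
  that computes Ext and the resolution by left ideals are instances of one notion.\<close>

lemma proj_module_one:
  assumes "ring R" shows "proj_module R X (\<lambda>x. \<one>\<^bsub>R\<^esub>) = free_module R X"
proof -
  interpret ring R by fact
  have "{f \<in> carrier (free_module R X). \<forall>x\<in>X. f x \<otimes>\<^bsub>R\<^esub> \<one>\<^bsub>R\<^esub> = f x} = carrier (free_module R X)"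
    by (auto simp: free_moduleD)
  then show ?thesis by (simp add: proj_module_def submodule_of_def free_module_def)
qed

lemma free_lift_cong:
  assumes "left_module R M" "f \<in> carrier (free_module R X)" "\<phi> \<in> X \<rightarrow> carrier M"
    "\<And>x. x \<in> X \<Longrightarrow> \<phi> x = \<psi> x"
  shows "free_lift R M \<phi> f = free_lift R M \<psi> f"
proof -
  interpret left_module R M by fact
  show ?thesis
    unfolding free_lift_def
  proof (rule M.finsum_cong')
    show "f x \<odot>\<^bsub>M\<^esub> \<phi> x = f x \<odot>\<^bsub>M\<^esub> \<psi> x" if "x \<in> fsupp R f" for x
      using assms(4)[of x] free_moduleD(3)[OF assms(2)] that by auto
    have "\<psi> \<in> X \<rightarrow> carrier M" using assms(3) by (auto simp: assms(4)[symmetric])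
    then show "(\<lambda>x. f x \<odot>\<^bsub>M\<^esub> \<psi> x) \<in> fsupp R f \<rightarrow> carrier M"
      using smult_closed[OF free_moduleD(1)[OF assms(2)]] free_moduleD(3)[OF assms(2)] by auto
  qed simp
qed

locale idempotent_family = ring R for R (structure) +
  fixes X :: "'x set" and e :: "'x \<Rightarrow> 'a"
  assumes e_closed: "\<And>x. x \<in> X \<Longrightarrow> e x \<in> carrier R"
    and e_idem: "\<And>x. x \<in> X \<Longrightarrow> e x \<otimes> e x = e x"
begin

abbreviation "F \<equiv> free_module R X"
abbreviation "P \<equiv> proj_module R X e"

lemma free_left_module: "left_module R F"
  by (rule free_module_left_module) (rule ring_axioms)

lemma proj_carrier_submodule: "submodule {f \<in> carrier F. \<forall>x\<in>X. f x \<otimes> e x = f x} R F"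
proof -
  interpret F: left_module R F by (rule free_left_module)
  show ?thesis
  proof (rule F.left_submoduleI)
    show "\<zero>\<^bsub>F\<^esub> \<in> {f \<in> carrier F. \<forall>x\<in>X. f x \<otimes> e x = f x}"
      using F.M.zero_closed by (auto simp: free_module_simps e_closed)
    show "f \<oplus>\<^bsub>F\<^esub> g \<in> {f \<in> carrier F. \<forall>x\<in>X. f x \<otimes> e x = f x}"
      if "f \<in> {f \<in> carrier F. \<forall>x\<in>X. f x \<otimes> e x = f x}" "g \<in> {f \<in> carrier F. \<forall>x\<in>X. f x \<otimes> e x = f x}" for f g
      using F.M.a_closed[of f g] that by (auto simp: free_module_simps e_closed l_distr free_moduleD(1))
    show "r \<odot>\<^bsub>F\<^esub> f \<in> {f \<in> carrier F. \<forall>x\<in>X. f x \<otimes> e x = f x}"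
      if "r \<in> carrier R" "f \<in> {f \<in> carrier F. \<forall>x\<in>X. f x \<otimes> e x = f x}" for r f
      using F.smult_closed[of r f] that by (auto simp: free_module_simps e_closed m_assoc free_moduleD(1))
  qed auto
qed

lemma proj_left_module: "left_module R P"
  unfolding proj_module_def
  by (rule left_module.submodule_of_left_module[OF free_left_module proj_carrier_submodule])

lemma proj_inclusion_hom: "(\<lambda>f. f) \<in> mod_hom R P F"
  by (rule mod_homI) (auto simp: proj_module_simps free_module_simps)

lemma proj_gen_eq: "x \<in> X \<Longrightarrow> proj_gen R e x = e x \<odot>\<^bsub>F\<^esub> free_basis R x"
  by (auto simp: proj_gen_def free_module_simps free_basis_def e_closed)

lemma proj_gen_closed:
  assumes "x \<in> X" shows "proj_gen R e x \<in> carrier P"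
proof -
  interpret F: left_module R F by (rule free_left_module)
  have "proj_gen R e x \<in> carrier F"
    unfolding proj_gen_eq[OF assms]
    using F.smult_closed[OF e_closed free_basis_closed[OF ring_axioms]] assms by auto
  then show ?thesis using assms by (auto simp: proj_module_simps proj_gen_def e_idem e_closed)
qed

lemma proj_gen_idem: "x \<in> X \<Longrightarrow> e x \<odot>\<^bsub>P\<^esub> proj_gen R e x = proj_gen R e x"
  by (auto simp: proj_module_simps proj_gen_def e_idem e_closed)

lemma proj_lift_hom:
  assumes "left_module R N" "\<phi> \<in> X \<rightarrow> carrier N"
  shows "free_lift R N \<phi> \<in> mod_hom R P N"
  using mod_hom_compose[OF proj_inclusion_hom free_lift_hom[OF assms]] .

text \<open>The existence half of \<open>Hom(R e, N) = e N\<close>; the uniqueness half is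
  \<open>proj_hom_eq_lift\<close>. A family extends with prescribed values on the generators when
  each \<open>e x\<close> fixes the value at \<open>x\<close>.\<close>

lemma proj_lift_gen:
  assumes "left_module R N" "\<phi> \<in> X \<rightarrow> carrier N" "x \<in> X" "e x \<odot>\<^bsub>N\<^esub> \<phi> x = \<phi> x"
  shows "free_lift R N \<phi> (proj_gen R e x) = \<phi> x"
proof -
  have "free_lift R N \<phi> (proj_gen R e x) = e x \<odot>\<^bsub>N\<^esub> free_lift R N \<phi> (free_basis R x)"
    unfolding proj_gen_eq[OF assms(3)]
    by (rule mod_hom_smult[OF free_lift_hom[OF assms(1,2)]])
      (use e_closed assms(3) free_basis_closed[OF ring_axioms] in auto)
  also have "free_lift R N \<phi> (free_basis R x) = \<phi> x"
    using assms by (intro free_lift_basis) auto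
  finally show ?thesis using assms(4) by simp
qed

text \<open>On all of \<open>F\<close> the lift is the projection that multiplies the coordinate at
  \<open>x\<close> by \<open>e x\<close>, as can be checked on the basis; this projection is the
  identity on \<open>P\<close>.\<close>

lemma proj_expand:
  assumes "f \<in> carrier P" shows "free_lift R P (proj_gen R e) f = f"
proof -
  have *: "(\<lambda>f. \<lambda>x. if x \<in> X then f x \<otimes> e x else \<zero>) \<in> mod_hom R F P"
  proof (rule mod_homI)
    fix f assume f: "f \<in> carrier F"
    note c = free_moduleD[OF f]
    have "(\<lambda>x. if x \<in> X then f x \<otimes> e x else \<zero>) \<in> carrier F"
      by (rule free_module_carrierI[where Y = "fsupp R f"]) (use c e_closed in \<open>auto simp: fsupp_def\<close>)
    then show "(\<lambda>x. if x \<in> X then f x \<otimes> e x else \<zero>) \<in> carrier P"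
      using c by (auto simp: proj_module_simps e_closed e_idem m_assoc)
  qed (auto simp: proj_module_simps free_module_simps e_closed free_moduleD(1) l_distr m_assoc fun_eq_iff)
  have "free_lift R P (proj_gen R e) f = (\<lambda>x. if x \<in> X then f x \<otimes> e x else \<zero>)"
  proof (rule hom_eq_on_basis[OF ring_axioms proj_left_module _ *])
    show "free_lift R P (proj_gen R e) \<in> mod_hom R F P"
      by (rule free_lift_hom) (auto intro: proj_left_module proj_gen_closed)
    show "f \<in> carrier F" using assms by (simp add: proj_module_simps)
    fix x assume "x \<in> X"
    then show "free_lift R P (proj_gen R e) (free_basis R x) =
        (\<lambda>y. if y \<in> X then free_basis R x y \<otimes> e y else \<zero>)"
      by (subst free_lift_basis[where \<phi> = "proj_gen R e", OF proj_left_module proj_gen_closed])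
        (auto simp: proj_gen_def free_basis_def e_closed)
  qed
  also have "\<dots> = f"
  proof
    fix x
    have "f x = \<zero>" if "x \<notin> X"
      using assms free_moduleD(3)[of f R X] that by (auto simp: proj_module_simps fsupp_def)
    then show "(if x \<in> X then f x \<otimes> e x else \<zero>) = f x"
      using assms by (auto simp: proj_module_simps)
  qed
  finally show ?thesis .
qed

lemma proj_hom_eq_lift:
  assumes "left_module R N" "h \<in> mod_hom R P N" "f \<in> carrier P"
    and "\<And>x. x \<in> X \<Longrightarrow> h (proj_gen R e x) = \<phi> x"
  shows "h f = free_lift R N \<phi> f"
proof -
  have f: "f \<in> carrier F" using assms(3) by (simp add: proj_module_simps)
  have "h f = h (free_lift R P (proj_gen R e) f)" using proj_expand[OF assms(3)] by simp
  also have "\<dots> = free_lift R N (h \<circ> proj_gen R e) f"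
    by (rule hom_free_lift[OF proj_left_module assms(1,2) _ f]) (auto intro: proj_gen_closed)
  also have "\<dots> = free_lift R N \<phi> f"
    by (rule free_lift_cong[OF assms(1) f])
      (use assms(4) mod_hom_closed[OF assms(2) proj_gen_closed] in auto)
  finally show ?thesis .
qed

lemma proj_hom_eqI:
  assumes "left_module R N" "h \<in> mod_hom R P N" "h' \<in> mod_hom R P N" "f \<in> carrier P"
    "\<And>x. x \<in> X \<Longrightarrow> h (proj_gen R e x) = h' (proj_gen R e x)"
  shows "h f = h' f"
  using proj_hom_eq_lift[OF assms(1,2,4), of "\<lambda>x. h' (proj_gen R e x)"]
    proj_hom_eq_lift[OF assms(1,3,4), of "\<lambda>x. h' (proj_gen R e x)"] assms(5) by simp

text \<open>Projectivity, with surjectivity of \<open>g\<close> weakened to the image of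
  \<open>k\<close> lying in the image of \<open>g\<close>, the form that exactness of a resolution
  supplies.\<close>

lemma proj_lifting:
  assumes N: "left_module R N" and Q: "left_module R Q" and k: "k \<in> mod_hom R P N"
    and g: "g \<in> mod_hom R Q N" and im: "\<And>f. f \<in> carrier P \<Longrightarrow> k f \<in> g ` carrier Q"
  obtains l where "l \<in> mod_hom R P Q" "\<And>f. f \<in> carrier P \<Longrightarrow> g (l f) = k f"
proof -
  interpret Q: left_module R Q by (rule Q)
  define q where "q = (\<lambda>x. SOME q. q \<in> carrier Q \<and> g q = k (proj_gen R e x))"
  have "\<exists>q. q \<in> carrier Q \<and> g q = k (proj_gen R e x)" if "x \<in> X" for x
    using im[OF proj_gen_closed[OF that]] by force
  then have "q x \<in> carrier Q \<and> g (q x) = k (proj_gen R e x)" if "x \<in> X" for x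
    unfolding q_def by (rule someI_ex) (rule that)
  then have q: "q x \<in> carrier Q" "g (q x) = k (proj_gen R e x)" if "x \<in> X" for x using that by auto
  \<comment> \<open>A chosen preimage need not be fixed by \<open>e x\<close>; multiplying it by
    \<open>e x\<close> repairs this and does not change its image, because \<open>e x\<close> fixes
    the generator.\<close>
  define \<phi> where "\<phi> = (\<lambda>x. e x \<odot>\<^bsub>Q\<^esub> q x)"
  have \<phi>: "\<phi> \<in> X \<rightarrow> carrier Q" "\<And>x. x \<in> X \<Longrightarrow> e x \<odot>\<^bsub>Q\<^esub> \<phi> x = \<phi> x"
    unfolding \<phi>_def using e_closed q e_idem by (auto simp: Q.smult_closed Q.smult_assoc1[symmetric])
  let ?l = "free_lift R Q \<phi>"
  have l: "?l \<in> mod_hom R P Q" by (rule proj_lift_hom[OF Q \<phi>(1)])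
  have "g (?l f) = k f" if "f \<in> carrier P" for f
  proof (rule proj_hom_eqI[OF N mod_hom_compose[OF l g] k that])
    fix x assume x: "x \<in> X"
    have "g (?l (proj_gen R e x)) = e x \<odot>\<^bsub>N\<^esub> k (proj_gen R e x)"
      using proj_lift_gen[OF Q \<phi>(1) x \<phi>(2)[OF x]] mod_hom_smult[OF g e_closed[OF x] q(1)[OF x]] q(2)[OF x]
      by (simp add: \<phi>_def)
    also have "\<dots> = k (proj_gen R e x)"
      using mod_hom_smult[OF k e_closed[OF x] proj_gen_closed[OF x]] proj_gen_idem[OF x] by simp
    finally show "g (?l (proj_gen R e x)) = k (proj_gen R e x)" .
  qed
  with l show ?thesis by (rule that)
qed

end

section \<open>Comparison of resolutions\<close>

locale proj_resolution =
  fixes R :: "('r, 'y) ring_scheme" (structure)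
    and X :: "nat \<Rightarrow> 'x set" and e :: "nat \<Rightarrow> 'x \<Rightarrow> 'r"
    and d :: "nat \<Rightarrow> ('x \<Rightarrow> 'r) \<Rightarrow> 'x \<Rightarrow> 'r"
    and A :: "('r, 'a, 'z) module_scheme" and aug :: "('x \<Rightarrow> 'r) \<Rightarrow> 'a"
  assumes A: "left_module R A"
    and idem: "\<And>n. idempotent_family R (X n) (e n)"
    and d_hom: "\<And>n. d n \<in> mod_hom R (proj_module R (X (Suc n)) (e (Suc n))) (proj_module R (X n) (e n))"
    and aug_hom: "aug \<in> mod_hom R (proj_module R (X 0) (e 0)) A"
    and aug_surj: "aug ` carrier (proj_module R (X 0) (e 0)) = carrier A"
    and exact_0: "d 0 ` carrier (proj_module R (X 1) (e 1)) =
      {f \<in> carrier (proj_module R (X 0) (e 0)). aug f = \<zero>\<^bsub>A\<^esub>}"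
    and exact_Suc: "\<And>n. d (Suc n) ` carrier (proj_module R (X (Suc (Suc n))) (e (Suc (Suc n)))) =
      {f \<in> carrier (proj_module R (X (Suc n)) (e (Suc n))). d n f = \<zero>\<^bsub>proj_module R (X n) (e n)\<^esub>}"
begin

abbreviation "P n \<equiv> proj_module R (X n) (e n)"

lemma P_left_module: "left_module R (P n)"
  by (rule idempotent_family.proj_left_module[OF idem])

lemma aug_d: "f \<in> carrier (P (Suc 0)) \<Longrightarrow> aug (d 0 f) = \<zero>\<^bsub>A\<^esub>"
  using exact_0 by auto

lemma d_d: "f \<in> carrier (P (Suc (Suc n))) \<Longrightarrow> d n (d (Suc n) f) = \<zero>\<^bsub>P n\<^esub>"
  using exact_Suc by blast

lemma d_closed: "f \<in> carrier (P (Suc n)) \<Longrightarrow> d n f \<in> carrier (P n)"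
  by (rule mod_hom_closed[OF d_hom])

end

lemma res_proj_resolution:
  assumes "left_module R A"
  shows "proj_resolution R (res_basis R A) (\<lambda>n x. \<one>\<^bsub>R\<^esub>) (res_diff R A) A (res_aug R A)"
proof -
  interpret left_module R A by fact
  have p: "proj_module R (res_basis R A n) (\<lambda>x. \<one>\<^bsub>R\<^esub>) = res_mod R A n" for n
    unfolding res_mod_def by (rule proj_module_one) (rule R.ring_axioms)
  show ?thesis
  proof (unfold_locales, unfold p)
    show "res_diff R A 0 ` carrier (res_mod R A 1) = {f \<in> carrier (res_mod R A 0). res_aug R A f = \<zero>\<^bsub>A\<^esub>}"
      using res_exact[OF assms, of 0] by (auto simp: a_kernel_def')
    show "res_diff R A (Suc n) ` carrier (res_mod R A (Suc (Suc n))) =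
        {f \<in> carrier (res_mod R A (Suc n)). res_diff R A n f = \<zero>\<^bsub>res_mod R A n\<^esub>}" for n
      using res_exact[OF assms, of "Suc n"] by (auto simp: a_kernel_def')
  qed (use res_aug_hom[OF assms] res_aug_surj[OF assms] res_diff_hom[OF R.ring_axioms] in auto)
qed

lemma comparison_map:
  assumes P: "proj_resolution R X e d A aug" and Q: "proj_resolution R Y e' d' A aug'"
  obtains \<alpha> where "\<And>n. \<alpha> n \<in> mod_hom R (proj_module R (X n) (e n)) (proj_module R (Y n) (e' n))"
    "\<And>f. f \<in> carrier (proj_module R (X 0) (e 0)) \<Longrightarrow> aug' (\<alpha> 0 f) = aug f"
    "\<And>n f. f \<in> carrier (proj_module R (X (Suc n)) (e (Suc n))) \<Longrightarrow> d' n (\<alpha> (Suc n) f) = \<alpha> n (d n f)"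
proof -
  interpret P: proj_resolution R X e d A aug by (rule P)
  interpret Q: proj_resolution R Y e' d' A aug' by (rule Q)
  note lift = idempotent_family.proj_lifting[OF P.idem]
  \<comment> \<open>The last clause is the lifting condition for the next degree. Compatibility with
    the augmentation is confined to \<open>n = 0\<close>, since dependent choice carries a single
    predicate through all degrees.\<close>
  define ok where "ok = (\<lambda>n \<alpha>. \<alpha> \<in> mod_hom R (P.P n) (Q.P n) \<and>
    (n = 0 \<longrightarrow> (\<forall>f\<in>carrier (P.P 0). aug' (\<alpha> f) = aug f)) \<and>
    (\<forall>f\<in>carrier (P.P (Suc n)). \<alpha> (d n f) \<in> d' n ` carrier (Q.P (Suc n))))"
  have "\<exists>\<alpha>. \<forall>n. ok n (\<alpha> n) \<and> (\<forall>f\<in>carrier (P.P (Suc n)). d' n (\<alpha> (Suc n) f) = \<alpha> n (d n f))"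
  proof (rule dependent_nat_choice)
    obtain \<alpha> where \<alpha>: "\<alpha> \<in> mod_hom R (P.P 0) (Q.P 0)" "\<And>f. f \<in> carrier (P.P 0) \<Longrightarrow> aug' (\<alpha> f) = aug f"
      using lift[OF P.A Q.P_left_module P.aug_hom Q.aug_hom] mod_hom_closed[OF P.aug_hom] Q.aug_surj
      by metis
    have "\<alpha> (d 0 f) \<in> d' 0 ` carrier (Q.P (Suc 0))" if "f \<in> carrier (P.P (Suc 0))" for f
      using Q.exact_0 \<alpha>(2)[OF P.d_closed[OF that]] P.aug_d[OF that]
        mod_hom_closed[OF \<alpha>(1) P.d_closed[OF that]] by auto
    then show "\<exists>\<alpha>. ok 0 \<alpha>" unfolding ok_def using \<alpha> by blast
  next
    fix \<alpha> n assume ok: "ok n \<alpha>"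
    then have \<alpha>: "\<alpha> \<in> mod_hom R (P.P n) (Q.P n)"
      "\<And>f. f \<in> carrier (P.P (Suc n)) \<Longrightarrow> \<alpha> (d n f) \<in> d' n ` carrier (Q.P (Suc n))" by (auto simp: ok_def)
    obtain \<beta> where \<beta>: "\<beta> \<in> mod_hom R (P.P (Suc n)) (Q.P (Suc n))"
      "\<And>f. f \<in> carrier (P.P (Suc n)) \<Longrightarrow> d' n (\<beta> f) = \<alpha> (d n f)"
      using lift[OF Q.P_left_module Q.P_left_module mod_hom_compose[OF P.d_hom \<alpha>(1)] Q.d_hom \<alpha>(2)] by metis
    have "\<beta> (d (Suc n) f) \<in> d' (Suc n) ` carrier (Q.P (Suc (Suc n)))"
      if "f \<in> carrier (P.P (Suc (Suc n)))" for f
      using Q.exact_Suc \<beta>(2)[OF P.d_closed[OF that]] P.d_d[OF that]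
        mod_hom_closed[OF \<beta>(1) P.d_closed[OF that]]
        mod_hom_zero[OF P.P_left_module Q.P_left_module \<alpha>(1)] by auto
    then show "\<exists>\<beta>. ok (Suc n) \<beta> \<and> (\<forall>f\<in>carrier (P.P (Suc n)). d' n (\<beta> f) = \<alpha> (d n f))"
      unfolding ok_def using \<beta> by blast
  qed
  then obtain \<alpha> where "\<And>n. ok n (\<alpha> n)"
    "\<And>n f. f \<in> carrier (P.P (Suc n)) \<Longrightarrow> d' n (\<alpha> (Suc n) f) = \<alpha> n (d n f)" by blast
  then show ?thesis by (intro that[of \<alpha>]) (auto simp: ok_def)
qed

lemma comparison_homotopy:
  assumes P: "proj_resolution R X e d A aug" and Q: "proj_resolution R Y e' d' A aug'"
    and u: "\<And>n. u n \<in> mod_hom R (proj_module R (X n) (e n)) (proj_module R (Y n) (e' n))"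
      "\<And>f. f \<in> carrier (proj_module R (X 0) (e 0)) \<Longrightarrow> aug' (u 0 f) = aug f"
      "\<And>n f. f \<in> carrier (proj_module R (X (Suc n)) (e (Suc n))) \<Longrightarrow> d' n (u (Suc n) f) = u n (d n f)"
    and v: "\<And>n. v n \<in> mod_hom R (proj_module R (X n) (e n)) (proj_module R (Y n) (e' n))"
      "\<And>f. f \<in> carrier (proj_module R (X 0) (e 0)) \<Longrightarrow> aug' (v 0 f) = aug f"
      "\<And>n f. f \<in> carrier (proj_module R (X (Suc n)) (e (Suc n))) \<Longrightarrow> d' n (v (Suc n) f) = v n (d n f)"
  obtains s where
    "\<And>n. s n \<in> mod_hom R (proj_module R (X n) (e n)) (proj_module R (Y (Suc n)) (e' (Suc n)))"
    "\<And>f. f \<in> carrier (proj_module R (X 0) (e 0)) \<Longrightarrow>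
      d' 0 (s 0 f) = u 0 f \<ominus>\<^bsub>proj_module R (Y 0) (e' 0)\<^esub> v 0 f"
    "\<And>n f. f \<in> carrier (proj_module R (X (Suc n)) (e (Suc n))) \<Longrightarrow>
      d' (Suc n) (s (Suc n) f) = u (Suc n) f \<ominus>\<^bsub>proj_module R (Y (Suc n)) (e' (Suc n))\<^esub> v (Suc n) f
        \<ominus>\<^bsub>proj_module R (Y (Suc n)) (e' (Suc n))\<^esub> s n (d n f)"
proof -
  interpret P: proj_resolution R X e d A aug by (rule P)
  interpret Q: proj_resolution R Y e' d' A aug' by (rule Q)
  interpret A: left_module R A by (rule P.A)
  interpret QM: left_module R "Q.P n" for n by (rule Q.P_left_module)
  note lift = idempotent_family.proj_lifting[OF P.idem Q.P_left_module Q.P_left_module _ Q.d_hom]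
  define w where "w = (\<lambda>n f. u n f \<ominus>\<^bsub>Q.P n\<^esub> v n f)"
  have w: "w n \<in> mod_hom R (P.P n) (Q.P n)" for n
    unfolding w_def by (rule QM.minus_hom[OF P.P_left_module u(1) v(1)])
  have w0: "aug' (w 0 f) = \<zero>\<^bsub>A\<^esub>" if "f \<in> carrier (P.P 0)" for f
    using that mod_hom_closed[OF u(1)] mod_hom_closed[OF v(1)] mod_hom_closed[OF P.aug_hom]
    by (simp add: w_def mod_hom_diff[OF Q.P_left_module P.A Q.aug_hom] u v A.M.minus_eq A.M.r_neg)
  have wS: "d' n (w (Suc n) f) = w n (d n f)" if "f \<in> carrier (P.P (Suc n))" for n f
    using that mod_hom_closed[OF u(1)] mod_hom_closed[OF v(1)]
    by (simp add: w_def mod_hom_diff[OF Q.P_left_module Q.P_left_module Q.d_hom] u v)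
  \<comment> \<open>In the homotopy identity evaluated at \<open>d n f\<close>, the term with the
    preceding homotopy vanishes because \<open>d d = 0\<close>. What remains is the last clause,
    which mentions \<open>s\<close> alone and suffices for the next lifting.\<close>
  define ok where "ok = (\<lambda>n s. s \<in> mod_hom R (P.P n) (Q.P (Suc n)) \<and>
    (n = 0 \<longrightarrow> (\<forall>f\<in>carrier (P.P 0). d' 0 (s f) = w 0 f)) \<and>
    (\<forall>f\<in>carrier (P.P (Suc n)). d' n (s (d n f)) = w n (d n f)))"
  have "\<exists>s. \<forall>n. ok n (s n) \<and> (\<forall>f\<in>carrier (P.P (Suc n)).
      d' (Suc n) (s (Suc n) f) = w (Suc n) f \<ominus>\<^bsub>Q.P (Suc n)\<^esub> s n (d n f))"
  proof (rule dependent_nat_choice)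
    have "w 0 f \<in> d' 0 ` carrier (Q.P (Suc 0))" if "f \<in> carrier (P.P 0)" for f
      using Q.exact_0 w0[OF that] mod_hom_closed[OF w that] by auto
    then obtain s where s: "s \<in> mod_hom R (P.P 0) (Q.P (Suc 0))"
        "\<And>f. f \<in> carrier (P.P 0) \<Longrightarrow> d' 0 (s f) = w 0 f"
      using lift[OF w[of 0]] by metis
    then show "\<exists>s. ok 0 s" unfolding ok_def using P.d_closed by blast
  next
    fix s n assume ok: "ok n s"
    then have s: "s \<in> mod_hom R (P.P n) (Q.P (Suc n))"
      "\<And>f. f \<in> carrier (P.P (Suc n)) \<Longrightarrow> d' n (s (d n f)) = w n (d n f)" by (auto simp: ok_def)
    let ?k = "\<lambda>f. w (Suc n) f \<ominus>\<^bsub>Q.P (Suc n)\<^esub> s (d n f)"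
    have k: "?k \<in> mod_hom R (P.P (Suc n)) (Q.P (Suc n))"
      by (rule QM.minus_hom[OF P.P_left_module w mod_hom_compose[OF P.d_hom s(1)]])
    have "?k f \<in> d' (Suc n) ` carrier (Q.P (Suc (Suc n)))" if f: "f \<in> carrier (P.P (Suc n))" for f
    proof -
      have c: "s (d n f) \<in> carrier (Q.P (Suc n))" "w (Suc n) f \<in> carrier (Q.P (Suc n))"
        "w n (d n f) \<in> carrier (Q.P n)"
        using mod_hom_closed[OF s(1) P.d_closed[OF f]] mod_hom_closed[OF w] f P.d_closed[OF f] by auto
      have "d' n (?k f) = d' n (w (Suc n) f) \<ominus>\<^bsub>Q.P n\<^esub> d' n (s (d n f))"
        by (rule mod_hom_diff[OF Q.P_left_module Q.P_left_module Q.d_hom c(2,1)])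
      also have "\<dots> = \<zero>\<^bsub>Q.P n\<^esub>"
        unfolding s(2)[OF f] wS[OF f] using c(3) by (simp add: QM.M.minus_eq QM.M.r_neg)
      finally show ?thesis unfolding Q.exact_Suc using mod_hom_closed[OF k f] by blast
    qed
    then obtain t where t: "t \<in> mod_hom R (P.P (Suc n)) (Q.P (Suc (Suc n)))"
        "\<And>f. f \<in> carrier (P.P (Suc n)) \<Longrightarrow> d' (Suc n) (t f) = ?k f"
      using lift[OF k] by metis
    have "d' (Suc n) (t (d (Suc n) f)) = w (Suc n) (d (Suc n) f)" if "f \<in> carrier (P.P (Suc (Suc n)))" for f
      using t(2)[OF P.d_closed[OF that]] mod_hom_closed[OF w P.d_closed[OF that]]
      by (simp add: P.d_d[OF that] mod_hom_zero[OF P.P_left_module Q.P_left_module s(1)]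
          QM.M.minus_eq)
    then show "\<exists>t. ok (Suc n) t \<and> (\<forall>f\<in>carrier (P.P (Suc n)). d' (Suc n) (t f) = ?k f)"
      unfolding ok_def using t by blast
  qed
  then obtain s where "\<And>n. ok n (s n)"
    "\<And>n f. f \<in> carrier (P.P (Suc n)) \<Longrightarrow>
      d' (Suc n) (s (Suc n) f) = w (Suc n) f \<ominus>\<^bsub>Q.P (Suc n)\<^esub> s n (d n f)" by blast
  then show ?thesis by (intro that[of s]) (auto simp: ok_def w_def)
qed

section \<open>Idempotents of \<open>S(G)\<close> and faces of tuples\<close>

lemma mult_list_Cons: "mult_list M (x # xs) = x \<otimes>\<^bsub>M\<^esub> mult_list M xs"
  by (simp add: mult_list_def)

context exel
begin

interpretation S: Group.monoid SG by (rule exel_monoid_monoid)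

lemma e_Pe [simp]: "g \<in> carrier G \<Longrightarrow> e g \<in> Pe"
  using Pe_mult[OF _ Pe_one, of g] by simp

lemma iv_Pe: "p \<in> Pe \<Longrightarrow> iv p = p"
  by (rule iv_eq) (auto simp: Pe_idem)

lemma iv_sy:
  assumes "g \<in> carrier G" shows "iv (sy g) = sy (inv g)"
  using e_sy[of g] e_sy[of "inv g"] assms by (intro iv_eq) (auto simp: exel_e_def)

text \<open>\<open>s \<mapsto> (s s\<^sup>-\<^sup>1, deg s)\<close> is a bijection onto the pairs \<open>(t, g)\<close> with \<open>t\<close> idempotent
  and \<open>t e\<^sub>g = t\<close>; its inverse is \<open>(t, g) \<mapsto> t[g]\<close>.\<close>

lemma range_deg:
  assumes "s \<in> carrier SG"
  shows "deg s \<in> carrier G" "s \<cdot> iv s \<in> Pe" "s \<cdot> iv s \<cdot> e (deg s) = s \<cdot> iv s" "s \<cdot> iv s \<cdot> sy (deg s) = s"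
proof -
  obtain p g where p: "p \<in> Pe" "g \<in> carrier G" "s = p \<cdot> sy g" using normal_form[OF assms] .
  have d: "deg s = g" using p by (simp add: deg_mult deg_Pe deg_sy)
  have "s \<cdot> iv s = p \<cdot> (e g \<cdot> p)"
    using p by (simp add: iv_mult iv_Pe iv_sy exel_e_def S.m_assoc)
  also have "\<dots> = (p \<cdot> p) \<cdot> e g"
    unfolding e_Pe_comm[OF p(1,2), symmetric] using p by (simp add: S.m_assoc)
  finally have t: "s \<cdot> iv s = p \<cdot> e g" using p by (simp add: Pe_idem)
  show "deg s \<in> carrier G" "s \<cdot> iv s \<in> Pe" "s \<cdot> iv s \<cdot> e (deg s) = s \<cdot> iv s" "s \<cdot> iv s \<cdot> sy (deg s) = s"
    unfolding t d using p by (auto simp: Pe_Pe S.m_assoc e_idem e_sy)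
qed

lemma range_deg_inverse:
  assumes "t \<in> Pe" "g \<in> carrier G" "t \<cdot> e g = t"
  shows "t \<cdot> sy g \<cdot> iv (t \<cdot> sy g) = t" "deg (t \<cdot> sy g) = g"
proof -
  have "t \<cdot> sy g \<cdot> iv (t \<cdot> sy g) = t \<cdot> (e g \<cdot> t)"
    using assms by (simp add: iv_mult iv_Pe iv_sy exel_e_def S.m_assoc)
  also have "\<dots> = t \<cdot> e g"
    unfolding e_Pe_comm[OF assms(1,2), symmetric] using assms by (simp add: Pe_idem flip: S.m_assoc)
  finally show "t \<cdot> sy g \<cdot> iv (t \<cdot> sy g) = t" using assms(3) by simp
  show "deg (t \<cdot> sy g) = g" using assms by (simp add: deg_mult deg_Pe deg_sy)
qed

section \<open>Partial products and the idempotents of tuples\<close>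

definition partial_products :: "'g list \<Rightarrow> 'g set"
  where "partial_products gs = (\<lambda>i. mult_list G (take i gs)) ` {1..length gs}"

lemma partial_products_closed:
  "set gs \<subseteq> carrier G \<Longrightarrow> h \<in> partial_products gs \<Longrightarrow> h \<in> carrier G"
  using mult_list_closed set_take_subset by (fastforce simp: partial_products_def)

lemma partial_products_Cons:
  assumes "g \<in> carrier G"
  shows "partial_products (g # gs) = insert g ((\<lambda>h. g \<otimes> h) ` partial_products gs)"
proof -
  have i: "{1..length (g # gs)} = insert 1 (Suc ` {1..length gs})"
    by (auto simp: image_Suc_atLeastAtMost)
  show ?thesis
    unfolding partial_products_def i image_insert image_image
    using assms by (simp add: mult_list_def)
qed

lemma mult_list_e_Pe: "set hs \<subseteq> carrier G \<Longrightarrow> mult_list SG (map e hs) \<in> Pe"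
  by (induction hs) (auto simp: mult_list_def intro: Pe.intros)

text \<open>The factors are commuting idempotents, so the product absorbs each of them. Absorption
  by \<open>s\<close> thus depends only on the set of factors, not on their order or
  multiplicity.\<close>

lemma mult_list_e_absorb:
  assumes "set hs \<subseteq> carrier G" "s \<in> carrier SG"
  shows "s \<cdot> mult_list SG (map e hs) = s \<longleftrightarrow> (\<forall>h\<in>set hs. s \<cdot> e h = s)"
  using assms
proof (induction hs)
  case Nil
  then show ?case by (simp add: mult_list_def)
next
  case (Cons g hs)
  let ?q = "mult_list SG (map e hs)"
  have q: "?q \<in> Pe" "g \<in> carrier G" "s \<in> carrier SG" using Cons.prems mult_list_e_Pe by auto
  have "s \<cdot> (e g \<cdot> ?q) = s \<longleftrightarrow> s \<cdot> e g = s \<and> s \<cdot> ?q = s"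
  proof
    assume *: "s \<cdot> (e g \<cdot> ?q) = s"
    have "s \<cdot> e g = s \<cdot> (e g \<cdot> ?q) \<cdot> e g" unfolding * by simp
    also have "\<dots> = s \<cdot> (e g \<cdot> (?q \<cdot> e g))" using q by (simp add: S.m_assoc)
    also have "\<dots> = s \<cdot> ((e g \<cdot> e g) \<cdot> ?q)"
      unfolding e_Pe_comm[OF q(1,2)] using q by (simp add: S.m_assoc)
    finally have 1: "s \<cdot> e g = s" using q * by (simp add: e_idem)
    with * show "s \<cdot> e g = s \<and> s \<cdot> ?q = s" using q by (simp flip: S.m_assoc)
  qed (use q in \<open>simp flip: S.m_assoc\<close>)
  then show ?case using Cons by (simp add: mult_list_Cons)
qed

lemma mult_list_e_absorb_left:
  assumes "set hs \<subseteq> carrier G" "s \<in> carrier SG" "\<forall>h\<in>set hs. e h \<cdot> s = s"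
  shows "mult_list SG (map e hs) \<cdot> s = s"
  using assms
proof (induction hs)
  case (Cons g hs)
  then show ?case using mult_list_e_Pe[of hs] by (simp add: mult_list_Cons S.m_assoc)
qed (simp add: mult_list_def)

lemma exel_es_eq:
  obtains hs where "exel_es G gs = mult_list SG (map e hs)" "set hs = partial_products gs"
proof
  show "exel_es G gs = mult_list SG (map e (map (\<lambda>i. mult_list G (take i gs)) [1..<Suc (length gs)]))"
    by (simp add: exel_es_def comp_def)
  show "set (map (\<lambda>i. mult_list G (take i gs)) [1..<Suc (length gs)]) = partial_products gs"
    unfolding partial_products_def set_map set_upt atLeastLessThanSuc_atLeastAtMost ..
qed

lemma exel_es_Pe: "set gs \<subseteq> carrier G \<Longrightarrow> exel_es G gs \<in> Pe"
  using exel_es_eq[of gs] partial_products_closed mult_list_e_Pe by (metis subsetI)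

lemma exel_es_absorb:
  assumes "set gs \<subseteq> carrier G" "s \<in> carrier SG"
  shows "s \<cdot> exel_es G gs = s \<longleftrightarrow> (\<forall>h\<in>partial_products gs. s \<cdot> e h = s)"
  using exel_es_eq[of gs] partial_products_closed[OF assms(1)] mult_list_e_absorb[OF _ assms(2)]
  by (metis subsetI)

lemma exel_es_absorb_left:
  assumes "set gs \<subseteq> carrier G" "s \<in> carrier SG" "\<And>h. h \<in> partial_products gs \<Longrightarrow> e h \<cdot> s = s"
  shows "exel_es G gs \<cdot> s = s"
  using exel_es_eq[of gs] partial_products_closed[OF assms(1)] mult_list_e_absorb_left[OF _ assms(2)]
    assms(3) by (metis subsetI)

lemma exel_es_e:
  assumes "set gs \<subseteq> carrier G" "h \<in> partial_products gs"
  shows "e h \<cdot> exel_es G gs = exel_es G gs"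
proof -
  have "exel_es G gs \<cdot> e h = exel_es G gs"
    using exel_es_absorb[OF assms(1), of "exel_es G gs"] exel_es_Pe[OF assms(1)] assms(2) Pe_idem by auto
  then show ?thesis
    using e_Pe_comm[OF exel_es_Pe[OF assms(1)], of h] partial_products_closed[OF assms] by simp
qed

text \<open>For \<open>gs = (g\<^sub>1, \<dots>, g\<^sub>n\<^sub>+\<^sub>1)\<close>, the \<open>i\<close>-th term of \<open>\<delta>\<^sup>n f\<close> at \<open>gs\<close> is, up to sign,
  \<open>face_coeff i gs \<cdot> f (face i gs)\<close>.\<close>

definition face_coeff :: "nat \<Rightarrow> 'g list \<Rightarrow> 'g list set"
  where "face_coeff i gs = (if i = 0 then sy (gs ! 0) else e (mult_list G (take i gs)))"

definition face :: "nat \<Rightarrow> 'g list \<Rightarrow> 'g list"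
  where "face i gs = (if i = 0 then tl gs
    else if i < length gs then take (i - 1) gs @ [gs ! (i - 1) \<otimes> gs ! i] @ drop (i + 1) gs
    else take (length gs - 1) gs)"

lemma face_closed:
  assumes "gs \<in> tuples G (Suc n)" "i \<le> Suc n" shows "face i gs \<in> tuples G n"
proof -
  have gs: "length gs = Suc n" "set gs \<subseteq> carrier G" using assms by (auto simp: tuples_def)
  have nth: "gs ! j \<in> carrier G" if "j < Suc n" for j using gs that by (metis nth_mem subsetD)
  have "set (face i gs) \<subseteq> carrier G"
    using nth gs set_take_subset[of "i - 1" gs] set_take_subset[of "length gs - 1" gs]
      set_drop_subset[of "i + 1" gs] list.set_sel(2)[of gs]
    unfolding face_def by (cases "gs = []") (auto simp del: take_eq_Nil)
  moreover have "length (face i gs) = n" using gs assms(2) by (auto simp: face_def)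
  ultimately show ?thesis by (simp add: tuples_def)
qed

lemma face_Suc_Cons:
  assumes "gs \<noteq> []"
  shows "face (Suc 0) (g # gs) = (g \<otimes> gs ! 0) # face 0 gs"
    "0 < i \<Longrightarrow> face (Suc i) (g # gs) = g # face i gs"
  using assms by (cases gs; cases i; auto simp: face_def)+

text \<open>A face with \<open>i > 0\<close> deletes the \<open>i\<close>-th partial product and
  keeps the others. Since the same value may occur at another position, it is inserted on the left
  instead of being removed on the right.\<close>

lemma partial_products_face:
  assumes "set gs \<subseteq> carrier G" "0 < i" "i \<le> length gs"
  shows "insert (mult_list G (take i gs)) (partial_products (face i gs)) = partial_products gs"
  using assms
proof (induction i arbitrary: gs)
  case (Suc i)
  then obtain g hs where gs: "gs = g # hs" by (cases gs) auto
  have c: "g \<in> carrier G" "set hs \<subseteq> carrier G" using Suc.prems gs by auto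
  show ?case
  proof (cases hs)
    case Nil
    then show ?thesis using Suc.prems gs c
      by (auto simp: face_def partial_products_Cons) (auto simp: partial_products_def mult_list_def)
  next
    case (Cons h ks)
    have c': "h \<in> carrier G" "set ks \<subseteq> carrier G" using c Cons by auto
    show ?thesis
    proof (cases i)
      case 0
      have "face (Suc i) gs = (g \<otimes> h) # ks" using gs Cons 0 by (simp add: face_def)
      then show ?thesis unfolding gs 0 using Cons c c' partial_products_closed[OF c'(2)]
        by (auto simp: partial_products_Cons mult_list_def G.m_assoc image_image)
    next
      case (Suc j)
      have f: "face (Suc i) gs = g # face i hs" using face_Suc_Cons(2)[of hs i g] gs Cons Suc by simp
      have IH: "insert (mult_list G (take i hs)) (partial_products (face i hs)) = partial_products hs"
        using Suc.IH[of hs] c Suc.prems gs Suc by simp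
      show ?thesis
        unfolding f unfolding gs partial_products_Cons[OF c(1)] IH[symmetric]
        by (auto simp: mult_list_Cons)
    qed
  qed
qed simp

context
  fixes gs n assumes gs: "gs \<in> tuples G (Suc n)"
begin

lemma tuples_SucD: "set gs \<subseteq> carrier G" "length gs = Suc n" "gs = hd gs # tl gs" "hd gs \<in> carrier G"
  "set (tl gs) \<subseteq> carrier G" "gs ! 0 = hd gs"
  using gs by (cases gs; auto simp: tuples_def)+

lemma face_set: "i \<le> Suc n \<Longrightarrow> set (face i gs) \<subseteq> carrier G"
  using face_closed[OF gs] by (simp add: tuples_def)

lemma take_mult_list_closed: "mult_list G (take i gs) \<in> carrier G"
  using tuples_SucD set_take_subset[of i gs] by (intro mult_list_closed) auto

lemma face_coeff_closed: "face_coeff i gs \<in> carrier SG"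
  using take_mult_list_closed tuples_SucD by (simp add: face_coeff_def)

lemma mult_list_take_partial_products:
  "0 < i \<Longrightarrow> i \<le> Suc n \<Longrightarrow> mult_list G (take i gs) \<in> partial_products gs"
  using tuples_SucD(2) by (auto simp: partial_products_def)

text \<open>Hence only the zeroth face can change \<open>s\<close>.\<close>

lemma exel_es_face_coeff:
  assumes "s \<in> carrier SG" "s \<cdot> exel_es G gs = s" "0 < i" "i \<le> Suc n"
  shows "s \<cdot> face_coeff i gs = s"
  using assms mult_list_take_partial_products[of i] exel_es_absorb[OF tuples_SucD(1) assms(1)]
  by (simp add: face_coeff_def)

text \<open>Faces of basis elements are again basis elements. For \<open>i = 0\<close>, the relation
  \<open>[g] e_h = e_(gh) [g]\<close> turns a condition at a partial product \<open>h\<close> of the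
  tail into one at the partial product \<open>g h\<close> of \<open>gs\<close>.\<close>

lemma exel_es_face:
  assumes s: "s \<in> carrier SG" "s \<cdot> exel_es G gs = s" and i: "i \<le> Suc n"
  shows "s \<cdot> face_coeff i gs \<cdot> exel_es G (face i gs) = s \<cdot> face_coeff i gs"
proof (cases "i = 0")
  case True
  let ?g = "hd gs"
  have "s \<cdot> sy ?g \<cdot> e h = s \<cdot> sy ?g" if h: "h \<in> partial_products (tl gs)" for h
  proof -
    have hc: "h \<in> carrier G" by (rule partial_products_closed[OF tuples_SucD(5) h])
    have "?g \<otimes> h \<in> partial_products gs"
      using partial_products_Cons[OF tuples_SucD(4), of "tl gs"] h tuples_SucD(3) by auto
    then have "s \<cdot> e (?g \<otimes> h) = s"
      using exel_es_absorb[OF tuples_SucD(1) s(1)] s(2) by blast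
    then show ?thesis
      using sy_e[OF tuples_SucD(4) hc] s(1) hc tuples_SucD(4) by (simp add: S.m_assoc) (simp flip: S.m_assoc)
  qed
  then show ?thesis using True s tuples_SucD
    by (simp add: face_coeff_def face_def exel_es_absorb)
next
  case False
  have "s \<cdot> exel_es G (face i gs) = s"
    using exel_es_absorb[OF tuples_SucD(1) s(1)] exel_es_absorb[OF face_set[OF i] s(1)] s(2)
      partial_products_face[OF tuples_SucD(1), of i] False i tuples_SucD(2) by auto
  then show ?thesis using exel_es_face_coeff[OF s, of i] False i by simp
qed

text \<open>This is why every term of the differential of a cochain lies in the submodule prescribed
  at \<open>gs\<close>, so that the differential is again a cochain.\<close>

lemma face_coeff_es:
  assumes i: "i \<le> Suc n"
  shows "exel_es G gs \<cdot> (face_coeff i gs \<cdot> exel_es G (face i gs)) = face_coeff i gs \<cdot> exel_es G (face i gs)"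
proof (rule exel_es_absorb_left[OF tuples_SucD(1)])
  let ?q = "exel_es G (face i gs)" and ?c = "face_coeff i gs"
  have q: "?q \<in> Pe" "?q \<in> carrier SG" using exel_es_Pe[OF face_set[OF i]] by auto
  show "?c \<cdot> ?q \<in> carrier SG" using q face_coeff_closed by simp
  fix h assume h: "h \<in> partial_products gs"
  then have hc: "h \<in> carrier G" by (rule partial_products_closed[OF tuples_SucD(1)])
  show "e h \<cdot> (?c \<cdot> ?q) = ?c \<cdot> ?q"
  proof (cases "i = 0")
    case True
    let ?g = "hd gs"
    have c: "?c = sy ?g" "?q = exel_es G (tl gs)" using True tuples_SucD(6) by (auto simp: face_coeff_def face_def)
    have "h = ?g \<or> h \<in> (\<lambda>h. ?g \<otimes> h) ` partial_products (tl gs)"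
      using h partial_products_Cons[OF tuples_SucD(4), of "tl gs"] tuples_SucD(3) by auto
    then consider "h = ?g" | k where "k \<in> partial_products (tl gs)" "h = ?g \<otimes> k" by blast
    then show ?thesis
    proof cases
      case 1
      then show ?thesis unfolding c(1) using q tuples_SucD(4) e_sy[of ?g] by (simp flip: S.m_assoc)
    next
      case (2 k)
      have k: "k \<in> carrier G" by (rule partial_products_closed[OF tuples_SucD(5) 2(1)])
      have "e h \<cdot> (sy ?g \<cdot> ?q) = sy ?g \<cdot> (e k \<cdot> ?q)"
        using sy_e[OF tuples_SucD(4) k] q tuples_SucD(4) k by (simp add: 2(2) flip: S.m_assoc)
      then show ?thesis unfolding c using exel_es_e[OF tuples_SucD(5) 2(1)] by simp
    qed
  next
    case False
    let ?k = "mult_list G (take i gs)"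
    have c: "?c = e ?k" using False by (simp add: face_coeff_def)
    note k = take_mult_list_closed[of i]
    have "h = ?k \<or> h \<in> partial_products (face i gs)"
      using partial_products_face[OF tuples_SucD(1), of i] h False i tuples_SucD(2) by auto
    then show ?thesis
    proof
      assume "h = ?k"
      then show ?thesis unfolding c using q k by (simp add: e_idem flip: S.m_assoc)
    next
      assume "h \<in> partial_products (face i gs)"
      then have "e h \<cdot> ?q = ?q" by (rule exel_es_e[OF face_set[OF i]])
      moreover have "e h \<cdot> (e ?k \<cdot> ?q) = e ?k \<cdot> (e h \<cdot> ?q)"
        using q k hc e_comm[OF hc k] by (simp flip: S.m_assoc)
      ultimately show ?thesis unfolding c by simp
    qed
  qed
qed

end

text \<open>This makes the cone well defined: all vertices of the simplex of \<open>s\<close> are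
  admissible over \<open>s s^-1\<close>. With \<open>s = t[g]\<close>, an idempotent absorbed by
  \<open>s\<close> is moved to the left of \<open>[g]\<close>; multiplication by
  \<open>[g^-1]\<close> then replaces \<open>[g]\<close> by \<open>e_g\<close>, which
  \<open>t\<close> absorbs.\<close>

lemma exel_es_range_deg:
  assumes s: "s \<in> carrier SG" "s \<cdot> exel_es G gs = s" and gs: "set gs \<subseteq> carrier G"
  shows "s \<cdot> iv s \<cdot> exel_es G (deg s # gs) = s \<cdot> iv s"
proof -
  let ?t = "s \<cdot> iv s" and ?g = "deg s"
  note t = range_deg[OF s(1)]
  have tc: "?t \<in> carrier SG" using t(2) by simp
  have "?t \<cdot> e (?g \<otimes> h) = ?t" if h: "h \<in> partial_products gs" for h
  proof -
    have hc: "h \<in> carrier G" by (rule partial_products_closed[OF gs h])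
    have "s \<cdot> e h = s" using exel_es_absorb[OF gs s(1)] s(2) h by blast
    then have "?t \<cdot> sy ?g \<cdot> e h = ?t \<cdot> sy ?g" unfolding t(4) .
    then have "?t \<cdot> e (?g \<otimes> h) \<cdot> sy ?g = ?t \<cdot> sy ?g"
      using sy_e[OF t(1) hc] tc t(1) hc by (simp add: S.m_assoc)
    then have "?t \<cdot> e (?g \<otimes> h) \<cdot> sy ?g \<cdot> sy (inv ?g) = ?t \<cdot> sy ?g \<cdot> sy (inv ?g)" by simp
    then have "?t \<cdot> (e (?g \<otimes> h) \<cdot> e ?g) = ?t \<cdot> e ?g"
      using tc t(1) hc by (simp add: S.m_assoc exel_e_def[of G ?g])
    moreover have "?t \<cdot> (e (?g \<otimes> h) \<cdot> e ?g) = ?t \<cdot> e ?g \<cdot> e (?g \<otimes> h)"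
      using e_comm[of "?g \<otimes> h" ?g] tc t(1) hc by (simp add: S.m_assoc)
    ultimately show ?thesis unfolding t(3) by simp
  qed
  then show ?thesis
    using t gs tc by (subst exel_es_absorb) (auto simp: partial_products_Cons)
qed

text \<open>The zeroth face in coordinates: the idempotent is kept and the first vertex moves on to
  the next one.\<close>

lemma range_deg_sy:
  assumes "s \<in> carrier SG" "g \<in> carrier G" "s \<cdot> e g = s"
  shows "s \<cdot> sy g \<cdot> iv (s \<cdot> sy g) = s \<cdot> iv s" "deg (s \<cdot> sy g) = deg s \<otimes> g"
proof -
  have "s \<cdot> sy g \<cdot> iv (s \<cdot> sy g) = s \<cdot> e g \<cdot> iv s"
    using assms(1,2) iv(1)[OF assms(1)] by (simp add: iv_mult iv_sy exel_e_def S.m_assoc)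
  then show "s \<cdot> sy g \<cdot> iv (s \<cdot> sy g) = s \<cdot> iv s" using assms(3) by simp
  show "deg (s \<cdot> sy g) = deg s \<otimes> g" using assms by (simp add: deg_mult deg_sy)
qed

end

section \<open>The partial group algebra\<close>

locale partial_group_algebra = exel G for G :: "('g, 'x) monoid_scheme" (structure) +
  fixes K :: "('k, 'y) ring_scheme"
  assumes K: "cring K"
begin

interpretation S: Group.monoid SG by (rule exel_monoid_monoid)
interpretation K: cring K by (rule K)

abbreviation R where "R \<equiv> K_par K G"

lemma R_ring: "ring R"
  by (rule K_par_ring[OF K G.group_axioms])

interpretation R: ring R by (rule R_ring)

lemma R_carrier: "carrier R = carrier (free_module K (carrier SG))"
  and R_zero: "\<zero>\<^bsub>R\<^esub> = (\<lambda>s. \<zero>\<^bsub>K\<^esub>)"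
  and R_add: "a \<oplus>\<^bsub>R\<^esub> b = (\<lambda>s. a s \<oplus>\<^bsub>K\<^esub> b s)"
  and R_one: "\<one>\<^bsub>R\<^esub> = free_basis K \<one>\<^bsub>SG\<^esub>"
  and R_mult: "a \<otimes>\<^bsub>R\<^esub> b = bil_ext K (mult SG) a b"
  and R_smult: "k \<odot>\<^bsub>R\<^esub> a = (\<lambda>s. k \<otimes>\<^bsub>K\<^esub> a s)"
  by (simp_all add: semigroup_algebra_def free_module_simps)

abbreviation "bs \<equiv> free_basis K"

definition monomial :: "'k \<Rightarrow> 'g list set \<Rightarrow> 'g list set \<Rightarrow> 'k"
  where "monomial k s = (\<lambda>t. if t = s then k else \<zero>\<^bsub>K\<^esub>)"

lemma basis_closed [simp]: "s \<in> carrier SG \<Longrightarrow> bs s \<in> carrier R"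
  unfolding R_carrier by (rule free_basis_closed[OF K.ring_axioms])

lemma basis_mult: "bs s \<otimes>\<^bsub>R\<^esub> bs t = bs (s \<cdot> t)"
  unfolding R_mult by (rule bil_ext_basis[OF K])

lemma monomial_smult: "k \<in> carrier K \<Longrightarrow> monomial k s = k \<odot>\<^bsub>R\<^esub> bs s"
  by (auto simp: monomial_def free_basis_def R_smult)

lemma monomial_one: "monomial \<one>\<^bsub>K\<^esub> s = bs s"
  by (auto simp: monomial_def free_basis_def)

lemma monomial_closed: "k \<in> carrier K \<Longrightarrow> s \<in> carrier SG \<Longrightarrow> monomial k s \<in> carrier R"
  unfolding R_carrier by (rule free_module_carrierI[where Y = "{s}"]) (auto simp: monomial_def)

lemma R_smult_mult:
  assumes "k \<in> carrier K" "a \<in> carrier R" "b \<in> carrier R"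
  shows "(k \<odot>\<^bsub>R\<^esub> a) \<otimes>\<^bsub>R\<^esub> b = k \<odot>\<^bsub>R\<^esub> (a \<otimes>\<^bsub>R\<^esub> b)" "a \<otimes>\<^bsub>R\<^esub> (k \<odot>\<^bsub>R\<^esub> b) = k \<odot>\<^bsub>R\<^esub> (a \<otimes>\<^bsub>R\<^esub> b)"
proof -
  note c = assms(2,3)[unfolded R_carrier]
  have f: "k \<odot>\<^bsub>R\<^esub> a = k \<odot>\<^bsub>free_module K (carrier SG)\<^esub> a" for a by (simp add: R_smult free_module_simps)
  show "(k \<odot>\<^bsub>R\<^esub> a) \<otimes>\<^bsub>R\<^esub> b = k \<odot>\<^bsub>R\<^esub> (a \<otimes>\<^bsub>R\<^esub> b)"
    unfolding f R_mult
    using mod_hom_smult[OF bil_ext_hom_left[OF K c(2), of "carrier SG" "mult SG" "carrier SG"] assms(1) c(1)]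
    by simp
  show "a \<otimes>\<^bsub>R\<^esub> (k \<odot>\<^bsub>R\<^esub> b) = k \<odot>\<^bsub>R\<^esub> (a \<otimes>\<^bsub>R\<^esub> b)"
    unfolding f R_mult
    using mod_hom_smult[OF bil_ext_hom_right[OF K c(1), of "carrier SG" "mult SG" "carrier SG"] assms(1) c(2)]
    by simp
qed

lemma R_smult_closed: "k \<in> carrier K \<Longrightarrow> a \<in> carrier R \<Longrightarrow> k \<odot>\<^bsub>R\<^esub> a \<in> carrier R"
  using left_module.smult_closed[OF free_module_left_module[OF K.ring_axioms]]
  unfolding R_carrier by (auto simp: R_smult free_module_simps)

lemma monomial_mult:
  assumes "k \<in> carrier K" "s \<in> carrier SG" "t \<in> carrier SG"
  shows "monomial k s \<otimes>\<^bsub>R\<^esub> bs t = monomial k (s \<cdot> t)"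
  using assms by (simp add: monomial_smult R_smult_mult basis_mult)

lemma monomial_induct [consumes 1, case_names zero add monomial]:
  assumes a: "a \<in> carrier R" and "Q \<zero>\<^bsub>R\<^esub>"
    "\<And>a b. a \<in> carrier R \<Longrightarrow> b \<in> carrier R \<Longrightarrow> Q a \<Longrightarrow> Q b \<Longrightarrow> Q (a \<oplus>\<^bsub>R\<^esub> b)"
    "\<And>k s. k \<in> carrier K \<Longrightarrow> s \<in> carrier SG \<Longrightarrow> Q (monomial k s)"
  shows "Q a"
proof -
  obtain l where l: "l \<in> lists (carrier K \<times> carrier SG)" "lin_comb K l = a"
    using lin_comb_surj[OF K.ring_axioms a[unfolded R_carrier]] .
  have "Q (lin_comb K l)" using l(1)
  proof (induction l)
    case Nil
    then show ?case using assms(2) by (simp add: R_zero)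
  next
    case (Cons p l)
    obtain k s where p: "p = (k, s)" by (cases p)
    then have ks: "k \<in> carrier K" "s \<in> carrier SG" using Cons by auto
    have "lin_comb K (p # l) = monomial k s \<oplus>\<^bsub>R\<^esub> lin_comb K l"
      using ks by (auto simp: p R_add monomial_def free_basis_def)
    moreover have "lin_comb K l \<in> carrier R"
      unfolding R_carrier using Cons lin_comb_closed[OF K.ring_axioms, of l] by auto
    ultimately show ?case using assms(3,4) ks monomial_closed Cons by auto
  qed
  then show ?thesis using l by simp
qed

definition scalar :: "'k \<Rightarrow> 'g list set \<Rightarrow> 'k"
  where "scalar k = k \<odot>\<^bsub>R\<^esub> \<one>\<^bsub>R\<^esub>"

lemma scalar_closed: "k \<in> carrier K \<Longrightarrow> scalar k \<in> carrier R"
  unfolding scalar_def by (rule R_smult_closed) auto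

text \<open>Centrality is what makes scalar multiplication by \<open>K\<close> preserve linear maps
  over \<open>R\<close> and commute with the action of \<open>S(G)\<close>.\<close>

lemma scalar_central: "k \<in> carrier K \<Longrightarrow> a \<in> carrier R \<Longrightarrow> scalar k \<otimes>\<^bsub>R\<^esub> a = a \<otimes>\<^bsub>R\<^esub> scalar k"
  by (simp add: scalar_def R_smult_mult)

lemma scalar_simps:
  "k \<in> carrier K \<Longrightarrow> l \<in> carrier K \<Longrightarrow> scalar (k \<oplus>\<^bsub>K\<^esub> l) = scalar k \<oplus>\<^bsub>R\<^esub> scalar l"
  "k \<in> carrier K \<Longrightarrow> l \<in> carrier K \<Longrightarrow> scalar (k \<otimes>\<^bsub>K\<^esub> l) = scalar k \<otimes>\<^bsub>R\<^esub> scalar l"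
  "scalar \<one>\<^bsub>K\<^esub> = \<one>\<^bsub>R\<^esub>"
proof -
  have o: "\<one>\<^bsub>R\<^esub> s \<in> carrier K" for s by (simp add: R_one free_basis_def)
  show "scalar (k \<oplus>\<^bsub>K\<^esub> l) = scalar k \<oplus>\<^bsub>R\<^esub> scalar l" if "k \<in> carrier K" "l \<in> carrier K"
    using that o by (simp add: scalar_def R_smult R_add K.l_distr)
  show "scalar (k \<otimes>\<^bsub>K\<^esub> l) = scalar k \<otimes>\<^bsub>R\<^esub> scalar l" if "k \<in> carrier K" "l \<in> carrier K"
  proof -
    have "scalar k \<otimes>\<^bsub>R\<^esub> scalar l = k \<odot>\<^bsub>R\<^esub> scalar l"
      using that scalar_closed[OF that(2)] unfolding scalar_def[of k] by (simp add: R_smult_mult)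
    then show ?thesis using that o by (simp add: scalar_def R_smult K.m_assoc)
  qed
  show "scalar \<one>\<^bsub>K\<^esub> = \<one>\<^bsub>R\<^esub>" using o by (simp add: scalar_def R_smult)
qed

section \<open>Restriction of scalars, the action of \<open>S(G)\<close> and the
  differential\<close>

lemma restrict_scalars_simps:
  "carrier (restrict_scalars R N) = carrier N" "zero (restrict_scalars R N) = zero N"
  "add (restrict_scalars R N) = add N" "k \<odot>\<^bsub>restrict_scalars R N\<^esub> x = scalar k \<odot>\<^bsub>N\<^esub> x"
  by (simp_all add: restrict_scalars_def scalar_def)

lemma restrict_scalars_left_module:
  assumes "left_module R N" shows "left_module K (restrict_scalars R N)"
proof -
  interpret N: left_module R N by fact
  have "abelian_group (restrict_scalars R N)"
    by (rule abelian_group_cong[OF K N.M.abelian_group_axioms]) (simp_all add: restrict_scalars_simps)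
  then show ?thesis
    by (intro left_module.intro left_module_axioms.intro K.ring_axioms)
      (auto simp: restrict_scalars_simps scalar_closed scalar_simps N.smult_closed N.smult_l_distr
        N.smult_r_distr N.smult_assoc1 N.smult_one)
qed

context
  fixes N :: "('g list set \<Rightarrow> 'k, 'n, 'w) module_scheme"
  assumes N: "left_module R N"
begin

interpretation N: left_module R N by (rule N)

abbreviation "act \<equiv> sg_act K N"

lemma act_closed [simp]: "s \<in> carrier SG \<Longrightarrow> x \<in> carrier N \<Longrightarrow> act s x \<in> carrier N"
  by (simp add: sg_act_def N.smult_closed)

lemma act_hom: "s \<in> carrier SG \<Longrightarrow> abelian_group_hom N N (act s)"
  unfolding sg_act_def by (rule N.smult_abelian_group_hom) simp

lemma act_add:
  "s \<in> carrier SG \<Longrightarrow> x \<in> carrier N \<Longrightarrow> y \<in> carrier N \<Longrightarrow> act s (x \<oplus>\<^bsub>N\<^esub> y) = act s x \<oplus>\<^bsub>N\<^esub> act s y"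
  by (simp add: sg_act_def N.smult_r_distr)

lemma act_mult:
  "s \<in> carrier SG \<Longrightarrow> t \<in> carrier SG \<Longrightarrow> x \<in> carrier N \<Longrightarrow> act s (act t x) = act (s \<cdot> t) x"
  by (simp add: sg_act_def basis_mult flip: N.smult_assoc1)

lemma act_one: "x \<in> carrier N \<Longrightarrow> act \<one>\<^bsub>SG\<^esub> x = x"
  by (simp add: sg_act_def N.smult_one flip: R_one)

lemma act_scalar:
  assumes "s \<in> carrier SG" "x \<in> carrier N" "k \<in> carrier K"
  shows "act s (scalar k \<odot>\<^bsub>N\<^esub> x) = scalar k \<odot>\<^bsub>N\<^esub> act s x"
  using assms by (simp add: sg_act_def scalar_closed scalar_central flip: N.smult_assoc1)

text \<open>An idempotent acts as a projection, so its image is its set of fixed points. The cochain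
  condition is used in this form.\<close>

lemma act_image_iff:
  assumes "p \<in> Pe" "x \<in> carrier N"
  shows "x \<in> act p ` carrier N \<longleftrightarrow> act p x = x"
  using assms Pe_idem[OF assms(1)] by (auto simp: act_mult intro: image_eqI[of _ _ x])

text \<open>One alternating sum over all faces replaces the three-part formula. It covers
  \<open>n = 0\<close> as well, where the middle sum is empty, so degree zero can be treated like
  the others.\<close>

lemma par_delta_faces:
  assumes f: "\<And>gs. gs \<in> tuples G n \<Longrightarrow> f gs \<in> carrier N" and gs: "gs \<in> tuples G (Suc n)"
  shows "par_delta K G N n f gs =
    (\<Oplus>\<^bsub>N\<^esub>i\<in>{..Suc n}. alternate N i (act (face_coeff i gs) (f (face i gs))))" (is "_ = (\<Oplus>\<^bsub>N\<^esub>i\<in>_. ?t i)")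
proof -
  note gs_simps = tuples_SucD[OF gs]
  have t: "?t i \<in> carrier N" if "i \<le> Suc n" for i
    using f[OF face_closed[OF gs that]] face_coeff_closed[OF gs] by simp
  have s: "{..Suc n} = insert 0 (insert (Suc n) {1..n})" by auto
  have "(\<Oplus>\<^bsub>N\<^esub>i\<in>{..Suc n}. ?t i) = ?t 0 \<oplus>\<^bsub>N\<^esub> (?t (Suc n) \<oplus>\<^bsub>N\<^esub> (\<Oplus>\<^bsub>N\<^esub>i\<in>{1..n}. ?t i))"
    unfolding s using t by (subst N.M.finsum_insert; auto)+
  also have "\<dots> = ?t 0 \<oplus>\<^bsub>N\<^esub> (\<Oplus>\<^bsub>N\<^esub>i\<in>{1..n}. ?t i) \<oplus>\<^bsub>N\<^esub> ?t (Suc n)"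
  proof -
    have "(\<Oplus>\<^bsub>N\<^esub>i\<in>{1..n}. ?t i) \<in> carrier N" by (rule N.M.finsum_closed) (use t in auto)
    then show ?thesis using t by (simp add: N.M.a_ac)
  qed
  also have "(\<Oplus>\<^bsub>N\<^esub>i\<in>{1..n}. ?t i) = (\<Oplus>\<^bsub>N\<^esub>i\<in>{1..n}. alternate N i (act (e (mult_list G (take i gs)))
          (f (take (i - 1) gs @ [gs ! (i - 1) \<otimes> gs ! i] @ drop (i + 1) gs))))"
  proof (rule N.M.finsum_cong'[OF HOL.refl])
    have eq: "?t i = alternate N i (act (e (mult_list G (take i gs)))
          (f (take (i - 1) gs @ [gs ! (i - 1) \<otimes> gs ! i] @ drop (i + 1) gs)))" if "i \<in> {1..n}" for i
      using that gs_simps(2) by (simp add: face_coeff_def face_def)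
    show "(\<lambda>i. alternate N i (act (e (mult_list G (take i gs)))
          (f (take (i - 1) gs @ [gs ! (i - 1) \<otimes> gs ! i] @ drop (i + 1) gs)))) \<in> {1..n} \<rightarrow> carrier N"
    proof
      fix i assume i: "i \<in> {1..n}"
      show "alternate N i (act (e (mult_list G (take i gs)))
          (f (take (i - 1) gs @ [gs ! (i - 1) \<otimes> gs ! i] @ drop (i + 1) gs))) \<in> carrier N"
        unfolding eq[OF i, symmetric] using t i by simp
    qed
    show "?t i = alternate N i (act (e (mult_list G (take i gs)))
          (f (take (i - 1) gs @ [gs ! (i - 1) \<otimes> gs ! i] @ drop (i + 1) gs)))" if "i \<in> {1..n}" for i
      by (rule eq[OF that])
  qed
  also have "?t 0 = act (sy (gs ! 0)) (f (tl gs))" by (simp add: alternate_def face_coeff_def face_def)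
  also have "?t (Suc n) = alternate N (n + 1) (act (e (mult_list G gs)) (f (take n gs)))"
    using gs_simps(2) by (simp add: face_coeff_def face_def)
  finally show ?thesis using gs by (simp add: par_delta_def)
qed

lemma par_delta_closed:
  assumes f: "\<And>gs. gs \<in> tuples G n \<Longrightarrow> f gs \<in> carrier N" and gs: "gs \<in> tuples G (Suc n)"
  shows "par_delta K G N n f gs \<in> carrier N"
proof -
  have "act (face_coeff i gs) (f (face i gs)) \<in> carrier N" if "i \<le> Suc n" for i
    using f[OF face_closed[OF gs that]] face_coeff_closed[OF gs] by simp
  then show ?thesis
    by (subst par_delta_faces[OF _ gs]) (auto intro!: N.M.finsum_closed f)
qed

lemma par_delta_fixed:
  assumes f: "\<And>gs. gs \<in> tuples G n \<Longrightarrow> f gs \<in> carrier N"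
    "\<And>gs. gs \<in> tuples G n \<Longrightarrow> act (exel_es G gs) (f gs) = f gs"
    and gs: "gs \<in> tuples G (Suc n)"
  shows "act (exel_es G gs) (par_delta K G N n f gs) = par_delta K G N n f gs"
proof -
  note gs_simps = tuples_SucD[OF gs]
  let ?q = "exel_es G gs" and ?t = "\<lambda>i. act (face_coeff i gs) (f (face i gs))"
  have q: "?q \<in> carrier SG" using exel_es_Pe[OF gs_simps(1)] by simp
  interpret h: abelian_group_hom N N "act ?q" by (rule act_hom[OF q])
  have t: "?t i \<in> carrier N" "act ?q (?t i) = ?t i" if i: "i \<le> Suc n" for i
  proof -
    note fc = face_closed[OF gs i] and c = face_coeff_closed[OF gs]
    have p: "exel_es G (face i gs) \<in> carrier SG" using exel_es_Pe[OF face_set[OF gs i]] by simp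
    show "?t i \<in> carrier N" using f(1)[OF fc] c by simp
    have "act ?q (?t i) = act ?q (act (face_coeff i gs) (act (exel_es G (face i gs)) (f (face i gs))))"
      using f(2)[OF fc] by simp
    also have "\<dots> = act (face_coeff i gs) (act (exel_es G (face i gs)) (f (face i gs)))"
      using f(1)[OF fc] c p q face_coeff_es[OF gs i] by (simp add: act_mult)
    finally show "act ?q (?t i) = ?t i" using f(2)[OF fc] by simp
  qed
  have "act ?q (\<Oplus>\<^bsub>N\<^esub>i\<in>{..Suc n}. alternate N i (?t i)) = (\<Oplus>\<^bsub>N\<^esub>i\<in>{..Suc n}. act ?q (alternate N i (?t i)))"
    by (rule h.additive_finsum) (use t in auto)
  also have "\<dots> = (\<Oplus>\<^bsub>N\<^esub>i\<in>{..Suc n}. alternate N i (?t i))"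
    by (rule N.M.finsum_cong') (use t in \<open>auto simp: h.hom_alternate\<close>)
  also have "\<dots> = par_delta K G N n f gs" by (rule par_delta_faces[symmetric]) (use f gs in auto)
  finally show ?thesis by (subst (1) par_delta_faces[OF _ gs]) (use f in auto)
qed

end

lemma mod_hom_act:
  assumes "h \<in> mod_hom R N N'" "s \<in> carrier SG" "x \<in> carrier N"
  shows "h (sg_act K N s x) = sg_act K N' s (h x)"
  using mod_hom_smult[OF assms(1) _ assms(3), of "bs s"] assms(2) by (simp add: sg_act_def)

text \<open>Naturality in the module. The generators form a universal cochain, so the differential
  of any cochain is the image of the differential of this one.\<close>

lemma par_delta_hom:
  assumes N: "left_module R N" and N': "left_module R N'" and h: "h \<in> mod_hom R N N'"
    and f: "\<And>gs. gs \<in> tuples G n \<Longrightarrow> f gs \<in> carrier N" and gs: "gs \<in> tuples G (Suc n)"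
  shows "h (par_delta K G N n f gs) = par_delta K G N' n (\<lambda>gs. h (f gs)) gs"
proof -
  interpret N: left_module R N by (rule N)
  interpret N': left_module R N' by (rule N')
  interpret h: abelian_group_hom N N' h by (rule mod_hom_abelian_group_hom[OF N N' h])
  have t: "sg_act K N (face_coeff i gs) (f (face i gs)) \<in> carrier N"
    "h (sg_act K N (face_coeff i gs) (f (face i gs))) = sg_act K N' (face_coeff i gs) (h (f (face i gs)))"
    if "i \<le> Suc n" for i
    using f[OF face_closed[OF gs that]] face_coeff_closed[OF gs]
    by (simp_all add: act_closed[OF N] mod_hom_act[OF h])
  have "h (par_delta K G N n f gs) =
      (\<Oplus>\<^bsub>N'\<^esub>i\<in>{..Suc n}. h (alternate N i (sg_act K N (face_coeff i gs) (f (face i gs)))))"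
    by (subst par_delta_faces[OF N _ gs]) (use f t in \<open>auto intro!: h.additive_finsum\<close>)
  also have "\<dots> = (\<Oplus>\<^bsub>N'\<^esub>i\<in>{..Suc n}. alternate N' i (sg_act K N' (face_coeff i gs) (h (f (face i gs)))))"
    by (rule N'.M.finsum_cong')
      (use t f face_closed[OF gs] face_coeff_closed[OF gs] in \<open>auto simp: h.hom_alternate act_closed[OF N']\<close>)
  also have "\<dots> = par_delta K G N' n (\<lambda>gs. h (f gs)) gs"
    by (rule par_delta_faces[OF N' _ gs, symmetric]) (use f in auto)
  finally show ?thesis .
qed

section \<open>A projective resolution of \<open>B\<close>\<close>

abbreviation B where "B \<equiv> idempotent_module K SG"

definition idem :: "'g list \<Rightarrow> 'g list set \<Rightarrow> 'k"
  where "idem gs = bs (exel_es G gs)"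

abbreviation chains where "chains n \<equiv> proj_module R (tuples G n) idem"
abbreviation gen where "gen \<equiv> proj_gen R idem"

definition chain_bd :: "nat \<Rightarrow> ('g list \<Rightarrow> 'g list set \<Rightarrow> 'k) \<Rightarrow> 'g list \<Rightarrow> 'g list set \<Rightarrow> 'k"
  where "chain_bd n = free_lift R (chains n) (par_delta K G (chains n) n gen)"

text \<open>\<open>chains 0\<close> is \<open>R\<close> itself, and the augmentation sends
  \<open>s\<close> to \<open>s s^-1\<close>: it forgets the only vertex of a simplex and keeps its
  idempotent.\<close>

definition chain_aug :: "('g list \<Rightarrow> 'g list set \<Rightarrow> 'k) \<Rightarrow> 'g list set \<Rightarrow> 'k"
  where "chain_aug = free_lift R B (\<lambda>gs. bs \<one>\<^bsub>SG\<^esub>)"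

lemma tuples_set: "gs \<in> tuples G n \<Longrightarrow> set gs \<subseteq> carrier G"
  by (simp add: tuples_def)

lemma tuples_0: "tuples G 0 = {[]}"
  by (auto simp: tuples_def)

lemma exel_es_Nil: "exel_es G [] = \<one>\<^bsub>SG\<^esub>"
  by (simp add: exel_es_def mult_list_def)

lemma es_closed: "gs \<in> tuples G n \<Longrightarrow> exel_es G gs \<in> carrier SG"
  using exel_es_Pe[OF tuples_set] by simp

lemma es_idem: "gs \<in> tuples G n \<Longrightarrow> exel_es G gs \<cdot> exel_es G gs = exel_es G gs"
  by (rule Pe_idem[OF exel_es_Pe[OF tuples_set]])

lemma idem_family: "idempotent_family R (tuples G n) idem"
  by unfold_locales (auto simp: idem_def basis_mult es_idem intro!: basis_closed es_closed)

lemmas chains_left_module = idempotent_family.proj_left_module[OF idem_family]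
  and gen_closed = idempotent_family.proj_gen_closed[OF idem_family]

lemma B_left_module: "left_module R B"
  by (rule idempotent_module_exel[OF K G.group_axioms])

lemma act_gen: "gs \<in> tuples G n \<Longrightarrow> sg_act K (chains n) (exel_es G gs) (gen gs) = gen gs"
  using idempotent_family.proj_gen_idem[OF idem_family] by (simp add: sg_act_def idem_def)

lemma chain_bd_hom: "chain_bd n \<in> mod_hom R (chains (Suc n)) (chains n)"
  unfolding chain_bd_def
  by (rule idempotent_family.proj_lift_hom[OF idem_family chains_left_module])
    (auto intro!: par_delta_closed[OF chains_left_module] gen_closed)

text \<open>A lift takes the prescribed value at a generator only if the idempotent there fixes the
  value. Here it does, because the differential of a cochain is a cochain.\<close>

lemma chain_bd_gen:
  assumes "gs \<in> tuples G (Suc n)"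
  shows "chain_bd n (gen gs) = par_delta K G (chains n) n gen gs"
  unfolding chain_bd_def
proof (rule idempotent_family.proj_lift_gen[OF idem_family chains_left_module _ assms])
  show "par_delta K G (chains n) n gen \<in> tuples G (Suc n) \<rightarrow> carrier (chains n)"
    by (auto intro!: par_delta_closed[OF chains_left_module] gen_closed)
  show "idem gs \<odot>\<^bsub>chains n\<^esub> par_delta K G (chains n) n gen gs = par_delta K G (chains n) n gen gs"
    using par_delta_fixed[OF chains_left_module gen_closed act_gen assms]
    by (simp add: sg_act_def idem_def)
qed

text \<open>Those with \<open>s\<close> absorbing \<open>exel_es G gs\<close> span the chains over
  \<open>K\<close>, by \<open>chains_induct\<close>; for \<open>k = 1\<close> such an element is one
  simplex over \<open>s s^-1\<close> with first vertex \<open>deg s\<close>.\<close>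

definition single :: "'k \<Rightarrow> 'g list set \<Rightarrow> 'g list \<Rightarrow> 'g list \<Rightarrow> 'g list set \<Rightarrow> 'k"
  where "single k s gs = (\<lambda>hs. if hs = gs then monomial k s else \<zero>\<^bsub>R\<^esub>)"

lemma monomial_gen:
  assumes "k \<in> carrier K" "s \<in> carrier SG" "gs \<in> tuples G n"
  shows "monomial k s \<odot>\<^bsub>chains n\<^esub> gen gs = single k (s \<cdot> exel_es G gs) gs"
  using assms es_closed[OF assms(3)] monomial_closed[OF assms(1,2)]
  by (auto simp: proj_module_simps proj_gen_def single_def idem_def monomial_mult)

lemma single_eq:
  assumes "k \<in> carrier K" "s \<in> carrier SG" "gs \<in> tuples G n" "s \<cdot> exel_es G gs = s"
  shows "single k s gs = monomial k s \<odot>\<^bsub>chains n\<^esub> gen gs"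
  using monomial_gen[OF assms(1-3)] assms(4) by simp

lemma single_closed:
  assumes "k \<in> carrier K" "s \<in> carrier SG" "gs \<in> tuples G n" "s \<cdot> exel_es G gs = s"
  shows "single k s gs \<in> carrier (chains n)"
  unfolding single_eq[OF assms]
  by (rule left_module.smult_closed[OF chains_left_module monomial_closed[OF assms(1,2)] gen_closed[OF assms(3)]])

lemma chains_induct [consumes 1, case_names zero add single]:
  assumes f: "f \<in> carrier (chains n)" and 0: "Q \<zero>\<^bsub>chains n\<^esub>"
    and add: "\<And>f g. f \<in> carrier (chains n) \<Longrightarrow> g \<in> carrier (chains n) \<Longrightarrow> Q f \<Longrightarrow> Q g \<Longrightarrow> Q (f \<oplus>\<^bsub>chains n\<^esub> g)"
    and single: "\<And>k s gs. k \<in> carrier K \<Longrightarrow> s \<in> carrier SG \<Longrightarrow> gs \<in> tuples G n \<Longrightarrow>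
      s \<cdot> exel_es G gs = s \<Longrightarrow> Q (single k s gs)"
  shows "Q f"
proof -
  interpret C: left_module R "chains n" by (rule chains_left_module)
  have gen: "Q (a \<odot>\<^bsub>chains n\<^esub> gen gs)" if gs: "gs \<in> tuples G n" and a: "a \<in> carrier R" for a gs
    using a
  proof (induction rule: monomial_induct)
    case zero
    then show ?case using 0 gen_closed[OF gs] by (simp add: smult_l_null'[OF chains_left_module])
  next
    case (add a b)
    then show ?case using assms(3) gen_closed[OF gs] by (simp add: C.smult_l_distr C.smult_closed)
  next
    case (monomial k s)
    \<comment> \<open>An arbitrary \<open>s\<close> acts on the generator like its product with the
      idempotent, and this product satisfies the absorption hypothesis of
      \<open>single\<close>.\<close>
    have "s \<cdot> exel_es G gs \<cdot> exel_es G gs = s \<cdot> exel_es G gs"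
      using monomial es_closed[OF gs] es_idem[OF gs] by (simp add: S.m_assoc)
    then show ?case unfolding monomial_gen[OF monomial gs] using monomial es_closed[OF gs] gs by (intro single) auto
  qed
  have "f \<in> carrier (free_module R (tuples G n))" using f by (simp add: proj_module_simps)
  note f' = free_moduleD[OF this]
  have "Q (\<Oplus>\<^bsub>chains n\<^esub>gs\<in>Y. f gs \<odot>\<^bsub>chains n\<^esub> gen gs)" if "finite Y" "Y \<subseteq> tuples G n" for Y
    using that
  proof (induction Y rule: finite_induct)
    case (insert gs Y)
    have c: "f hs \<odot>\<^bsub>chains n\<^esub> gen hs \<in> carrier (chains n)" if "hs \<in> insert gs Y" for hs
      using insert(4) that f'(1) by (intro C.smult_closed gen_closed) auto
    have "(\<Oplus>\<^bsub>chains n\<^esub>hs\<in>insert gs Y. f hs \<odot>\<^bsub>chains n\<^esub> gen hs) =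
        f gs \<odot>\<^bsub>chains n\<^esub> gen gs \<oplus>\<^bsub>chains n\<^esub> (\<Oplus>\<^bsub>chains n\<^esub>hs\<in>Y. f hs \<odot>\<^bsub>chains n\<^esub> gen hs)"
      by (rule C.M.finsum_insert) (use insert c in auto)
    moreover have "(\<Oplus>\<^bsub>chains n\<^esub>hs\<in>Y. f hs \<odot>\<^bsub>chains n\<^esub> gen hs) \<in> carrier (chains n)"
      by (rule C.M.finsum_closed) (use c in auto)
    ultimately show ?case using insert c gen f'(1) by (auto intro!: add)
  qed (simp add: 0)
  then have "Q (free_lift R (chains n) gen f)" using f' by (simp add: free_lift_def)
  then show ?thesis using idempotent_family.proj_expand[OF idem_family f] by simp
qed

text \<open>The simplicial boundary: in the coordinates \<open>(s s^-1; g, g g_1, ...)\<close> the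
  \<open>i\<close>-th term omits the vertex in position \<open>i\<close>, counted from 0.\<close>

lemma chain_bd_single:
  assumes k: "k \<in> carrier K" and s: "s \<in> carrier SG" and gs: "gs \<in> tuples G (Suc n)"
    and absorb: "s \<cdot> exel_es G gs = s"
  shows "chain_bd n (single k s gs) =
    (\<Oplus>\<^bsub>chains n\<^esub>i\<in>{..Suc n}. alternate (chains n) i (single k (s \<cdot> face_coeff i gs) (face i gs)))"
proof -
  interpret C: left_module R "chains n" by (rule chains_left_module)
  note m = monomial_closed[OF k s]
  interpret h: abelian_group_hom "chains n" "chains n" "\<lambda>x. monomial k s \<odot>\<^bsub>chains n\<^esub> x"
    by (rule C.smult_abelian_group_hom[OF m])
  let ?t = "\<lambda>i. sg_act K (chains n) (face_coeff i gs) (gen (face i gs))"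
  have t: "?t i \<in> carrier (chains n)" "monomial k s \<odot>\<^bsub>chains n\<^esub> ?t i = single k (s \<cdot> face_coeff i gs) (face i gs)"
    if i: "i \<le> Suc n" for i
  proof -
    note fc = face_closed[OF gs i] and c = face_coeff_closed[OF gs, of i]
    show "?t i \<in> carrier (chains n)" using gen_closed[OF fc] c by (simp add: act_closed[OF chains_left_module])
    have "monomial k s \<odot>\<^bsub>chains n\<^esub> ?t i = monomial k (s \<cdot> face_coeff i gs) \<odot>\<^bsub>chains n\<^esub> gen (face i gs)"
      using gen_closed[OF fc] c m k s by (simp add: sg_act_def monomial_mult flip: C.smult_assoc1)
    also have "\<dots> = single k (s \<cdot> face_coeff i gs) (face i gs)"
      using monomial_gen[OF k _ fc, of "s \<cdot> face_coeff i gs"] exel_es_face[OF gs s absorb i] s c by simp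
    finally show "monomial k s \<odot>\<^bsub>chains n\<^esub> ?t i = single k (s \<cdot> face_coeff i gs) (face i gs)" .
  qed
  have "chain_bd n (single k s gs) = monomial k s \<odot>\<^bsub>chains n\<^esub> chain_bd n (gen gs)"
    unfolding single_eq[OF assms] by (rule mod_hom_smult[OF chain_bd_hom m gen_closed[OF gs]])
  also have "chain_bd n (gen gs) = (\<Oplus>\<^bsub>chains n\<^esub>i\<in>{..Suc n}. alternate (chains n) i (?t i))"
    unfolding chain_bd_gen[OF gs]
    by (rule par_delta_faces[OF chains_left_module _ gs]) (rule gen_closed)
  also have "monomial k s \<odot>\<^bsub>chains n\<^esub> \<dots> =
      (\<Oplus>\<^bsub>chains n\<^esub>i\<in>{..Suc n}. monomial k s \<odot>\<^bsub>chains n\<^esub> alternate (chains n) i (?t i))"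
    by (rule h.additive_finsum) (use t in auto)
  also have "\<dots> = (\<Oplus>\<^bsub>chains n\<^esub>i\<in>{..Suc n}. alternate (chains n) i (single k (s \<cdot> face_coeff i gs) (face i gs)))"
  proof (rule C.M.finsum_cong')
    show "(\<lambda>i. alternate (chains n) i (single k (s \<cdot> face_coeff i gs) (face i gs))) \<in> {..Suc n} \<rightarrow> carrier (chains n)"
      using t C.smult_closed[OF m t(1)] by auto
  qed (use t in \<open>auto simp: h.hom_alternate\<close>)
  finally show ?thesis .
qed

text \<open>The contracting homotopy \<open>h\<close> sends the \<open>K\<close>-basis element \<open>s\<close> of the summand at \<open>gs\<close> to
  \<open>s s\<^sup>-\<^sup>1\<close> in the summand at \<open>deg s # gs\<close>, that is, \<open>(s s\<^sup>-\<^sup>1; g, g g\<^sub>1, \<dots>)\<close> to \<open>(s s\<^sup>-\<^sup>1; 1, g, g g\<^sub>1, \<dots>)\<close>.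
  The definition reads off coefficients by means of the bijection above.\<close>

definition cone :: "('g list \<Rightarrow> 'g list set \<Rightarrow> 'k) \<Rightarrow> 'g list \<Rightarrow> 'g list set \<Rightarrow> 'k"
  where "cone f = (\<lambda>hs. case hs of [] \<Rightarrow> \<zero>\<^bsub>R\<^esub>
    | g # gs \<Rightarrow> (\<lambda>t. if g \<in> carrier G \<and> t \<in> Pe \<and> t \<cdot> e g = t then f gs (t \<cdot> sy g) else \<zero>\<^bsub>K\<^esub>))"

lemma cone_add: "cone (f \<oplus>\<^bsub>chains n\<^esub> g) = cone f \<oplus>\<^bsub>chains (Suc n)\<^esub> cone g"
  by (auto simp: cone_def proj_module_simps R_add R_zero fun_eq_iff split: list.split)

lemma cone_zero: "cone \<zero>\<^bsub>chains n\<^esub> = \<zero>\<^bsub>chains (Suc n)\<^esub>"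
  by (auto simp: cone_def proj_module_simps R_zero fun_eq_iff split: list.split)

lemma cone_single:
  assumes "s \<in> carrier SG"
  shows "cone (single k s gs) = single k (s \<cdot> iv s) (deg s # gs)"
proof (intro ext)
  fix hs t
  show "cone (single k s gs) hs t = single k (s \<cdot> iv s) (deg s # gs) hs t"
  proof (cases hs)
    case (Cons g hs')
    \<comment> \<open>The bijection between the elements \<open>s\<close> and the pairs
      \<open>(s s^-1, deg s)\<close>: the coefficient read off at \<open>(t, g)\<close> belongs to
      \<open>s\<close> for exactly one pair.\<close>
    have iff: "(g \<in> carrier G \<and> t \<in> Pe \<and> t \<cdot> e g = t \<and> t \<cdot> sy g = s) \<longleftrightarrow> (g = deg s \<and> t = s \<cdot> iv s)"
      using range_deg[OF assms] range_deg_inverse[of t g] by auto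
    have "cone (single k s gs) hs t = (if hs' = gs \<and>
        (g \<in> carrier G \<and> t \<in> Pe \<and> t \<cdot> e g = t \<and> t \<cdot> sy g = s) then k else \<zero>\<^bsub>K\<^esub>)"
      by (simp add: Cons cone_def single_def monomial_def R_zero)
    also have "\<dots> = single k (s \<cdot> iv s) (deg s # gs) hs t"
      unfolding iff by (simp add: Cons single_def monomial_def R_zero)
    finally show ?thesis .
  qed (simp add: cone_def single_def)
qed

lemma cone_single_closed:
  assumes "k \<in> carrier K" "s \<in> carrier SG" "gs \<in> tuples G n" "s \<cdot> exel_es G gs = s"
  shows "cone (single k s gs) \<in> carrier (chains (Suc n))"
  unfolding cone_single[OF assms(2)]
  using assms range_deg[OF assms(2)] exel_es_range_deg[OF assms(2,4) tuples_set[OF assms(3)]]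
  by (intro single_closed) (auto simp: tuples_def)

text \<open>The formula for \<open>cone\<close> is visibly additive, so finite support and
  absorption of the idempotents need to be verified on single simplices only.\<close>

lemma cone_closed: "f \<in> carrier (chains n) \<Longrightarrow> cone f \<in> carrier (chains (Suc n))"
proof (induction rule: chains_induct)
  case zero
  interpret left_module R "chains (Suc n)" by (rule chains_left_module)
  show ?case by (simp add: cone_zero)
next
  case (add f g)
  interpret left_module R "chains (Suc n)" by (rule chains_left_module)
  show ?case using add by (simp add: cone_add)
qed (rule cone_single_closed)

text \<open>Only additivity is claimed: left multiplication by \<open>[h]\<close> translates the
  vertices and in general moves the apex.\<close>

lemma cone_hom: "abelian_group_hom (chains n) (chains (Suc n)) cone"
proof -
  interpret C: left_module R "chains n" by (rule chains_left_module)
  interpret C': left_module R "chains (Suc n)" by (rule chains_left_module)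
  show ?thesis
    by (rule abelian_group_hom_additiveI[OF C.M.abelian_group_axioms C'.M.abelian_group_axioms])
      (auto simp: cone_closed cone_add)
qed

text \<open>The cone on the empty simplex: an idempotent \<open>t\<close> of \<open>B\<close>
  becomes the vertex 1 over \<open>t\<close>, which is \<open>t = t[1]\<close> as an element of
  \<open>R\<close>.\<close>

definition incl :: "('g list set \<Rightarrow> 'k) \<Rightarrow> 'g list \<Rightarrow> 'g list set \<Rightarrow> 'k"
  where "incl b = (\<lambda>hs. if hs = [] then b else \<zero>\<^bsub>R\<^esub>)"

lemma incl_mono: "incl (monomial k s) = single k s []"
  by (simp add: incl_def single_def)

lemma B_simps:
  "carrier B = carrier (free_module K Pe)" "\<zero>\<^bsub>B\<^esub> = (\<lambda>s. \<zero>\<^bsub>K\<^esub>)" "b \<oplus>\<^bsub>B\<^esub> c = (\<lambda>s. b s \<oplus>\<^bsub>K\<^esub> c s)"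
  "a \<odot>\<^bsub>B\<^esub> b = bil_ext K (\<lambda>s p. s \<cdot> p \<cdot> iv s) a b"
  by (simp_all add: idempotent_module_def free_module_simps idempotents_Pe)

lemma one_B: "bs \<one>\<^bsub>SG\<^esub> \<in> carrier B"
  unfolding B_simps by (rule free_basis_closed[OF K.ring_axioms Pe_one])

lemma monomial_one_B:
  assumes "k \<in> carrier K" "s \<in> carrier SG"
  shows "monomial k s \<odot>\<^bsub>B\<^esub> bs \<one>\<^bsub>SG\<^esub> = monomial k (s \<cdot> iv s)"
proof -
  have *: "(\<lambda>a. bil_ext K (\<lambda>s p. s \<cdot> p \<cdot> iv s) a (bs \<one>\<^bsub>SG\<^esub>))
      \<in> mod_hom K (free_module K (carrier SG)) (free_module K (carrier SG))"
    by (rule bil_ext_hom_left[OF K free_basis_closed[OF K.ring_axioms Pe_one]])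
      (auto simp: iv)
  have c: "bs s \<in> carrier (free_module K (carrier SG))"
    by (rule free_basis_closed[OF K.ring_axioms assms(2)])
  have "monomial k s = k \<odot>\<^bsub>free_module K (carrier SG)\<^esub> bs s"
    using assms(1) by (simp add: monomial_smult R_smult free_module_simps)
  then have "monomial k s \<odot>\<^bsub>B\<^esub> bs \<one>\<^bsub>SG\<^esub> = k \<odot>\<^bsub>free_module K (carrier SG)\<^esub> bs (s \<cdot> \<one>\<^bsub>SG\<^esub> \<cdot> iv s)"
    using mod_hom_smult[OF * assms(1) c] by (simp add: B_simps bil_ext_basis[OF K])
  also have "\<dots> = monomial k (s \<cdot> iv s)"
    using assms by (simp add: monomial_smult R_smult free_module_simps)
  finally show ?thesis .
qed

lemma chain_aug_hom: "chain_aug \<in> mod_hom R (chains 0) B"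
  unfolding chain_aug_def
  by (rule idempotent_family.proj_lift_hom[OF idem_family B_left_module]) (use one_B in auto)

lemma chain_aug_gen: "chain_aug (gen []) = bs \<one>\<^bsub>SG\<^esub>"
proof -
  interpret B: left_module R B by (rule B_left_module)
  show ?thesis
    unfolding chain_aug_def
    by (rule idempotent_family.proj_lift_gen[OF idem_family[of 0] B_left_module])
      (use one_B B.smult_one[OF one_B] in \<open>auto simp: tuples_0 idem_def exel_es_Nil R_one\<close>)
qed

lemma chain_aug_single:
  assumes "k \<in> carrier K" "s \<in> carrier SG"
  shows "chain_aug (single k s []) = monomial k (s \<cdot> iv s)"
proof -
  have n: "[] \<in> tuples G 0" by (simp add: tuples_0)
  have "single k s [] = monomial k s \<odot>\<^bsub>chains 0\<^esub> gen []"
    by (rule single_eq[OF assms n]) (use assms in \<open>simp add: exel_es_Nil\<close>)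
  then have "chain_aug (single k s []) = monomial k s \<odot>\<^bsub>B\<^esub> chain_aug (gen [])"
    using mod_hom_smult[OF chain_aug_hom monomial_closed[OF assms] gen_closed[OF n]] by simp
  then show ?thesis using monomial_one_B[OF assms] by (simp add: chain_aug_gen)
qed

lemma incl_aug:
  assumes "b \<in> carrier B" shows "incl b \<in> carrier (chains 0)" "chain_aug (incl b) = b"
proof -
  interpret C: left_module R "chains 0" by (rule chains_left_module)
  obtain l where l: "l \<in> lists (carrier K \<times> Pe)" "lin_comb K l = b"
    using lin_comb_surj[OF K.ring_axioms assms[unfolded B_simps]] .
  have "incl (lin_comb K l) \<in> carrier (chains 0) \<and> chain_aug (incl (lin_comb K l)) = lin_comb K l"
    using l(1)
  proof (induction l)
    case Nil
    have "incl (lin_comb K []) = \<zero>\<^bsub>chains 0\<^esub>" by (auto simp: incl_def proj_module_simps R_zero)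
    then show ?case using mod_hom_zero[OF chains_left_module B_left_module chain_aug_hom]
      by (simp add: B_simps)
  next
    case (Cons q l)
    obtain k p where q: "q = (k, p)" by (cases q)
    then have kp: "k \<in> carrier K" "p \<in> Pe" using Cons by auto
    have 1: "lin_comb K (q # l) = monomial k p \<oplus>\<^bsub>B\<^esub> lin_comb K l"
      using kp by (auto simp: q B_simps monomial_def free_basis_def)
    have 2: "incl (lin_comb K (q # l)) = single k p [] \<oplus>\<^bsub>chains 0\<^esub> incl (lin_comb K l)"
      unfolding 1 incl_mono[symmetric] by (auto simp: incl_def proj_module_simps B_simps R_add R_zero)
    have 3: "single k p [] \<in> carrier (chains 0)"
      by (rule single_closed) (use kp in \<open>auto simp: tuples_0 exel_es_Nil\<close>)
    have 4: "incl (lin_comb K l) \<in> carrier (chains 0)" "chain_aug (incl (lin_comb K l)) = lin_comb K l"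
      using Cons by auto
    have "chain_aug (single k p []) = monomial k p"
      using chain_aug_single[of k p] kp by (simp add: iv_Pe Pe_idem)
    then show ?case
      unfolding 2 using 3 4 by (simp add: mod_hom_add[OF chain_aug_hom] 1 del: lin_comb.simps)
  qed
  then show "incl b \<in> carrier (chains 0)" "chain_aug (incl b) = b" using l by auto
qed

lemma incl_add: "incl (b \<oplus>\<^bsub>B\<^esub> c) = incl b \<oplus>\<^bsub>chains 0\<^esub> incl c"
  by (auto simp: incl_def proj_module_simps B_simps R_add R_zero)

lemma incl_zero: "incl \<zero>\<^bsub>B\<^esub> = \<zero>\<^bsub>chains 0\<^esub>"
  by (auto simp: incl_def proj_module_simps B_simps R_zero)

text \<open>The boundary of the edge from 1 to \<open>g\<close> over \<open>t\<close> is the vertex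
  \<open>g\<close> minus the vertex 1; the latter is \<open>incl\<close> of the
  augmentation.\<close>

lemma cone_homotopy_0:
  assumes "f \<in> carrier (chains 0)"
  shows "chain_bd 0 (cone f) \<oplus>\<^bsub>chains 0\<^esub> incl (chain_aug f) = f"
  using assms
proof (induction rule: chains_induct)
  case zero
  interpret C: left_module R "chains 0" by (rule chains_left_module)
  show ?case
    by (simp add: cone_zero mod_hom_zero[OF chains_left_module chains_left_module chain_bd_hom]
        mod_hom_zero[OF chains_left_module B_left_module chain_aug_hom] incl_zero)
next
  case (add f g)
  interpret C: left_module R "chains 0" by (rule chains_left_module)
  have c: "chain_bd 0 (cone h) \<in> carrier (chains 0)" "incl (chain_aug h) \<in> carrier (chains 0)"
    if "h \<in> carrier (chains 0)" for h
    using mod_hom_closed[OF chain_bd_hom cone_closed[OF that]] incl_aug(1)[OF mod_hom_closed[OF chain_aug_hom that]]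
    by auto
  have "chain_bd 0 (cone (f \<oplus>\<^bsub>chains 0\<^esub> g)) \<oplus>\<^bsub>chains 0\<^esub> incl (chain_aug (f \<oplus>\<^bsub>chains 0\<^esub> g))
    = (chain_bd 0 (cone f) \<oplus>\<^bsub>chains 0\<^esub> incl (chain_aug f)) \<oplus>\<^bsub>chains 0\<^esub>
      (chain_bd 0 (cone g) \<oplus>\<^bsub>chains 0\<^esub> incl (chain_aug g))"
    using add(1,2) c[OF add(1)] c[OF add(2)]
    by (simp add: cone_add mod_hom_add[OF chain_bd_hom] mod_hom_add[OF chain_aug_hom] incl_add
        cone_closed C.M.a_ac)
  then show ?case using add by simp
next
  case (single k s gs)
  interpret C: left_module R "chains 0" by (rule chains_left_module)
  have gs: "gs = []" using single by (simp add: tuples_0)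
  let ?t = "s \<cdot> iv s" and ?g = "deg s"
  note r = range_deg[OF single(2)]
  have g: "[?g] \<in> tuples G (Suc 0)" using r by (simp add: tuples_def)
  have tc: "?t \<in> carrier SG" using r by simp
  have absorb: "?t \<cdot> exel_es G [?g] = ?t" using exel_es_range_deg[OF single(2), of "[]"] single gs by simp
  have m: "mult_list G [?g] = ?g" using r by (simp add: mult_list_def)
  have c: "single k s [] \<in> carrier (chains 0)" "single k ?t [] \<in> carrier (chains 0)"
    using single_closed[OF single(1,2), of "[]" 0] single_closed[OF single(1) tc, of "[]" 0] single(2) tc
    by (simp_all add: tuples_0 exel_es_Nil)
  have "chain_bd 0 (cone (single k s gs)) = single k s [] \<ominus>\<^bsub>chains 0\<^esub> single k ?t []"
    unfolding gs cone_single[OF single(2)] chain_bd_single[OF single(1) tc g absorb]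
    using c by (simp add: face_coeff_def face_def alternate_def r m a_minus_def atMost_Suc C.M.a_comm)
  then show ?case
    unfolding gs chain_aug_single[OF single(1,2)] incl_mono using c
    by (simp add: C.M.minus_eq C.M.a_assoc C.M.l_neg)
qed

text \<open>The zeroth face of a cone is the original simplex, and face \<open>i + 1\<close> of the
  cone is the cone on face \<open>i\<close>. The shift of the index reverses the signs, so all terms
  but the zeroth cancel.\<close>

lemma cone_homotopy_Suc:
  assumes "f \<in> carrier (chains (Suc n))"
  shows "chain_bd (Suc n) (cone f) \<oplus>\<^bsub>chains (Suc n)\<^esub> cone (chain_bd n f) = f"
  using assms
proof (induction rule: chains_induct)
  case zero
  interpret C: left_module R "chains (Suc n)" by (rule chains_left_module)
  show ?case
    by (simp add: cone_zero mod_hom_zero[OF chains_left_module chains_left_module chain_bd_hom])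
next
  case (add f g)
  interpret C: left_module R "chains (Suc n)" by (rule chains_left_module)
  have c: "chain_bd (Suc n) (cone h) \<in> carrier (chains (Suc n))" "cone (chain_bd n h) \<in> carrier (chains (Suc n))"
    if "h \<in> carrier (chains (Suc n))" for h
    using mod_hom_closed[OF chain_bd_hom cone_closed[OF that]] cone_closed[OF mod_hom_closed[OF chain_bd_hom that]]
    by auto
  have "chain_bd (Suc n) (cone (f \<oplus>\<^bsub>chains (Suc n)\<^esub> g)) \<oplus>\<^bsub>chains (Suc n)\<^esub> cone (chain_bd n (f \<oplus>\<^bsub>chains (Suc n)\<^esub> g))
    = (chain_bd (Suc n) (cone f) \<oplus>\<^bsub>chains (Suc n)\<^esub> cone (chain_bd n f)) \<oplus>\<^bsub>chains (Suc n)\<^esub>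
      (chain_bd (Suc n) (cone g) \<oplus>\<^bsub>chains (Suc n)\<^esub> cone (chain_bd n g))"
    using add(1,2) c[OF add(1)] c[OF add(2)]
    by (simp add: cone_add mod_hom_add[OF chain_bd_hom] cone_closed C.M.a_ac)
  then show ?case using add by simp
next
  case (single k s gs)
  interpret C: left_module R "chains (Suc n)" by (rule chains_left_module)
  interpret cone: abelian_group_hom "chains n" "chains (Suc n)" cone by (rule cone_hom)
  let ?t = "s \<cdot> iv s" and ?g = "deg s"
  note r = range_deg[OF single(2)] and gs_simps = tuples_SucD[OF single(3)]
  have ne: "gs \<noteq> []" using gs_simps(2) by auto
  have g: "?g # gs \<in> tuples G (Suc (Suc n))" using r single(3) by (simp add: tuples_def)
  have tc: "?t \<in> carrier SG" using r by simp
  have absorb: "?t \<cdot> exel_es G (?g # gs) = ?t" by (rule exel_es_range_deg[OF single(2,4) gs_simps(1)])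
  \<comment> \<open>The common value of the cone on face \<open>i\<close> and of face
    \<open>i + 1\<close> of the cone. For \<open>i = 0\<close>, merging \<open>deg s\<close> with
    the first entry of \<open>gs\<close> matches the degree of \<open>s\<close> times that
    entry.\<close>
  let ?f = "\<lambda>i. single k ?t (face (Suc i) (?g # gs))"
  have face: "cone (single k (s \<cdot> face_coeff i gs) (face i gs)) = ?f i"
    "single k (s \<cdot> face_coeff i gs) (face i gs) \<in> carrier (chains n)" if i: "i \<le> Suc n" for i
  proof -
    note c = face_coeff_closed[OF single(3), of i]
    have sc: "s \<cdot> face_coeff i gs \<in> carrier SG" using c single(2) by simp
    show "single k (s \<cdot> face_coeff i gs) (face i gs) \<in> carrier (chains n)"
      by (rule single_closed[OF single(1) sc face_closed[OF single(3) i] exel_es_face[OF single(3,2,4) i]])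
    show "cone (single k (s \<cdot> face_coeff i gs) (face i gs)) = ?f i"
    proof (cases "i = 0")
      case True
      have "hd gs \<in> partial_products gs"
        using partial_products_Cons[OF gs_simps(4), of "tl gs"] gs_simps(3) by auto
      then have "s \<cdot> e (hd gs) = s"
        using exel_es_absorb[OF gs_simps(1) single(2)] single(4) by blast
      then show ?thesis
        using cone_single[OF sc] range_deg_sy[OF single(2) gs_simps(4)] True gs_simps(6)
        by (simp add: face_Suc_Cons(1)[OF ne] face_coeff_def)
    next
      case False
      then have "s \<cdot> face_coeff i gs = s"
        using exel_es_face_coeff[OF single(3,2,4)] i by simp
      then show ?thesis
        using cone_single[OF single(2)] False by (simp add: face_Suc_Cons(2)[OF ne])
    qed
  qed
  have fc: "?f i \<in> carrier (chains (Suc n))" if "i \<le> Suc n" for i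
    unfolding face(1)[OF that, symmetric] by (rule cone_closed[OF face(2)[OF that]])
  define T where "T = (\<Oplus>\<^bsub>chains (Suc n)\<^esub>i\<in>{..Suc n}. alternate (chains (Suc n)) i (?f i))"
  have T: "T \<in> carrier (chains (Suc n))"
    unfolding T_def by (rule C.M.finsum_closed) (use fc in auto)
  have sc: "single k s gs \<in> carrier (chains (Suc n))" by (rule single_closed[OF single])
  have "cone (chain_bd n (single k s gs)) =
      (\<Oplus>\<^bsub>chains (Suc n)\<^esub>i\<in>{..Suc n}. cone (alternate (chains n) i (single k (s \<cdot> face_coeff i gs) (face i gs))))"
    unfolding chain_bd_single[OF single] by (rule cone.additive_finsum) (use face(2) cone.G.alternate_closed in auto)
  also have "\<dots> = T"
    unfolding T_def by (rule C.M.finsum_cong') (use fc face in \<open>auto simp: cone.hom_alternate\<close>)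
  finally have 1: "cone (chain_bd n (single k s gs)) = T" .
  let ?a = "\<lambda>i. alternate (chains (Suc n)) i (single k (?t \<cdot> face_coeff i (?g # gs)) (face i (?g # gs)))"
  have a0: "?a 0 = single k s gs" by (simp add: alternate_def face_coeff_def face_def r)
  have aS: "?a (Suc i) = \<ominus>\<^bsub>chains (Suc n)\<^esub> alternate (chains (Suc n)) i (?f i)" if "i \<le> Suc n" for i
    using exel_es_face_coeff[OF g tc absorb, of "Suc i"] that fc[OF that] by (simp add: C.M.alternate_Suc)
  have idx: "{..Suc (Suc n)} = insert 0 (Suc ` {..Suc n})"
    by (rule atMost_Suc_eq_insert_0)
  have "chain_bd (Suc n) (cone (single k s gs)) = (\<Oplus>\<^bsub>chains (Suc n)\<^esub>i\<in>{..Suc (Suc n)}. ?a i)"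
    unfolding cone_single[OF single(2)] by (rule chain_bd_single[OF single(1) tc g absorb])
  also have "\<dots> = ?a 0 \<oplus>\<^bsub>chains (Suc n)\<^esub> (\<Oplus>\<^bsub>chains (Suc n)\<^esub>i\<in>Suc ` {..Suc n}. ?a i)"
    unfolding idx using a0 sc aS fc by (intro C.M.finsum_insert) auto
  also have "(\<Oplus>\<^bsub>chains (Suc n)\<^esub>i\<in>Suc ` {..Suc n}. ?a i) = (\<Oplus>\<^bsub>chains (Suc n)\<^esub>i\<in>{..Suc n}. ?a (Suc i))"
    by (rule C.M.finsum_reindex) (use aS fc in auto)
  also have "\<dots> = (\<Oplus>\<^bsub>chains (Suc n)\<^esub>i\<in>{..Suc n}. \<ominus>\<^bsub>chains (Suc n)\<^esub> alternate (chains (Suc n)) i (?f i))"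
    by (rule C.M.finsum_cong') (use aS fc in auto)
  also have "\<dots> = \<ominus>\<^bsub>chains (Suc n)\<^esub> T"
    unfolding T_def by (rule C.M.finsum_minus) (use fc in auto)
  finally show ?case unfolding 1 a0 using T sc by (simp add: C.M.a_assoc C.M.l_neg)
qed

text \<open>A generator has degree 1, so its first vertex is already the apex: it is the cone on the
  simplex obtained by deleting that vertex, which is \<open>exel_es G gs\<close> times the symbol of
  \<open>hd gs\<close>, placed at \<open>tl gs\<close>.\<close>

lemma gen_cone:
  assumes "gs \<in> tuples G (Suc n)"
  obtains f where "f \<in> carrier (chains n)" "cone f = gen gs"
proof -
  note gs_simps = tuples_SucD[OF assms]
  let ?p = "exel_es G gs" and ?g = "hd gs"
  have p: "?p \<in> Pe" "?p \<in> carrier SG" "?p \<cdot> ?p = ?p" using exel_es_Pe[OF gs_simps(1)] Pe_idem by auto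
  have "?g \<in> partial_products gs"
    using partial_products_Cons[OF gs_simps(4), of "tl gs"] gs_simps(3) by auto
  then have pg: "?p \<cdot> e ?g = ?p" using exel_es_absorb[OF gs_simps(1) p(2)] p(3) by blast
  let ?s = "?p \<cdot> sy ?g"
  have s: "?s \<in> carrier SG" "?s \<cdot> exel_es G (tl gs) = ?s"
    using exel_es_face[OF assms p(2,3), of 0] p gs_simps by (auto simp: face_coeff_def face_def)
  have tl: "tl gs \<in> tuples G n" using assms gs_simps by (auto simp: tuples_def)
  have "cone (single \<one>\<^bsub>K\<^esub> ?s (tl gs)) = single \<one>\<^bsub>K\<^esub> ?p gs"
    unfolding cone_single[OF s(1)] range_deg_inverse[OF p(1) gs_simps(4) pg] using gs_simps(3) by simp
  also have "\<dots> = gen gs" by (auto simp: single_def proj_gen_def idem_def monomial_one)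
  finally show ?thesis
    by (rule that[rotated]) (rule single_closed[OF K.one_closed s(1) tl s(2)])
qed

text \<open>By the homotopy identity, \<open>d d h = d - d h d = d - (1 - h d) d = h d d\<close>; as the image of \<open>h\<close> generates,
  \<open>d d = 0\<close> follows by induction.\<close>

lemma chain_aug_bd: "f \<in> carrier (chains (Suc 0)) \<Longrightarrow> chain_aug (chain_bd 0 f) = \<zero>\<^bsub>B\<^esub>"
proof -
  interpret B: left_module R B by (rule B_left_module)
  have *: "chain_aug (chain_bd 0 (cone f)) = \<zero>\<^bsub>B\<^esub>" if f: "f \<in> carrier (chains 0)" for f
  proof -
    note b = mod_hom_closed[OF chain_aug_hom f] and c = mod_hom_closed[OF chain_bd_hom cone_closed[OF f]]
    have "chain_aug (chain_bd 0 (cone f)) \<oplus>\<^bsub>B\<^esub> chain_aug f = chain_aug f"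
      using cone_homotopy_0[OF f] mod_hom_add[OF chain_aug_hom c incl_aug(1)[OF b]] incl_aug(2)[OF b] by simp
    then show ?thesis using b mod_hom_closed[OF chain_aug_hom c] by (simp add: B.M.add.l_cancel_one)
  qed
  have z: "(\<lambda>f. \<zero>\<^bsub>B\<^esub>) \<in> mod_hom R (chains (Suc 0)) B"
    by (rule mod_homI) (auto simp: smult_r_null'[OF B_left_module])
  show "chain_aug (chain_bd 0 f) = \<zero>\<^bsub>B\<^esub>" if "f \<in> carrier (chains (Suc 0))"
    by (rule idempotent_family.proj_hom_eqI[OF idem_family B_left_module
        mod_hom_compose[OF chain_bd_hom chain_aug_hom] z that]) (metis gen_cone *)
qed

lemma chain_bd_bd: "f \<in> carrier (chains (Suc (Suc n))) \<Longrightarrow> chain_bd n (chain_bd (Suc n) f) = \<zero>\<^bsub>chains n\<^esub>"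
proof (induction n arbitrary: f)
  \<comment> \<open>The assumption \<open>d h d = d\<close> is the vanishing of \<open>d d\<close>
    (for \<open>n = 0\<close>, of the augmentation after \<open>d\<close>) one degree lower, read
    through the homotopy identity.\<close>
  have step: "chain_bd n (chain_bd (Suc n) f) = \<zero>\<^bsub>chains n\<^esub>"
    if f: "f \<in> carrier (chains (Suc (Suc n)))"
      and IH: "\<And>f. f \<in> carrier (chains (Suc n)) \<Longrightarrow> chain_bd n (cone (chain_bd n f)) = chain_bd n f" for n f
  proof -
    interpret C: left_module R "chains n" by (rule chains_left_module)
    have *: "chain_bd n (chain_bd (Suc n) (cone f)) = \<zero>\<^bsub>chains n\<^esub>" if f: "f \<in> carrier (chains (Suc n))" for f
    proof -
      note b = mod_hom_closed[OF chain_bd_hom f] and c = mod_hom_closed[OF chain_bd_hom cone_closed[OF f]]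
      have "chain_bd n (chain_bd (Suc n) (cone f)) \<oplus>\<^bsub>chains n\<^esub> chain_bd n f = chain_bd n f"
        using cone_homotopy_Suc[OF f] mod_hom_add[OF chain_bd_hom c cone_closed[OF b]] IH[OF f] by simp
      then show ?thesis using b mod_hom_closed[OF chain_bd_hom c] by (simp add: C.M.add.l_cancel_one)
    qed
    have z: "(\<lambda>f. \<zero>\<^bsub>chains n\<^esub>) \<in> mod_hom R (chains (Suc (Suc n))) (chains n)"
      by (rule mod_homI) (auto simp: smult_r_null'[OF chains_left_module])
    show ?thesis
      by (rule idempotent_family.proj_hom_eqI[OF idem_family chains_left_module
          mod_hom_compose[OF chain_bd_hom chain_bd_hom] z f]) (metis gen_cone *)
  qed
  {
    case 0
    have "chain_bd 0 (cone (chain_bd 0 g)) = chain_bd 0 g" if g: "g \<in> carrier (chains (Suc 0))" for g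
    proof -
      interpret C: left_module R "chains 0" by (rule chains_left_module)
      note b = mod_hom_closed[OF chain_bd_hom g]
      show ?thesis
        using cone_homotopy_0[OF b] mod_hom_closed[OF chain_bd_hom cone_closed[OF b]]
        by (simp add: chain_aug_bd[OF g] incl_zero)
    qed
    then show ?case using step[OF 0] by blast
  next
    case (Suc n)
    have "chain_bd (Suc n) (cone (chain_bd (Suc n) g)) = chain_bd (Suc n) g"
      if g: "g \<in> carrier (chains (Suc (Suc n)))" for g
    proof -
      interpret C: left_module R "chains (Suc n)" by (rule chains_left_module)
      note b = mod_hom_closed[OF chain_bd_hom g]
      show ?thesis
        using cone_homotopy_Suc[OF b] mod_hom_closed[OF chain_bd_hom cone_closed[OF b]]
        by (simp add: Suc.IH[OF g] cone_zero)
    qed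
    then show ?case using step[OF Suc.prems] by blast
  }
qed

text \<open>A cycle \<open>f\<close> is the boundary of \<open>cone f\<close>, and
  \<open>incl\<close> provides preimages under the augmentation. Exactness compares sets, so an
  additive contraction is enough.\<close>

theorem chains_resolution: "proj_resolution R (tuples G) (\<lambda>n. idem) chain_bd B chain_aug"
proof (rule proj_resolution.intro)
  show "chain_aug ` carrier (chains 0) = carrier B"
    using mod_hom_closed[OF chain_aug_hom] incl_aug by (force simp: image_iff)
  show "chain_bd 0 ` carrier (chains 1) = {f \<in> carrier (chains 0). chain_aug f = \<zero>\<^bsub>B\<^esub>}"
  proof (intro equalityI subsetI)
    fix f assume f: "f \<in> {f \<in> carrier (chains 0). chain_aug f = \<zero>\<^bsub>B\<^esub>}"
    interpret C: left_module R "chains 0" by (rule chains_left_module)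
    have "chain_bd 0 (cone f) = f"
      using cone_homotopy_0[of f] f mod_hom_closed[OF chain_bd_hom cone_closed[of f 0]] by (simp add: incl_zero)
    then show "f \<in> chain_bd 0 ` carrier (chains 1)" using cone_closed[of f 0] f by (auto intro: image_eqI[of _ _ "cone f"])
  qed (use chain_aug_bd mod_hom_closed[OF chain_bd_hom] in auto)
  show "chain_bd (Suc n) ` carrier (chains (Suc (Suc n))) =
      {f \<in> carrier (chains (Suc n)). chain_bd n f = \<zero>\<^bsub>chains n\<^esub>}" for n
  proof (intro equalityI subsetI)
    fix f assume f: "f \<in> {f \<in> carrier (chains (Suc n)). chain_bd n f = \<zero>\<^bsub>chains n\<^esub>}"
    interpret C: left_module R "chains (Suc n)" by (rule chains_left_module)
    have "chain_bd (Suc n) (cone f) = f"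
      using cone_homotopy_Suc[of f n] f mod_hom_closed[OF chain_bd_hom cone_closed[of f "Suc n"]]
      by (simp add: cone_zero)
    then show "f \<in> chain_bd (Suc n) ` carrier (chains (Suc (Suc n)))"
      using cone_closed[of f "Suc n"] f by (auto intro: image_eqI[of _ _ "cone f"])
  qed (use chain_bd_bd mod_hom_closed[OF chain_bd_hom] in auto)
qed (use B_left_module idem_family chain_bd_hom chain_aug_hom in auto)

section \<open>Cochain complexes\<close>

context
  fixes M :: "('g list set \<Rightarrow> 'k, 'm, 'z) module_scheme"
  assumes M: "left_module R M"
begin

interpretation M: left_module R M by (rule M)

section \<open>Hom modules over \<open>K\<close>\<close>

lemma hom_module_simps:
  "f \<in> carrier (hom_module R L M) \<longleftrightarrow> f \<in> mod_hom R L M \<and> f \<in> extensional (carrier L)"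
  "\<zero>\<^bsub>hom_module R L M\<^esub> = (\<lambda>x\<in>carrier L. \<zero>\<^bsub>M\<^esub>)"
  "f \<oplus>\<^bsub>hom_module R L M\<^esub> g = (\<lambda>x\<in>carrier L. f x \<oplus>\<^bsub>M\<^esub> g x)"
  "k \<odot>\<^bsub>hom_module R L M\<^esub> f = (\<lambda>x\<in>carrier L. scalar k \<odot>\<^bsub>M\<^esub> f x)"
  by (simp_all add: hom_module_def map_module_def restrict_scalars_simps)

lemma restrict_mod_hom:
  assumes L: "left_module R L" and h: "h \<in> mod_hom R L M"
  shows "restrict h (carrier L) \<in> carrier (hom_module R L M)"
proof -
  interpret L: left_module R L by (rule L)
  show ?thesis
    unfolding hom_module_simps
    by (auto intro!: mod_homI
        simp: mod_hom_closed[OF h] mod_hom_add[OF h] mod_hom_smult[OF h] L.smult_closed)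
qed

lemma hom_module_left_module:
  assumes L: "left_module R L" shows "left_module K (hom_module R L M)"
proof -
  interpret L: left_module R L by (rule L)
  interpret MK: left_module K "restrict_scalars R M" by (rule restrict_scalars_left_module[OF M])
  show ?thesis
    unfolding hom_module_def
  proof (rule MK.map_module_submodule; unfold restrict_scalars_simps)
    show "(\<lambda>x\<in>carrier L. \<zero>\<^bsub>M\<^esub>) \<in> mod_hom R L M"
      by (rule mod_homI) (auto simp: L.smult_closed smult_r_null'[OF M])
    show "(\<lambda>x\<in>carrier L. f x \<oplus>\<^bsub>M\<^esub> g x) \<in> mod_hom R L M"
      if fg: "f \<in> mod_hom R L M" "g \<in> mod_hom R L M" for f g
      by (rule mod_homI)
        (auto simp: mod_hom_closed[OF fg(1)] mod_hom_closed[OF fg(2)] mod_hom_add[OF fg(1)]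
          mod_hom_add[OF fg(2)] mod_hom_smult[OF fg(1)] mod_hom_smult[OF fg(2)] L.smult_closed
          M.smult_r_distr M.M.a_ac)
    show "(\<lambda>x\<in>carrier L. scalar k \<odot>\<^bsub>M\<^esub> f x) \<in> mod_hom R L M"
      if k: "k \<in> carrier K" and f: "f \<in> mod_hom R L M" for k f
      by (rule mod_homI)
        (auto simp: mod_hom_closed[OF f] mod_hom_add[OF f] mod_hom_smult[OF f] L.smult_closed
          scalar_closed[OF k] scalar_central[OF k] M.smult_closed M.smult_r_distr
          simp flip: M.smult_assoc1)
  qed (rule mod_hom_closed)
qed

lemma hom_precompose:
  assumes L: "left_module R L" and L': "left_module R L'" and d: "d \<in> mod_hom R L' L"
  shows "(\<lambda>f. \<lambda>x\<in>carrier L'. f (d x)) \<in> mod_hom K (hom_module R L M) (hom_module R L' M)"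
proof (rule mod_homI)
  show "(\<lambda>x\<in>carrier L'. f (d x)) \<in> carrier (hom_module R L' M)" if "f \<in> carrier (hom_module R L M)" for f
    using restrict_mod_hom[OF L' mod_hom_compose[OF d, of f]] that by (simp add: hom_module_simps)
qed (auto simp: hom_module_simps mod_hom_closed[OF d] restrict_def)

section \<open>The complex of partial cochains\<close>

abbreviation "C n \<equiv> par_cochains K G M n"

lemma C_simps:
  "f \<in> carrier (C n) \<longleftrightarrow> f \<in> extensional (tuples G n) \<and>
    (\<forall>gs\<in>tuples G n. f gs \<in> carrier M \<and> sg_act K M (exel_es G gs) (f gs) = f gs)"
  "\<zero>\<^bsub>C n\<^esub> = (\<lambda>gs\<in>tuples G n. \<zero>\<^bsub>M\<^esub>)"
  "f \<oplus>\<^bsub>C n\<^esub> g = (\<lambda>gs\<in>tuples G n. f gs \<oplus>\<^bsub>M\<^esub> g gs)"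
  "k \<odot>\<^bsub>C n\<^esub> f = (\<lambda>gs\<in>tuples G n. scalar k \<odot>\<^bsub>M\<^esub> f gs)"
proof -
  have "x \<in> sg_act K M (exel_es G gs) ` carrier M \<longleftrightarrow> x \<in> carrier M \<and> sg_act K M (exel_es G gs) x = x"
    if "gs \<in> tuples G n" for x gs
  proof -
    note p = exel_es_Pe[OF tuples_set[OF that]]
    show ?thesis
      using act_image_iff[OF M p, of x] act_closed[OF M es_closed[OF that]] by auto
  qed
  then show "f \<in> carrier (C n) \<longleftrightarrow> f \<in> extensional (tuples G n) \<and>
    (\<forall>gs\<in>tuples G n. f gs \<in> carrier M \<and> sg_act K M (exel_es G gs) (f gs) = f gs)"
    by (auto simp: par_cochains_def map_module_def)
qed (simp_all add: par_cochains_def map_module_def restrict_scalars_simps)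

lemma C_left_module: "left_module K (C n)"
proof -
  interpret MK: left_module K "restrict_scalars R M" by (rule restrict_scalars_left_module[OF M])
  interpret L: left_module K "map_module (tuples G n) (tuples G n \<rightarrow> carrier (restrict_scalars R M)) (restrict_scalars R M)"
    by (rule MK.map_module_left_module)
  have eq: "C n = submodule_of (map_module (tuples G n) (tuples G n \<rightarrow> carrier (restrict_scalars R M)) (restrict_scalars R M)) (carrier (C n))"
    unfolding par_cochains_def by (subst MK.map_module_eq_submodule_of) (simp add: map_module_def submodule_of_def)
  have z: "sg_act K M (exel_es G gs) \<zero>\<^bsub>M\<^esub> = \<zero>\<^bsub>M\<^esub>" if "gs \<in> tuples G n" for gs
    using abelian_group_hom.hom_zero[OF act_hom[OF M es_closed[OF that]]] .
  show ?thesis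
    by (subst eq, rule L.submodule_of_left_module, rule L.left_submoduleI)
      (auto simp: C_simps map_module_def restrict_scalars_simps z act_add[OF M es_closed]
        act_scalar[OF M es_closed] M.smult_closed[OF scalar_closed])
qed

lemma par_delta_cong:
  assumes "\<And>gs. gs \<in> tuples G n \<Longrightarrow> f gs \<in> carrier M" "\<And>gs. gs \<in> tuples G n \<Longrightarrow> f gs = f' gs"
    and gs: "gs \<in> tuples G (Suc n)"
  shows "par_delta K G M n f gs = par_delta K G M n f' gs"
proof -
  have f': "f' gs \<in> carrier M" if "gs \<in> tuples G n" for gs using assms(1,2)[OF that] by simp
  have "par_delta K G M n f gs =
      (\<Oplus>\<^bsub>M\<^esub>i\<in>{..Suc n}. alternate M i (sg_act K M (face_coeff i gs) (f (face i gs))))"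
    by (rule par_delta_faces[OF M _ gs]) (rule assms(1))
  also have "\<dots> = (\<Oplus>\<^bsub>M\<^esub>i\<in>{..Suc n}. alternate M i (sg_act K M (face_coeff i gs) (f' (face i gs))))"
  proof (rule M.M.finsum_cong')
    show "alternate M i (sg_act K M (face_coeff i gs) (f (face i gs))) =
        alternate M i (sg_act K M (face_coeff i gs) (f' (face i gs)))" if "i \<in> {..Suc n}" for i
      using assms(2)[OF face_closed[OF gs, of i]] that by simp
  qed (use f' face_closed[OF gs] face_coeff_closed[OF gs] in \<open>auto simp: act_closed[OF M]\<close>)
  also have "\<dots> = par_delta K G M n f' gs"
    by (rule par_delta_faces[OF M _ gs, symmetric]) (rule f')
  finally show ?thesis .
qed

lemma par_delta_mod_hom: "par_delta K G M n \<in> mod_hom K (C n) (C (Suc n))"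
proof (rule mod_homI)
  have x: "par_delta K G M n f \<in> extensional (tuples G (Suc n))" for f by (simp add: par_delta_def)
  have c: "f gs \<in> carrier M" if "f \<in> carrier (C n)" "gs \<in> tuples G n" for f gs
    using that by (simp add: C_simps)
  show cl: "par_delta K G M n f \<in> carrier (C (Suc n))" if f: "f \<in> carrier (C n)" for f
    unfolding C_simps(1)
    using x par_delta_closed[OF M c[OF f]] par_delta_fixed[OF M c[OF f]] f by (auto simp: C_simps(1))
  have t: "sg_act K M (face_coeff i gs) (f (face i gs)) \<in> carrier M"
    if "f \<in> carrier (C n)" "gs \<in> tuples G (Suc n)" "i \<le> Suc n" for f gs i
    using c[OF that(1) face_closed[OF that(2,3)]] face_coeff_closed[OF that(2)] by (simp add: act_closed[OF M])
  have faces: "par_delta K G M n f gs =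
      (\<Oplus>\<^bsub>M\<^esub>i\<in>{..Suc n}. alternate M i (sg_act K M (face_coeff i gs) (f (face i gs))))"
    if "f \<in> carrier (C n)" "gs \<in> tuples G (Suc n)" for f gs
    by (rule par_delta_faces[OF M _ that(2)]) (rule c[OF that(1)])
  show "par_delta K G M n (f \<oplus>\<^bsub>C n\<^esub> g) = par_delta K G M n f \<oplus>\<^bsub>C (Suc n)\<^esub> par_delta K G M n g"
    if f: "f \<in> carrier (C n)" and g: "g \<in> carrier (C n)" for f g
  proof (rule extensionalityI[OF x])
    show "par_delta K G M n f \<oplus>\<^bsub>C (Suc n)\<^esub> par_delta K G M n g \<in> extensional (tuples G (Suc n))"
      by (simp add: C_simps)
    fix gs assume gs: "gs \<in> tuples G (Suc n)"
    interpret Cn: left_module K "C n" by (rule C_left_module)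
    note fg = Cn.M.a_closed[OF f g]
    let ?t = "\<lambda>f i. alternate M i (sg_act K M (face_coeff i gs) (f (face i gs)))"
    have "(\<Oplus>\<^bsub>M\<^esub>i\<in>{..Suc n}. ?t (f \<oplus>\<^bsub>C n\<^esub> g) i) = (\<Oplus>\<^bsub>M\<^esub>i\<in>{..Suc n}. ?t f i \<oplus>\<^bsub>M\<^esub> ?t g i)"
      by (rule M.M.finsum_cong')
        (use t[OF f gs] t[OF g gs] c[OF f] c[OF g] face_closed[OF gs] face_coeff_closed[OF gs]
          in \<open>auto simp: C_simps act_add[OF M] M.M.alternate_add\<close>)
    also have "\<dots> = (\<Oplus>\<^bsub>M\<^esub>i\<in>{..Suc n}. ?t f i) \<oplus>\<^bsub>M\<^esub> (\<Oplus>\<^bsub>M\<^esub>i\<in>{..Suc n}. ?t g i)"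
      by (rule M.M.finsum_addf) (use t[OF f gs] t[OF g gs] in auto)
    finally show "par_delta K G M n (f \<oplus>\<^bsub>C n\<^esub> g) gs =
        (par_delta K G M n f \<oplus>\<^bsub>C (Suc n)\<^esub> par_delta K G M n g) gs"
      unfolding faces[OF fg gs] using gs by (simp add: C_simps(3)[where n = "Suc n"] faces[OF f gs] faces[OF g gs])
  qed
  show "par_delta K G M n (k \<odot>\<^bsub>C n\<^esub> f) = k \<odot>\<^bsub>C (Suc n)\<^esub> par_delta K G M n f"
    if k: "k \<in> carrier K" and f: "f \<in> carrier (C n)" for k f
  proof (rule extensionalityI[OF x])
    show "k \<odot>\<^bsub>C (Suc n)\<^esub> par_delta K G M n f \<in> extensional (tuples G (Suc n))"
      by (simp add: C_simps)
    fix gs assume gs: "gs \<in> tuples G (Suc n)"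
    interpret Cn: left_module K "C n" by (rule C_left_module)
    interpret h: abelian_group_hom M M "\<lambda>x. scalar k \<odot>\<^bsub>M\<^esub> x"
      by (rule M.smult_abelian_group_hom[OF scalar_closed[OF k]])
    note kf = Cn.smult_closed[OF k f]
    let ?t = "\<lambda>f i. alternate M i (sg_act K M (face_coeff i gs) (f (face i gs)))"
    have "scalar k \<odot>\<^bsub>M\<^esub> (\<Oplus>\<^bsub>M\<^esub>i\<in>{..Suc n}. ?t f i) = (\<Oplus>\<^bsub>M\<^esub>i\<in>{..Suc n}. scalar k \<odot>\<^bsub>M\<^esub> ?t f i)"
      by (rule h.additive_finsum) (use t[OF f gs] in auto)
    also have "\<dots> = (\<Oplus>\<^bsub>M\<^esub>i\<in>{..Suc n}. ?t (k \<odot>\<^bsub>C n\<^esub> f) i)"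
      by (rule M.M.finsum_cong')
        (use t[OF f gs] t[OF kf gs] c[OF f] face_closed[OF gs] face_coeff_closed[OF gs] k
          in \<open>auto simp: C_simps act_scalar[OF M] h.hom_alternate\<close>)
    finally show "par_delta K G M n (k \<odot>\<^bsub>C n\<^esub> f) gs = (k \<odot>\<^bsub>C (Suc n)\<^esub> par_delta K G M n f) gs"
      unfolding faces[OF kf gs] using gs by (simp add: C_simps(4)[where n = "Suc n"] faces[OF f gs])
  qed
qed

text \<open>\<open>C 0\<close> consists of functions on the single tuple \<open>[]\<close>, whose
  idempotent is the identity, so it is a copy of \<open>M\<close>. Through this copy the degree-zero
  differential becomes an instance of the general one.\<close>

lemma par_delta0_eq:
  assumes "x \<in> carrier M"
  shows "par_delta0 K G M x = par_delta K G M 0 (\<lambda>gs\<in>tuples G 0. x)"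
proof (rule extensionalityI[of _ "tuples G 1"])
  fix gs assume gs: "gs \<in> tuples G 1"
  then obtain g where g: "gs = [g]" "g \<in> carrier G" by (auto simp: tuples_def length_Suc_conv)
  then show "par_delta0 K G M x gs = par_delta K G M 0 (\<lambda>gs\<in>tuples G 0. x) gs"
    using gs assms by (simp add: par_delta0_def par_delta_def tuples_0 mult_list_def alternate_def
        a_minus_def act_closed[OF M])
qed (simp_all add: par_delta0_def par_delta_def)

lemma C_0: "carrier (C 0) = (\<lambda>x. \<lambda>gs\<in>tuples G 0. x) ` carrier M"
proof (intro equalityI subsetI)
  fix f assume f: "f \<in> carrier (C 0)"
  then have "f = (\<lambda>gs\<in>tuples G 0. f [])" by (auto simp: C_simps tuples_0 extensional_def)
  then show "f \<in> (\<lambda>x. \<lambda>gs\<in>tuples G 0. x) ` carrier M" using f by (auto simp: C_simps tuples_0)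
qed (auto simp: C_simps tuples_0 exel_es_Nil act_one[OF M])

lemma par_B_Suc: "par_B K G M (Suc n) = par_delta K G M n ` carrier (C n)"
proof (cases n)
  case 0
  have "par_delta K G M 0 ` carrier (C 0) = par_delta0 K G M ` carrier M"
    unfolding C_0 image_image by (rule image_cong) (simp_all add: par_delta0_eq)
  then show ?thesis by (simp add: par_B_def 0)
qed (simp add: par_B_def)

section \<open>Cochains as homomorphisms out of the chains\<close>

definition cochain_lift :: "('g list \<Rightarrow> 'm) \<Rightarrow> ('g list \<Rightarrow> 'g list set \<Rightarrow> 'k) \<Rightarrow> 'm"
  where "cochain_lift c = free_lift R M c"

lemma cochain_lift_hom: "c \<in> carrier (C n) \<Longrightarrow> cochain_lift c \<in> mod_hom R (chains n) M"
  unfolding cochain_lift_def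
  by (rule idempotent_family.proj_lift_hom[OF idem_family M]) (auto simp: C_simps)

lemma cochain_lift_gen: "c \<in> carrier (C n) \<Longrightarrow> gs \<in> tuples G n \<Longrightarrow> cochain_lift c (gen gs) = c gs"
  unfolding cochain_lift_def
  by (rule idempotent_family.proj_lift_gen[OF idem_family M]) (auto simp: C_simps sg_act_def idem_def)

lemma hom_eq_cochain_lift:
  assumes "h \<in> mod_hom R (chains n) M" "f \<in> carrier (chains n)"
    "\<And>gs. gs \<in> tuples G n \<Longrightarrow> h (gen gs) = c gs"
  shows "h f = cochain_lift c f"
  unfolding cochain_lift_def
  by (rule idempotent_family.proj_hom_eq_lift[OF idem_family M assms(1,2)]) (rule assms(3))

text \<open>Naturality of \<open>par_delta\<close> applied to the universal cochain: precomposition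
  with the boundary corresponds to the cochain differential.\<close>

lemma hom_chain_bd:
  assumes h: "h \<in> mod_hom R (chains n) M" and gs: "gs \<in> tuples G (Suc n)"
    and c: "\<And>gs. gs \<in> tuples G n \<Longrightarrow> h (gen gs) = c gs"
  shows "h (chain_bd n (gen gs)) = par_delta K G M n c gs"
proof -
  have "h (chain_bd n (gen gs)) = par_delta K G M n (\<lambda>gs. h (gen gs)) gs"
    unfolding chain_bd_gen[OF gs] by (rule par_delta_hom[OF chains_left_module M h gen_closed gs])
  also have "\<dots> = par_delta K G M n c gs"
    by (rule par_delta_cong[OF _ c gs]) (auto intro: mod_hom_closed[OF h] gen_closed)
  finally show ?thesis .
qed

lemma cochain_lift_bd:
  assumes c: "c \<in> carrier (C n)" and f: "f \<in> carrier (chains (Suc n))"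
  shows "cochain_lift c (chain_bd n f) = cochain_lift (par_delta K G M n c) f"
  by (rule hom_eq_cochain_lift[OF mod_hom_compose[OF chain_bd_hom cochain_lift_hom[OF c]] f])
    (rule hom_chain_bd[OF cochain_lift_hom[OF c] _ cochain_lift_gen[OF c]])

lemma cochain_lift_zero:
  assumes "f \<in> carrier (chains n)"
  shows "cochain_lift \<zero>\<^bsub>C n\<^esub> f = \<zero>\<^bsub>M\<^esub>"
proof (rule hom_eq_cochain_lift[symmetric, OF _ assms])
  show "(\<lambda>f. \<zero>\<^bsub>M\<^esub>) \<in> mod_hom R (chains n) M"
    by (rule mod_homI) (auto simp: smult_r_null'[OF M])
qed (simp add: C_simps)

text \<open>No cancellation of terms is carried out: under lifting, this is the dual of the
  vanishing of \<open>chain_bd\<close> composed with itself.\<close>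

lemma par_delta_par_delta:
  assumes "c \<in> carrier (C n)"
  shows "par_delta K G M (Suc n) (par_delta K G M n c) = \<zero>\<^bsub>C (Suc (Suc n))\<^esub>"
proof (rule extensionalityI[of _ "tuples G (Suc (Suc n))"])
  fix gs assume gs: "gs \<in> tuples G (Suc (Suc n))"
  note dc = mod_hom_closed[OF par_delta_mod_hom assms]
  have "par_delta K G M (Suc n) (par_delta K G M n c) gs =
      cochain_lift (par_delta K G M n c) (chain_bd (Suc n) (gen gs))"
    by (rule hom_chain_bd[OF cochain_lift_hom[OF dc] gs cochain_lift_gen[OF dc], symmetric])
  also have "\<dots> = cochain_lift c (chain_bd n (chain_bd (Suc n) (gen gs)))"
    by (rule cochain_lift_bd[OF assms mod_hom_closed[OF chain_bd_hom gen_closed[OF gs]], symmetric])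
  also have "\<dots> = \<zero>\<^bsub>M\<^esub>"
    using chain_bd_bd[OF gen_closed[OF gs]] mod_hom_zero[OF chains_left_module M cochain_lift_hom[OF assms]]
    by simp
  finally show "par_delta K G M (Suc n) (par_delta K G M n c) gs = \<zero>\<^bsub>C (Suc (Suc n))\<^esub> gs"
    using gs by (simp add: C_simps)
qed (simp_all add: par_delta_def C_simps)

section \<open>The Ext complex and its comparison with the cochains\<close>

abbreviation "F \<equiv> res_mod R B"
abbreviation "H n \<equiv> hom_module R (F n) M"
abbreviation "cocycles n \<equiv> Ext_cocycles R B M n"
abbreviation "coboundaries n \<equiv> Ext_coboundaries R B M n"

lemma F_left_module: "left_module R (F n)"
  by (rule res_mod_left_module[OF R_ring])

lemma F_diff_hom: "res_diff R B n \<in> mod_hom R (F (Suc n)) (F n)"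
  by (rule res_diff_hom[OF R_ring])

lemma F_diff_diff:
  assumes "x \<in> carrier (F (Suc (Suc n)))"
  shows "res_diff R B n (res_diff R B (Suc n) x) = \<zero>\<^bsub>F n\<^esub>"
proof -
  have "res_diff R B (Suc n) x \<in> a_kernel (F (Suc n)) (F n) (res_diff R B n)"
    using res_exact[OF B_left_module, of "Suc n"] assms by auto
  then show ?thesis by (simp add: a_kernel_def')
qed

lemma Ext_diff_hom: "Ext_diff R B n \<in> mod_hom K (H n) (H (Suc n))"
  unfolding Ext_diff_def[abs_def] by (rule hom_precompose[OF F_left_module F_left_module F_diff_hom])

lemma cocycles_submodule: "submodule (cocycles n) K (H n)"
  unfolding Ext_cocycles_def
  by (rule kernel_submodule[OF hom_module_left_module[OF F_left_module]
        hom_module_left_module[OF F_left_module] Ext_diff_hom])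

lemma coboundaries_submodule: "submodule (coboundaries n) K (submodule_of (H n) (cocycles n))"
proof -
  interpret H: left_module K "H n" by (rule hom_module_left_module[OF F_left_module])
  have "submodule (coboundaries n) K (H n) \<and> coboundaries n \<subseteq> cocycles n"
  proof (cases n)
    case 0
    have "submodule {\<zero>\<^bsub>H n\<^esub>} K (H n)"
      by (rule H.left_submoduleI) (auto simp: smult_r_null'[OF H.left_module_axioms])
    moreover have "\<zero>\<^bsub>H n\<^esub> \<in> cocycles n"
      using H.left_submoduleD(2)[OF cocycles_submodule] .
    ultimately show ?thesis using 0 by simp
  next
    case (Suc k)
    have "Ext_diff R B (Suc k) (Ext_diff R B k f) = \<zero>\<^bsub>H (Suc (Suc k))\<^esub>" if f: "f \<in> carrier (H k)" for f
    proof (rule extensionalityI[of _ "carrier (F (Suc (Suc k)))"])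
      fix x assume x: "x \<in> carrier (F (Suc (Suc k)))"
      have "f \<zero>\<^bsub>F k\<^esub> = \<zero>\<^bsub>M\<^esub>"
        using mod_hom_zero[OF F_left_module M, of f k] f by (simp add: hom_module_simps)
      then show "Ext_diff R B (Suc k) (Ext_diff R B k f) x = \<zero>\<^bsub>H (Suc (Suc k))\<^esub> x"
        using x mod_hom_closed[OF F_diff_hom x]
        by (simp add: Ext_diff_def hom_module_simps F_diff_diff[OF x])
    qed (simp_all add: Ext_diff_def hom_module_simps)
    then show ?thesis
      using image_submodule[OF hom_module_left_module[OF F_left_module]
        hom_module_left_module[OF F_left_module] Ext_diff_hom, of k] mod_hom_closed[OF Ext_diff_hom, of _ k]
      by (auto simp: Suc Ext_cocycles_def)
  qed
  then show ?thesis
    by (intro submodule_in_submodule_of[OF H.left_module_axioms cocycles_submodule]) auto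
qed

lemma Z_submodule: "submodule (par_Z K G M n) K (C n)"
  unfolding par_Z_def by (rule kernel_submodule[OF C_left_module C_left_module par_delta_mod_hom])

lemma B_submodule: "submodule (par_B K G M (Suc n)) K (submodule_of (C (Suc n)) (par_Z K G M (Suc n)))"
proof (rule submodule_in_submodule_of[OF C_left_module Z_submodule])
  show "submodule (par_B K G M (Suc n)) K (C (Suc n))"
    unfolding par_B_Suc by (rule image_submodule[OF C_left_module C_left_module par_delta_mod_hom])
  show "par_B K G M (Suc n) \<subseteq> par_Z K G M (Suc n)"
    unfolding par_B_Suc par_Z_def using par_delta_par_delta mod_hom_closed[OF par_delta_mod_hom] by auto
qed

text \<open>Each composite of the two comparison maps lifts the identity of \<open>B\<close>, and so
  does the identity of the complex; hence the two are homotopic.\<close>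

lemma comparison:
  obtains \<alpha> \<beta> s t where
    "\<And>n. \<alpha> n \<in> mod_hom R (chains n) (F n)"
    "\<And>n x. x \<in> carrier (chains (Suc n)) \<Longrightarrow> res_diff R B n (\<alpha> (Suc n) x) = \<alpha> n (chain_bd n x)"
    "\<And>n. \<beta> n \<in> mod_hom R (F n) (chains n)"
    "\<And>n x. x \<in> carrier (F (Suc n)) \<Longrightarrow> chain_bd n (\<beta> (Suc n) x) = \<beta> n (res_diff R B n x)"
    "\<And>n. s n \<in> mod_hom R (chains n) (chains (Suc n))"
    "\<And>x. x \<in> carrier (chains 0) \<Longrightarrow> chain_bd 0 (s 0 x) = \<beta> 0 (\<alpha> 0 x) \<ominus>\<^bsub>chains 0\<^esub> x"
    "\<And>n x. x \<in> carrier (chains (Suc n)) \<Longrightarrow> chain_bd (Suc n) (s (Suc n) x) =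
      \<beta> (Suc n) (\<alpha> (Suc n) x) \<ominus>\<^bsub>chains (Suc n)\<^esub> x \<ominus>\<^bsub>chains (Suc n)\<^esub> s n (chain_bd n x)"
    "\<And>n. t n \<in> mod_hom R (F n) (F (Suc n))"
    "\<And>x. x \<in> carrier (F 0) \<Longrightarrow> res_diff R B 0 (t 0 x) = \<alpha> 0 (\<beta> 0 x) \<ominus>\<^bsub>F 0\<^esub> x"
    "\<And>n x. x \<in> carrier (F (Suc n)) \<Longrightarrow> res_diff R B (Suc n) (t (Suc n) x) =
      \<alpha> (Suc n) (\<beta> (Suc n) x) \<ominus>\<^bsub>F (Suc n)\<^esub> x \<ominus>\<^bsub>F (Suc n)\<^esub> t n (res_diff R B n x)"
proof -
  note P = chains_resolution and Q = res_proj_resolution[OF B_left_module]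
  have F: "proj_module R (res_basis R B n) (\<lambda>x. \<one>\<^bsub>R\<^esub>) = F n" for n
    unfolding res_mod_def by (rule proj_module_one[OF R_ring])
  obtain \<alpha> where \<alpha>: "\<And>n. \<alpha> n \<in> mod_hom R (chains n) (F n)"
    "\<And>x. x \<in> carrier (chains 0) \<Longrightarrow> res_aug R B (\<alpha> 0 x) = chain_aug x"
    "\<And>n x. x \<in> carrier (chains (Suc n)) \<Longrightarrow> res_diff R B n (\<alpha> (Suc n) x) = \<alpha> n (chain_bd n x)"
    using comparison_map[OF P Q] unfolding F by metis
  obtain \<beta> where \<beta>: "\<And>n. \<beta> n \<in> mod_hom R (F n) (chains n)"
    "\<And>x. x \<in> carrier (F 0) \<Longrightarrow> chain_aug (\<beta> 0 x) = res_aug R B x"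
    "\<And>n x. x \<in> carrier (F (Suc n)) \<Longrightarrow> chain_bd n (\<beta> (Suc n) x) = \<beta> n (res_diff R B n x)"
    using comparison_map[OF Q P] unfolding F by metis
  note \<alpha>c = mod_hom_closed[OF \<alpha>(1)] and \<beta>c = mod_hom_closed[OF \<beta>(1)]
  obtain s where s: "\<And>n. s n \<in> mod_hom R (chains n) (chains (Suc n))"
    "\<And>x. x \<in> carrier (chains 0) \<Longrightarrow> chain_bd 0 (s 0 x) = \<beta> 0 (\<alpha> 0 x) \<ominus>\<^bsub>chains 0\<^esub> x"
    "\<And>n x. x \<in> carrier (chains (Suc n)) \<Longrightarrow> chain_bd (Suc n) (s (Suc n) x) =
      \<beta> (Suc n) (\<alpha> (Suc n) x) \<ominus>\<^bsub>chains (Suc n)\<^esub> x \<ominus>\<^bsub>chains (Suc n)\<^esub> s n (chain_bd n x)"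
    by (rule comparison_homotopy[OF P P, of "\<lambda>n x. \<beta> n (\<alpha> n x)" "\<lambda>n x. x"])
      (auto simp: \<alpha> \<beta> \<alpha>c intro: mod_hom_compose[OF \<alpha>(1) \<beta>(1)] mod_hom_id)
  obtain t where t: "\<And>n. t n \<in> mod_hom R (F n) (F (Suc n))"
    "\<And>x. x \<in> carrier (F 0) \<Longrightarrow> res_diff R B 0 (t 0 x) = \<alpha> 0 (\<beta> 0 x) \<ominus>\<^bsub>F 0\<^esub> x"
    "\<And>n x. x \<in> carrier (F (Suc n)) \<Longrightarrow> res_diff R B (Suc n) (t (Suc n) x) =
      \<alpha> (Suc n) (\<beta> (Suc n) x) \<ominus>\<^bsub>F (Suc n)\<^esub> x \<ominus>\<^bsub>F (Suc n)\<^esub> t n (res_diff R B n x)"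
    by (rule comparison_homotopy[OF Q Q, of "\<lambda>n x. \<alpha> n (\<beta> n x)" "\<lambda>n x. x", unfolded F])
      (auto simp: \<alpha> \<beta> \<beta>c intro: mod_hom_compose[OF \<beta>(1) \<alpha>(1)] mod_hom_id)
  show ?thesis by (rule that[OF \<alpha>(1,3) \<beta>(1,3) s t])
qed

text \<open>Precomposition with \<open>a\<close>, followed by reading off the values on the
  generators. These values satisfy the cochain condition because \<open>exel_es G gs\<close> fixes
  the generator at \<open>gs\<close>.\<close>

lemma gen_pullback_hom:
  assumes \<alpha>: "a \<in> mod_hom R (chains n) (F n)"
  shows "(\<lambda>f. \<lambda>gs\<in>tuples G n. f (a (gen gs))) \<in> mod_hom K (H n) (C n)"
proof (rule mod_homI)
  note ac = mod_hom_closed[OF \<alpha> gen_closed]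
  show "(\<lambda>gs\<in>tuples G n. f (a (gen gs))) \<in> carrier (C n)" if "f \<in> carrier (H n)" for f
  proof -
    have f: "f \<in> mod_hom R (F n) M" using that by (simp add: hom_module_simps)
    note fa = mod_hom_compose[OF \<alpha> f]
    have "sg_act K M (exel_es G gs) (f (a (gen gs))) = f (a (gen gs))" if "gs \<in> tuples G n" for gs
      using mod_hom_act[OF fa es_closed[OF that] gen_closed[OF that]] act_gen[OF that] by simp
    then show ?thesis using mod_hom_closed[OF f ac] by (simp add: C_simps)
  qed
qed (auto simp: C_simps hom_module_simps mod_hom_closed[OF \<alpha> gen_closed] intro!: restrict_ext)

text \<open>The map \<open>\<Phi>\<close> induced by \<open>\<alpha>\<close> is the isomorphism on
  cohomology. The homotopy \<open>s\<close> on the chains gives surjectivity, with preimages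
  obtained from \<open>\<beta>\<close>; the homotopy \<open>t\<close> on the free resolution gives
  injectivity.\<close>

theorem Ext_cochains:
  "mod_isomorphic K (Ext R B M 0) (submodule_of (restrict_scalars R M) (par_Z0 K G M))"
  "mod_isomorphic K (Ext R B M (Suc l))
    (quot_module (submodule_of (C (Suc l)) (par_Z K G M (Suc l))) (par_B K G M (Suc l)))"
proof -
  obtain \<alpha> \<beta> s t where
    \<alpha>: "\<And>n. \<alpha> n \<in> mod_hom R (chains n) (F n)"
      "\<And>n x. x \<in> carrier (chains (Suc n)) \<Longrightarrow> res_diff R B n (\<alpha> (Suc n) x) = \<alpha> n (chain_bd n x)"
    and \<beta>: "\<And>n. \<beta> n \<in> mod_hom R (F n) (chains n)"
      "\<And>n x. x \<in> carrier (F (Suc n)) \<Longrightarrow> chain_bd n (\<beta> (Suc n) x) = \<beta> n (res_diff R B n x)"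
    and s: "\<And>n. s n \<in> mod_hom R (chains n) (chains (Suc n))"
      "\<And>x. x \<in> carrier (chains 0) \<Longrightarrow> chain_bd 0 (s 0 x) = \<beta> 0 (\<alpha> 0 x) \<ominus>\<^bsub>chains 0\<^esub> x"
      "\<And>n x. x \<in> carrier (chains (Suc n)) \<Longrightarrow> chain_bd (Suc n) (s (Suc n) x) =
        \<beta> (Suc n) (\<alpha> (Suc n) x) \<ominus>\<^bsub>chains (Suc n)\<^esub> x \<ominus>\<^bsub>chains (Suc n)\<^esub> s n (chain_bd n x)"
    and t: "\<And>n. t n \<in> mod_hom R (F n) (F (Suc n))"
      "\<And>x. x \<in> carrier (F 0) \<Longrightarrow> res_diff R B 0 (t 0 x) = \<alpha> 0 (\<beta> 0 x) \<ominus>\<^bsub>F 0\<^esub> x"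
      "\<And>n x. x \<in> carrier (F (Suc n)) \<Longrightarrow> res_diff R B (Suc n) (t (Suc n) x) =
        \<alpha> (Suc n) (\<beta> (Suc n) x) \<ominus>\<^bsub>F (Suc n)\<^esub> x \<ominus>\<^bsub>F (Suc n)\<^esub> t n (res_diff R B n x)"
    by (rule comparison) blast
  note \<alpha>c = mod_hom_closed[OF \<alpha>(1)] and \<beta>c = mod_hom_closed[OF \<beta>(1)]
    and sc = mod_hom_closed[OF s(1)] and tc = mod_hom_closed[OF t(1)]
    and bdc = mod_hom_closed[OF chain_bd_hom] and dc = mod_hom_closed[OF F_diff_hom]
  define \<Phi> :: "nat \<Rightarrow> ((('g list set \<Rightarrow> 'k, 'g list set \<Rightarrow> 'k) res_gen \<Rightarrow> 'g list set \<Rightarrow> 'k) \<Rightarrow> 'm) \<Rightarrow> 'g list \<Rightarrow> 'm"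
    where "\<Phi> = (\<lambda>n f. \<lambda>gs\<in>tuples G n. f (\<alpha> n (gen gs)))"
  have \<Phi>: "\<Phi> n \<in> mod_hom K (H n) (C n)" for n
    unfolding \<Phi>_def by (rule gen_pullback_hom[OF \<alpha>(1)])
  have Hh: "f \<in> mod_hom R (F n) M" if "f \<in> carrier (H n)" for f n
    using that by (simp add: hom_module_simps)
  have \<Phi>_lift: "f (\<alpha> n x) = cochain_lift (\<Phi> n f) x" if "f \<in> carrier (H n)" "x \<in> carrier (chains n)" for f n x
    by (rule hom_eq_cochain_lift[OF mod_hom_compose[OF \<alpha>(1) Hh[OF that(1)]] that(2)]) (simp add: \<Phi>_def)
  have \<Phi>_diff: "\<Phi> (Suc n) (Ext_diff R B n f) = par_delta K G M n (\<Phi> n f)" if f: "f \<in> carrier (H n)" for f n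
  proof (rule extensionalityI[of _ "tuples G (Suc n)"])
    fix gs assume gs: "gs \<in> tuples G (Suc n)"
    have "\<Phi> (Suc n) (Ext_diff R B n f) gs = f (\<alpha> n (chain_bd n (gen gs)))"
      using gs \<alpha>(2)[OF gen_closed[OF gs]] \<alpha>c[OF gen_closed[OF gs]] by (simp add: \<Phi>_def Ext_diff_def)
    also have "\<dots> = par_delta K G M n (\<Phi> n f) gs"
      by (rule hom_chain_bd[OF mod_hom_compose[OF \<alpha>(1) Hh[OF f]] gs]) (simp add: \<Phi>_def)
    finally show "\<Phi> (Suc n) (Ext_diff R B n f) gs = par_delta K G M n (\<Phi> n f) gs" .
  qed (simp_all add: \<Phi>_def par_delta_def)
  have cocycleD: "f \<in> carrier (H n)" "x \<in> carrier (F (Suc n)) \<Longrightarrow> f (res_diff R B n x) = \<zero>\<^bsub>M\<^esub>"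
    if "f \<in> cocycles n" for f n x
  proof -
    show "f \<in> carrier (H n)" using that by (simp add: Ext_cocycles_def)
    have "Ext_diff R B n f x = \<zero>\<^bsub>H (Suc n)\<^esub> x" using that by (simp add: Ext_cocycles_def)
    then show "f (res_diff R B n x) = \<zero>\<^bsub>M\<^esub>" if "x \<in> carrier (F (Suc n))"
      using that by (simp add: Ext_diff_def hom_module_simps)
  qed
  have \<Phi>_cocycle: "par_delta K G M n (\<Phi> n f) = \<zero>\<^bsub>C (Suc n)\<^esub>" if "f \<in> cocycles n" for f n
    using \<Phi>_diff[of f n] that mod_hom_zero[OF hom_module_left_module[OF F_left_module] C_left_module \<Phi>]
    by (simp add: Ext_cocycles_def)
  \<comment> \<open>The inverse up to coboundaries: a cochain is extended to the chains and pulled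
    back along \<open>\<beta>\<close>.\<close>
  define \<Psi> where "\<Psi> = (\<lambda>n c. \<lambda>x\<in>carrier (F n). cochain_lift c (\<beta> n x))"
  have \<Psi>: "\<Psi> n c \<in> cocycles n" if c: "c \<in> carrier (C n)" "par_delta K G M n c = \<zero>\<^bsub>C (Suc n)\<^esub>" for n c
  proof -
    have "\<Psi> n c \<in> carrier (H n)"
      unfolding \<Psi>_def
      by (rule restrict_mod_hom[OF F_left_module mod_hom_compose[OF \<beta>(1) cochain_lift_hom[OF c(1)]]])
    moreover have "\<Psi> n c (res_diff R B n x) = \<zero>\<^bsub>M\<^esub>" if x: "x \<in> carrier (F (Suc n))" for x
      using cochain_lift_bd[OF c(1) \<beta>c[OF x]] \<beta>(2)[OF x] cochain_lift_zero[OF \<beta>c[OF x]] c(2) dc[OF x]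
      by (simp add: \<Psi>_def)
    ultimately show ?thesis
      by (auto simp: Ext_cocycles_def Ext_diff_def hom_module_simps(2) intro!: restrict_ext)
  qed
  have lift_minus: "cochain_lift c (x \<ominus>\<^bsub>chains n\<^esub> y) = cochain_lift c x \<ominus>\<^bsub>M\<^esub> cochain_lift c y"
    if "c \<in> carrier (C n)" "x \<in> carrier (chains n)" "y \<in> carrier (chains n)" for c n x y
    by (rule mod_hom_diff[OF chains_left_module M cochain_lift_hom[OF that(1)] that(2,3)])
  have H_minus: "f (x \<ominus>\<^bsub>F n\<^esub> y) = f x \<ominus>\<^bsub>M\<^esub> f y"
    if "f \<in> carrier (H n)" "x \<in> carrier (F n)" "y \<in> carrier (F n)" for f n x y
    by (rule mod_hom_diff[OF F_left_module M Hh[OF that(1)] that(2,3)])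
  have lift_bd_zero: "cochain_lift c (chain_bd n x) = \<zero>\<^bsub>M\<^esub>"
    if "c \<in> carrier (C n)" "par_delta K G M n c = \<zero>\<^bsub>C (Suc n)\<^esub>" "x \<in> carrier (chains (Suc n))" for c n x
    using cochain_lift_bd[OF that(1,3)] cochain_lift_zero[OF that(3)] that(2) by simp
  have eq_of_diff: "x = y" if "x \<in> carrier M" "y \<in> carrier M" "x \<ominus>\<^bsub>M\<^esub> y = \<zero>\<^bsub>M\<^esub>" for x y
  proof -
    have "x = (x \<ominus>\<^bsub>M\<^esub> y) \<oplus>\<^bsub>M\<^esub> y" using that(1,2) by (simp add: M.M.minus_eq M.M.a_assoc M.M.l_neg)
    then show ?thesis using that by simp
  qed
  have add_of_diff: "x = y \<oplus>\<^bsub>M\<^esub> z" if "x \<in> carrier M" "y \<in> carrier M" "x \<ominus>\<^bsub>M\<^esub> y = z" for x y z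
    unfolding that(3)[symmetric] using that(1,2) M.M.a_lcomm[of y x "\<ominus>\<^bsub>M\<^esub> y"]
    by (simp add: M.M.minus_eq M.M.r_neg)
  have diff_of_diff: "y = x \<ominus>\<^bsub>M\<^esub> z" if "x \<in> carrier M" "y \<in> carrier M" "x \<ominus>\<^bsub>M\<^esub> y = z" for x y z
    unfolding that(3)[symmetric] using that(1,2) M.M.r_neg[OF that(1)]
    by (simp add: M.M.minus_eq M.M.minus_add flip: M.M.a_assoc)

  interpret Z: left_module K "submodule_of (H n) (cocycles n)" for n
    by (rule left_module.submodule_of_left_module[OF hom_module_left_module[OF F_left_module] cocycles_submodule])
  have Z_carrier: "carrier (submodule_of (H n) (cocycles n)) = cocycles n" for n
    by (simp add: submodule_of_def)

  show "mod_isomorphic K (Ext R B M 0) (submodule_of (restrict_scalars R M) (par_Z0 K G M))"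
    unfolding Ext_def
  proof (rule Z.first_isomorphism[OF coboundaries_submodule])
    \<comment> \<open>The only coboundary in degree zero is zero, so the kernel condition amounts to
      injectivity of this evaluation on cocycles.\<close>
    let ?h = "\<lambda>f. f (\<alpha> 0 (gen []))"
    have n: "[] \<in> tuples G 0" by (simp add: tuples_0)
    note g = \<alpha>c[OF gen_closed[OF n]]
    have \<Phi>0: "\<Phi> 0 f = (\<lambda>gs\<in>tuples G 0. ?h f)" for f by (auto simp: \<Phi>_def tuples_0)
    have Z0: "x \<in> par_Z0 K G M \<longleftrightarrow> x \<in> carrier M \<and> par_delta K G M 0 (\<lambda>gs\<in>tuples G 0. x) = \<zero>\<^bsub>C (Suc 0)\<^esub>" for x
      by (auto simp: par_Z0_def par_delta0_eq)
    have h_Z0: "?h f \<in> par_Z0 K G M" if "f \<in> cocycles 0" for f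
      using \<Phi>_cocycle[OF that] mod_hom_closed[OF Hh[OF cocycleD(1)[OF that]] g] by (simp add: Z0 \<Phi>0)
    show h: "?h \<in> mod_hom K (submodule_of (H 0) (cocycles 0)) (submodule_of (restrict_scalars R M) (par_Z0 K G M))"
      by (rule mod_homI)
        (use h_Z0 g in \<open>auto simp: submodule_of_def restrict_scalars_simps hom_module_simps\<close>)
    show "carrier (submodule_of (restrict_scalars R M) (par_Z0 K G M)) \<subseteq> ?h ` carrier (submodule_of (H 0) (cocycles 0))"
    proof
      fix x assume "x \<in> carrier (submodule_of (restrict_scalars R M) (par_Z0 K G M))"
      then have x: "x \<in> carrier M" "par_delta K G M 0 (\<lambda>gs\<in>tuples G 0. x) = \<zero>\<^bsub>C (Suc 0)\<^esub>"
        by (auto simp: submodule_of_def Z0)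
      let ?c = "\<lambda>gs\<in>tuples G 0. x"
      have c: "?c \<in> carrier (C 0)" using x(1) unfolding C_0 by blast
      note ab = \<beta>c[OF \<alpha>c[OF gen_closed[OF n]]] and lc = mod_hom_closed[OF cochain_lift_hom[OF c]]
      \<comment> \<open>The homotopy identity gives \<open>c \<beta> \<alpha> - c = c d s\<close>,
        which vanishes because \<open>c\<close> is a cocycle.\<close>
      have "cochain_lift ?c (\<beta> 0 (\<alpha> 0 (gen []))) \<ominus>\<^bsub>M\<^esub> cochain_lift ?c (gen []) = \<zero>\<^bsub>M\<^esub>"
        using lift_minus[OF c ab gen_closed[OF n]] s(2)[OF gen_closed[OF n]]
          lift_bd_zero[OF c x(2) sc[OF gen_closed[OF n]]] by simp
      then have "cochain_lift ?c (\<beta> 0 (\<alpha> 0 (gen []))) = x"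
        using eq_of_diff[OF lc[OF ab] lc[OF gen_closed[OF n]]] cochain_lift_gen[OF c n] n by simp
      then have "?h (\<Psi> 0 ?c) = x" using g by (simp add: \<Psi>_def)
      then show "x \<in> ?h ` carrier (submodule_of (H 0) (cocycles 0))"
        unfolding Z_carrier by (intro image_eqI[OF _ \<Psi>[OF c x(2)]]) (rule HOL.sym)
    qed
    \<comment> \<open>For a cocycle, \<open>f \<alpha> \<beta> - f = f d t = 0\<close>; and
      \<open>f \<alpha>\<close> vanishes everywhere once it vanishes on the generator.\<close>
    have inj: "f = \<zero>\<^bsub>H 0\<^esub>" if f: "f \<in> cocycles 0" "?h f = \<zero>\<^bsub>M\<^esub>" for f
    proof (rule extensionalityI[of _ "carrier (F 0)"])
      note fc = mod_hom_closed[OF Hh[OF cocycleD(1)[OF f(1)]]]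
      fix x assume x: "x \<in> carrier (F 0)"
      have "\<Phi> 0 f = \<zero>\<^bsub>C 0\<^esub>" using f(2) by (simp add: \<Phi>0 C_simps)
      then have "f (\<alpha> 0 (\<beta> 0 x)) = \<zero>\<^bsub>M\<^esub>"
        using \<Phi>_lift[OF cocycleD(1)[OF f(1)] \<beta>c[OF x]] cochain_lift_zero[OF \<beta>c[OF x]] by simp
      moreover have "f (\<alpha> 0 (\<beta> 0 x)) \<ominus>\<^bsub>M\<^esub> f x = \<zero>\<^bsub>M\<^esub>"
        using H_minus[OF cocycleD(1)[OF f(1)] \<alpha>c[OF \<beta>c[OF x]] x] t(2)[OF x] cocycleD(2)[OF f(1) tc[OF x]] by simp
      ultimately show "f x = \<zero>\<^bsub>H 0\<^esub> x"
        using eq_of_diff[OF fc[OF \<alpha>c[OF \<beta>c[OF x]]] fc[OF x]] x by (simp add: hom_module_simps)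
    qed (use cocycleD(1)[OF f(1)] in \<open>simp_all add: hom_module_simps\<close>)
    fix f f' assume ff: "f \<in> carrier (submodule_of (H 0) (cocycles 0))" "f' \<in> carrier (submodule_of (H 0) (cocycles 0))"
    let ?d = "f \<ominus>\<^bsub>submodule_of (H 0) (cocycles 0)\<^esub> f'"
    have d: "?d \<in> cocycles 0" using Z.M.minus_closed[OF ff] by (simp add: Z_carrier)
    have z: "?h \<zero>\<^bsub>H 0\<^esub> = \<zero>\<^bsub>M\<^esub>" using g by (simp add: hom_module_simps)
    \<comment> \<open>Since \<open>par_Z0\<close> has not been shown to be a submodule, the
      difference is compared by adding \<open>f'\<close> back and cancelling in
      \<open>M\<close>.\<close>
    have dec: "f = ?d \<oplus>\<^bsub>submodule_of (H 0) (cocycles 0)\<^esub> f'"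
      using ff by (simp add: Z.M.minus_eq Z.M.a_assoc Z.M.l_neg)
    have "?h f = ?h ?d \<oplus>\<^bsub>M\<^esub> ?h f'"
      using mod_hom_add[OF h, of ?d f'] d ff dec by (simp add: submodule_of_def restrict_scalars_simps)
    moreover have "?h ?d \<in> carrier M" "?h f' \<in> carrier M"
      using h_Z0[OF d] h_Z0[of f'] ff by (auto simp: Z0 Z_carrier)
    ultimately have "?h f = ?h f' \<longleftrightarrow> ?h ?d = \<zero>\<^bsub>M\<^esub>" by (simp add: M.M.add.l_cancel_one)
    also have "\<dots> \<longleftrightarrow> ?d \<in> coboundaries 0" using inj[OF d] z by auto
    finally show "?h f = ?h f' \<longleftrightarrow> ?d \<in> coboundaries 0" .
  qed

  let ?Z = "submodule_of (H (Suc l)) (cocycles (Suc l))"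
  let ?Z' = "submodule_of (C (Suc l)) (par_Z K G M (Suc l))" and ?B' = "par_B K G M (Suc l)"
  interpret Z': left_module K ?Z'
    by (rule left_module.submodule_of_left_module[OF C_left_module Z_submodule])
  have Z'_carrier: "carrier ?Z' = par_Z K G M (Suc l)" by (simp add: submodule_of_def)
  have \<Phi>Z: "\<Phi> (Suc l) \<in> mod_hom K ?Z ?Z'"
  proof (rule mod_homI)
    show "\<Phi> (Suc l) f \<in> carrier ?Z'" if "f \<in> carrier ?Z" for f
      unfolding Z'_carrier using that \<Phi>_cocycle mod_hom_closed[OF \<Phi> cocycleD(1)]
      by (simp add: Z_carrier par_Z_def)
  qed (use mod_hom_add[OF \<Phi>] mod_hom_smult[OF \<Phi>] cocycleD(1) in \<open>auto simp: submodule_of_def\<close>)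
  note q = Z'.quot_coset_hom[OF B_submodule]
  \<comment> \<open>For a cocycle \<open>c\<close>, \<open>c d s = 0\<close> turns the homotopy
    identity into \<open>c \<beta> \<alpha> = c + (c s) d\<close>. The last term is a coboundary,
    namely of the cochain \<open>b\<close> formed by the values of \<open>c s\<close> on the
    generators.\<close>
  have surj: "\<exists>f\<in>cocycles (Suc l). \<exists>b\<in>?B'. \<Phi> (Suc l) f = c \<oplus>\<^bsub>C (Suc l)\<^esub> b"
    if "c \<in> par_Z K G M (Suc l)" for c
  proof -
    have c: "c \<in> carrier (C (Suc l))" "par_delta K G M (Suc l) c = \<zero>\<^bsub>C (Suc (Suc l))\<^esub>"
      using that by (auto simp: par_Z_def)
    note lc = mod_hom_closed[OF cochain_lift_hom[OF c(1)]]
    let ?k = "\<lambda>x. cochain_lift c (s l x)"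
    have k: "?k \<in> mod_hom R (chains l) M"
      by (rule mod_hom_compose[OF s(1) cochain_lift_hom[OF c(1)]])
    define b where "b = (\<lambda>gs\<in>tuples G l. ?k (gen gs))"
    have b: "b \<in> carrier (C l)"
    proof -
      have "sg_act K M (exel_es G gs) (?k (gen gs)) = ?k (gen gs)" if "gs \<in> tuples G l" for gs
        using mod_hom_act[OF k es_closed[OF that] gen_closed[OF that]] act_gen[OF that] by simp
      then show ?thesis using mod_hom_closed[OF k gen_closed] by (simp add: C_simps b_def)
    qed
    have "\<Phi> (Suc l) (\<Psi> (Suc l) c) = c \<oplus>\<^bsub>C (Suc l)\<^esub> par_delta K G M l b"
    proof (rule extensionalityI[of _ "tuples G (Suc l)"])
      fix gs assume gs: "gs \<in> tuples G (Suc l)"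
      note g = gen_closed[OF gs]
      let ?ab = "\<beta> (Suc l) (\<alpha> (Suc l) (gen gs))"
      note ab = \<beta>c[OF \<alpha>c[OF g]] and sb = sc[OF bdc[OF g]]
      interpret Ch: left_module R "chains (Suc l)" by (rule chains_left_module)
      have "cochain_lift c ?ab \<ominus>\<^bsub>M\<^esub> cochain_lift c (gen gs) \<ominus>\<^bsub>M\<^esub> ?k (chain_bd l (gen gs)) =
          cochain_lift c (chain_bd (Suc l) (s (Suc l) (gen gs)))"
        unfolding s(3)[OF g] using ab sb g by (simp add: lift_minus[OF c(1)])
      also have "\<dots> = \<zero>\<^bsub>M\<^esub>" by (rule lift_bd_zero[OF c sc[OF g]])
      finally have "cochain_lift c ?ab \<ominus>\<^bsub>M\<^esub> cochain_lift c (gen gs) = ?k (chain_bd l (gen gs))"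
        by (rule eq_of_diff[OF M.M.minus_closed[OF lc[OF ab] lc[OF g]] lc[OF sb]])
      then have "cochain_lift c ?ab = cochain_lift c (gen gs) \<oplus>\<^bsub>M\<^esub> ?k (chain_bd l (gen gs))"
        by (rule add_of_diff[OF lc[OF ab] lc[OF g]])
      moreover have "?k (chain_bd l (gen gs)) = par_delta K G M l b gs"
        by (rule hom_chain_bd[OF k gs]) (simp add: b_def)
      ultimately show "\<Phi> (Suc l) (\<Psi> (Suc l) c) gs = (c \<oplus>\<^bsub>C (Suc l)\<^esub> par_delta K G M l b) gs"
        using gs \<alpha>c[OF g] by (simp add: \<Phi>_def \<Psi>_def C_simps cochain_lift_gen[OF c(1) gs])
    qed (simp_all add: \<Phi>_def C_simps)
    moreover have "par_delta K G M l b \<in> ?B'" unfolding par_B_Suc using b by blast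
    ultimately show ?thesis using \<Psi>[OF c] by blast
  qed
  have ker: "\<Phi> (Suc l) f \<in> ?B' \<longleftrightarrow> f \<in> coboundaries (Suc l)" if f: "f \<in> cocycles (Suc l)" for f
  proof
    assume "\<Phi> (Suc l) f \<in> ?B'"
    then obtain c where c: "c \<in> carrier (C l)" "\<Phi> (Suc l) f = par_delta K G M l c"
      unfolding par_B_Suc by blast
    note lc = mod_hom_closed[OF cochain_lift_hom[OF c(1)]] and fc = mod_hom_closed[OF Hh[OF cocycleD(1)[OF f]]]
    \<comment> \<open>Here \<open>f \<alpha> = c d\<close>, hence
      \<open>f \<alpha> \<beta> = c \<beta> d\<close>, and the cocycle condition gives
      \<open>f \<alpha> \<beta> - f - f t d = f d t = 0\<close>. So
      \<open>f = (c \<beta> - f t) d\<close>, which dictates the choice of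
      \<open>?k\<close>.\<close>
    let ?k = "\<lambda>x. cochain_lift c (\<beta> l x) \<ominus>\<^bsub>M\<^esub> f (t l x)"
    have "?k \<in> mod_hom R (F l) M"
      by (rule M.minus_hom[OF F_left_module mod_hom_compose[OF \<beta>(1) cochain_lift_hom[OF c(1)]]
            mod_hom_compose[OF t(1) Hh[OF cocycleD(1)[OF f]]]])
    then have k: "restrict ?k (carrier (F l)) \<in> carrier (H l)" by (rule restrict_mod_hom[OF F_left_module])
    have "f = Ext_diff R B l (restrict ?k (carrier (F l)))"
    proof (rule extensionalityI[of _ "carrier (F (Suc l))"])
      fix x assume x: "x \<in> carrier (F (Suc l))"
      note ab = \<alpha>c[OF \<beta>c[OF x]] and td = tc[OF dc[OF x]]
      interpret Fm: left_module R "F (Suc l)" by (rule F_left_module)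
      have "f (\<alpha> (Suc l) (\<beta> (Suc l) x)) = cochain_lift c (\<beta> l (res_diff R B l x))"
        using \<Phi>_lift[OF cocycleD(1)[OF f] \<beta>c[OF x]] cochain_lift_bd[OF c(1) \<beta>c[OF x]] \<beta>(2)[OF x] c(2) by simp
      moreover have "f (\<alpha> (Suc l) (\<beta> (Suc l) x)) \<ominus>\<^bsub>M\<^esub> f x \<ominus>\<^bsub>M\<^esub> f (t l (res_diff R B l x)) = \<zero>\<^bsub>M\<^esub>"
        using cocycleD(2)[OF f tc[OF x]] t(3)[OF x] ab td x by (simp add: H_minus[OF cocycleD(1)[OF f]])
      ultimately have *: "cochain_lift c (\<beta> l (res_diff R B l x)) \<ominus>\<^bsub>M\<^esub> f x = f (t l (res_diff R B l x))"
        by (intro eq_of_diff[OF M.M.minus_closed[OF lc[OF \<beta>c[OF dc[OF x]]] fc[OF x]] fc[OF td]]) simp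
      then have "f x = cochain_lift c (\<beta> l (res_diff R B l x)) \<ominus>\<^bsub>M\<^esub> f (t l (res_diff R B l x))"
        by (rule diff_of_diff[OF lc[OF \<beta>c[OF dc[OF x]]] fc[OF x]])
      then show "f x = Ext_diff R B l (restrict ?k (carrier (F l))) x"
        using x dc[OF x] by (simp add: Ext_diff_def)
    qed (use cocycleD(1)[OF f] in \<open>simp_all add: hom_module_simps Ext_diff_def\<close>)
    then show "f \<in> coboundaries (Suc l)" using k by auto
  next
    assume "f \<in> coboundaries (Suc l)"
    then obtain g where "g \<in> carrier (H l)" "f = Ext_diff R B l g" by auto
    then show "\<Phi> (Suc l) f \<in> ?B'" using \<Phi>_diff mod_hom_closed[OF \<Phi>] unfolding par_B_Suc by auto
  qed
  show "mod_isomorphic K (Ext R B M (Suc l)) (quot_module ?Z' ?B')"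
    unfolding Ext_def
  proof (rule Z.first_isomorphism[OF coboundaries_submodule mod_hom_compose[OF \<Phi>Z q]])
    show "carrier (quot_module ?Z' ?B') \<subseteq> (\<lambda>f. ?B' +>\<^bsub>?Z'\<^esub> \<Phi> (Suc l) f) ` carrier ?Z"
    proof
      fix X assume "X \<in> carrier (quot_module ?Z' ?B')"
      then obtain c where c: "c \<in> carrier ?Z'" "X = ?B' +>\<^bsub>?Z'\<^esub> c"
        unfolding Z'.quot_carrier[OF B_submodule] by blast
      then obtain f b where f: "f \<in> cocycles (Suc l)" "b \<in> ?B'" "\<Phi> (Suc l) f = c \<oplus>\<^bsub>?Z'\<^esub> b"
        using surj[of c] by (auto simp: submodule_of_def)
      have b: "b \<in> carrier ?Z'" using Z'.left_submoduleD(1)[OF B_submodule] f(2) by blast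
      have "\<Phi> (Suc l) f \<ominus>\<^bsub>?Z'\<^esub> c \<in> ?B'"
        unfolding f(3) using c(1) b f(2) by (simp add: Z'.M.minus_eq Z'.M.a_ac Z'.M.r_neg)
      then have "?B' +>\<^bsub>?Z'\<^esub> \<Phi> (Suc l) f = X"
        using Z'.quot_coset_eq_iff[OF B_submodule mod_hom_closed[OF \<Phi>Z] c(1), of f] f(1) c(2) by (simp add: Z_carrier)
      then show "X \<in> (\<lambda>f. ?B' +>\<^bsub>?Z'\<^esub> \<Phi> (Suc l) f) ` carrier ?Z" using f(1) unfolding Z_carrier by blast
    qed
    fix f f' assume ff: "f \<in> carrier ?Z" "f' \<in> carrier ?Z"
    have "?B' +>\<^bsub>?Z'\<^esub> \<Phi> (Suc l) f = ?B' +>\<^bsub>?Z'\<^esub> \<Phi> (Suc l) f' \<longleftrightarrow>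
        \<Phi> (Suc l) (f \<ominus>\<^bsub>?Z\<^esub> f') \<in> ?B'"
      using Z'.quot_coset_eq_iff[OF B_submodule mod_hom_closed[OF \<Phi>Z ff(1)] mod_hom_closed[OF \<Phi>Z ff(2)]]
        mod_hom_diff[OF Z.left_module_axioms Z'.left_module_axioms \<Phi>Z ff] by simp
    also have "\<dots> \<longleftrightarrow> f \<ominus>\<^bsub>?Z\<^esub> f' \<in> coboundaries (Suc l)"
      using ker[of "f \<ominus>\<^bsub>?Z\<^esub> f'"] Z.M.minus_closed[OF ff] by (simp add: Z_carrier)
    finally show "?B' +>\<^bsub>?Z'\<^esub> \<Phi> (Suc l) f = ?B' +>\<^bsub>?Z'\<^esub> \<Phi> (Suc l) f' \<longleftrightarrow>
        f \<ominus>\<^bsub>?Z\<^esub> f' \<in> coboundaries (Suc l)" .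
  qed
qed

end

end

theorem theorem2p21:
  fixes K :: "('k, 'y) ring_scheme"
    and G :: "('g, 'x) monoid_scheme"
    and M :: "('g list set \<Rightarrow> 'k, 'm, 'z) module_scheme"
  assumes "cring K" and "group G" and "left_module (K_par K G) M"
  shows "mod_isomorphic K (H_par K G M 0)
      (submodule_of (restrict_scalars (K_par K G) M) (par_Z0 K G M)) \<and>
    (\<forall>n\<ge>1. mod_isomorphic K (H_par K G M n)
      (quot_module (submodule_of (par_cochains K G M n) (par_Z K G M n)) (par_B K G M n)))"
proof -
  interpret partial_group_algebra G K
    using assms(1,2) by (simp add: partial_group_algebra_def partial_group_algebra_axioms_def exel_def)
  note iso = Ext_cochains[OF assms(3)]
  show ?thesis
  proof (intro conjI allI impI)
    fix n :: nat assume "1 \<le> n"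
    then obtain l where "n = Suc l" by (cases n) auto
    then show "mod_isomorphic K (H_par K G M n)
        (quot_module (submodule_of (par_cochains K G M n) (par_Z K G M n)) (par_B K G M n))"
      using iso(2)[of l] by (simp add: H_par_def)
  qed (use iso(1) in \<open>simp add: H_par_def\<close>)
qed

end
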